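(* Fix $D\ge2$ and bounded sequences $\mathbf{p}_1,\dots,\mathbf{p}_D$ defining a $D$-parameter Vilenkin filtration $\{\mathcal{F}_n\}_{n\in\mathbb{Z}_+^D}$ on $[0,1)^D$. Let $V$ be a linear operator taking $D$-parameter Vilenkin martingales into measurable functions on $[0,1)^D$. Assume the following. 1) $V:\mathfrak{L}^2\to L^2$ is bounded. 2) For any $D$-parameter Vilenkin martingale $f$ such that $f_0=0$ and, for all $n\in\mathbb{Z}_+^D$, $$\Delta_n f=\mathbf{1}_{e_n}\Delta_n f\quad\text{for some } e_n\in\mathcal{F}_{n-\mathbf{1}},$$ we have $\{|Vf|>0\}\subseteq\bigcup_{n\in\mathbb{Z}_+^D\setminus\{0\}}e_n$. Then $V:\mathfrak{H}^p\to L^p$ is bounded for any $0<p\le1$, and $V:\mathfrak{L}^r\to L^r$ is bounded for $1<r\le2$.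
   Context: $\mathbb{Z}_+=\{0,1,2,\dots\}$. For $n,m\in\mathbb{Z}_+^D$, $n\le m$ means $n_d\le m_d$ for all $d$; $n-\mathbf{1}$ denotes the vector with components $(n-\mathbf{1})_d=\max(n_d-1,0)$. $\mathbf{1}_e$ is the indicator function of $e$. For $d=1,\dots,D$, $\mathbf{p}_d=\{p^{(d)}_n\}_{n\in\mathbb{N}}$ is a sequence of integers $p^{(d)}_n\ge2$ that is bounded ($\sup_n p^{(d)}_n<\infty$); $P^{(d)}_0=1$, $P^{(d)}_n=p^{(d)}_1\cdots p^{(d)}_n$. The $D$-parameter Vilenkin filtration consists of the $\sigma$-algebras $\mathcal{F}_n$, $n\in\mathbb{Z}_+^D$, generated by the rectangles $\prod_{d=1}^D\big[l_d/P^{(d)}_{n_d},(l_d+1)/P^{(d)}_{n_d}\big)$, $0\le l_d<P^{(d)}_{n_d}$. $\mathbb{E}_n$ is the conditional expectation (with respect to Lebesgue measure) onto $\mathcal{F}_n$. A $D$-parameter Vilenkin martingale is a family $f=\{f_n\}_{n\in\mathbb{Z}_+^D}$ of integrable functions on $[0,1)^D$ with $f_n$ being $\mathcal{F}_n$-measurable and $\mathbb{E}_nf_m=f_n$ whenever $n\le m$. For a martingale, $\mathbb{E}_nf:=f_n$ and $$\Delta_nf=\sum_{\varepsilon_1,\dots,\varepsilon_D\in\{0,1\}}(-1)^{\varepsilon_1+\dots+\varepsilon_D}f_{n_1-\varepsilon_1,\dots,n_D-\varepsilon_D},$$ where terms with some index equal to $-1$ are taken to be zero. $\mathfrak{L}^p$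 is the space of martingales with $\|f\|_{\mathfrak{L}^p}=\sup_n\|f_n\|_{L^p}<\infty$. $\mathfrak{H}^p$ is the space of martingales with $\|f\|_{\mathfrak{H}^p}=\big\|\big(\sum_{n\in\mathbb{Z}_+^D}|\Delta_nf|^2\big)^{1/2}\big\|_{L^p}<\infty$. $L^p=L^p([0,1)^D)$. *)

theory Defs
  imports "HOL-Probability.Probability"
begin

text \<open>
  The number \<open>D\<close> of parameters is \<open>CARD('d)\<close>; multi-indices are functions \<open>'d \<Rightarrow> nat\<close> with the
  pointwise order. Functions are complex-valued, and \<open>[0,1)\<^sup>D\<close> carries the Lebesgue
  \<open>\<sigma>\<close>-algebra.
\<close>

definition unit_cube :: "(real^'d::finite) set" where
  "unit_cube = {x. \<forall>d. 0 \<le> x $ d \<and> x $ d < 1}"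

abbreviation cube_measure :: "(real^'d::finite) measure" where
  "cube_measure \<equiv> lebesgue_on unit_cube"


section \<open>\<open>L\<^sup>p\<close> (quasi-)norms with values in \<open>[0,\<infinity>]\<close>\<close>

text \<open>The power \<open>x\<^sup>a\<close> of an extended nonnegative real, meant for \<open>a > 0\<close> only.\<close>

definition epowr :: "ennreal \<Rightarrow> real \<Rightarrow> ennreal" where
  "epowr x a = (if x = \<infinity> then \<infinity> else ennreal (enn2real x powr a))"

definition eLp_norm :: "'a measure \<Rightarrow> real \<Rightarrow> ('a \<Rightarrow> ennreal) \<Rightarrow> ennreal" where
  "eLp_norm M q g = epowr (\<integral>\<^sup>+ x. epowr (g x) q \<partial>M) (1 / q)"

definition Lp_norm :: "'a measure \<Rightarrow> real \<Rightarrow> ('a \<Rightarrow> complex) \<Rightarrow> ennreal" where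
  "Lp_norm M q g = eLp_norm M q (\<lambda>x. ennreal (norm (g x)))"


section \<open>Vilenkin filtrations\<close>

text \<open>Sequences are indexed from \<open>1\<close>; the value at \<open>0\<close> is irrelevant.\<close>

definition vilenkin_sequence :: "(nat \<Rightarrow> nat) \<Rightarrow> bool" where
  "vilenkin_sequence s \<longleftrightarrow> (\<forall>n\<ge>1. 2 \<le> s n) \<and> (\<exists>B. \<forall>n\<ge>1. s n \<le> B)"

definition vilenkin_prod :: "(nat \<Rightarrow> nat) \<Rightarrow> nat \<Rightarrow> nat" where
  "vilenkin_prod s n = (\<Prod>k=1..n. s k)"

definition vilenkin_rectangle ::
  "('d::finite \<Rightarrow> nat \<Rightarrow> nat) \<Rightarrow> ('d \<Rightarrow> nat) \<Rightarrow> ('d \<Rightarrow> nat) \<Rightarrow> (real^'d) set" where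
  "vilenkin_rectangle p n l =
     {x. \<forall>d. real (l d) / real (vilenkin_prod (p d) (n d)) \<le> x $ d \<and>
             x $ d < (real (l d) + 1) / real (vilenkin_prod (p d) (n d))}"

text \<open>Only \<open>space\<close> and \<open>sets\<close> of the following measures matter (their measure is \<open>0\<close>).\<close>

definition vilenkin_filtration ::
  "('d::finite \<Rightarrow> nat \<Rightarrow> nat) \<Rightarrow> ('d \<Rightarrow> nat) \<Rightarrow> (real^'d) measure" where
  "vilenkin_filtration p n =
     sigma unit_cube {vilenkin_rectangle p n l | l. \<forall>d. l d < vilenkin_prod (p d) (n d)}"

text \<open>Conditional expectation of complex functions, by real and imaginary parts.\<close>

definition complex_cond_exp ::
  "'a measure \<Rightarrow> 'a measure \<Rightarrow> ('a \<Rightarrow> complex) \<Rightarrow> 'a \<Rightarrow> complex" where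
  "complex_cond_exp M F g x =
     Complex (real_cond_exp M F (\<lambda>y. Re (g y)) x) (real_cond_exp M F (\<lambda>y. Im (g y)) x)"


section \<open>Vilenkin martingales\<close>

text \<open>
  Functions on \<open>[0,1)\<^sup>D\<close> are represented by functions on \<open>\<real>\<^sup>D\<close>. The members of a martingale are
  required to vanish off the cube, which makes the representation unique.
\<close>

definition vilenkin_martingales ::
  "('d::finite \<Rightarrow> nat \<Rightarrow> nat) \<Rightarrow> (('d \<Rightarrow> nat) \<Rightarrow> real^'d \<Rightarrow> complex) set" where
  "vilenkin_martingales p = {f.
     (\<forall>n. integrable cube_measure (f n) \<and>
          f n \<in> borel_measurable (vilenkin_filtration p n) \<and>
          (\<forall>x. x \<notin> unit_cube \<longrightarrow> f n x = 0)) \<and>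
     (\<forall>n m. n \<le> m \<longrightarrow>
          (AE x in cube_measure.
             complex_cond_exp cube_measure (vilenkin_filtration p n) (f m) x = f n x))}"

text \<open>The \<open>\<epsilon> \<in> {0,1}\<^sup>D\<close> with \<open>\<not> \<epsilon> \<le> n\<close> are those for which \<open>n - \<epsilon>\<close> has a component \<open>-1\<close>.\<close>

definition mart_diff ::
  "('d::finite \<Rightarrow> nat) \<Rightarrow> (('d \<Rightarrow> nat) \<Rightarrow> 'a \<Rightarrow> complex) \<Rightarrow> 'a \<Rightarrow> complex" where
  "mart_diff n f x =
     (\<Sum>\<epsilon> \<in> UNIV \<rightarrow>\<^sub>E {0, 1}.
        (-1) ^ (\<Sum>d\<in>UNIV. \<epsilon> d) * (if \<epsilon> \<le> n then f (\<lambda>d. n d - \<epsilon> d) x else 0))"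

definition mart_L_norm ::
  "real \<Rightarrow> (('d::finite \<Rightarrow> nat) \<Rightarrow> real^'d \<Rightarrow> complex) \<Rightarrow> ennreal" where
  "mart_L_norm q f = (SUP n. Lp_norm cube_measure q (f n))"

definition square_function ::
  "(('d::finite \<Rightarrow> nat) \<Rightarrow> 'a \<Rightarrow> complex) \<Rightarrow> 'a \<Rightarrow> ennreal" where
  "square_function f x = epowr (\<Sum>\<^sub>\<infinity>n\<in>UNIV. ennreal ((norm (mart_diff n f x))\<^sup>2)) (1 / 2)"

definition mart_H_norm ::
  "real \<Rightarrow> (('d::finite \<Rightarrow> nat) \<Rightarrow> real^'d \<Rightarrow> complex) \<Rightarrow> ennreal" where
  "mart_H_norm q f = eLp_norm cube_measure q (square_function f)"

definition mart_L_space ::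
  "('d::finite \<Rightarrow> nat \<Rightarrow> nat) \<Rightarrow> real \<Rightarrow> (('d \<Rightarrow> nat) \<Rightarrow> real^'d \<Rightarrow> complex) set" where
  "mart_L_space p q = {f \<in> vilenkin_martingales p. mart_L_norm q f < \<infinity>}"

definition mart_H_space ::
  "('d::finite \<Rightarrow> nat \<Rightarrow> nat) \<Rightarrow> real \<Rightarrow> (('d \<Rightarrow> nat) \<Rightarrow> real^'d \<Rightarrow> complex) set" where
  "mart_H_space p q = {f \<in> vilenkin_martingales p. mart_H_norm q f < \<infinity>}"


section \<open>Operators on martingales\<close>

text \<open>
  Measurable functions are identified when equal almost everywhere, so linearity is required
  almost everywhere.
\<close>

definition martingale_operator ::
  "('d::finite \<Rightarrow> nat \<Rightarrow> nat) \<Rightarrow>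
   ((('d \<Rightarrow> nat) \<Rightarrow> real^'d \<Rightarrow> complex) \<Rightarrow> real^'d \<Rightarrow> complex) \<Rightarrow> bool" where
  "martingale_operator p V \<longleftrightarrow>
     (\<forall>f \<in> vilenkin_martingales p. V f \<in> borel_measurable cube_measure) \<and>
     (\<forall>f \<in> vilenkin_martingales p. \<forall>g \<in> vilenkin_martingales p.
        AE x in cube_measure. V (\<lambda>n y. f n y + g n y) x = V f x + V g x) \<and>
     (\<forall>c. \<forall>f \<in> vilenkin_martingales p.
        AE x in cube_measure. V (\<lambda>n y. c * f n y) x = c * V f x)"

definition bounded_operator_on ::
  "'f set \<Rightarrow> ('f \<Rightarrow> ennreal) \<Rightarrow> ('g \<Rightarrow> ennreal) \<Rightarrow> ('f \<Rightarrow> 'g) \<Rightarrow> bool" where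
  "bounded_operator_on X N N' V \<longleftrightarrow> (\<exists>C::real. \<forall>f\<in>X. N' (V f) \<le> ennreal C * N f)"

end

theory Submission
  imports Defs
begin

text \<open>Both boundedness assertions follow from one weak estimate, valid for every martingale \<open>f\<close> with
square function \<open>S\<close> and every \<open>t > 0\<close>:
\<open>|{|Vf| > t}| \<le> K (|{S > t}| + t\<^sup>-\<^sup>2 \<integral>\<^bsub>{S \<le> t}\<^esub> S\<^sup>2)\<close>.
Integrating it against \<open>q t\<^bsup>q-1\<^esup> dt\<close> gives \<open>\<parallel>Vf\<parallel>\<^sub>q \<le> C \<parallel>S\<parallel>\<^sub>q\<close> for all \<open>0 < q < 2\<close>
(\<open>truncated_estimate_integral\<close>). For \<open>q \<le> 1\<close> this is the bound on the Hardy space. For \<open>1 < q < 2\<close>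
it is combined with the square function inequality \<open>\<parallel>S\<parallel>\<^sub>q \<le> C sup\<^sub>n \<parallel>f\<^sub>n\<parallel>\<^sub>q\<close>
(\<open>square_function_le_martingale\<close>), and for \<open>q = 2\<close> the bound is the hypothesis on \<open>V\<close>.

The weak estimate (\<open>truncated_weak_estimate\<close>) comes from a Calderon-Zygmund type splitting \<open>f = g + h\<close>
at the set \<open>\<Omega> = {S > t}\<close>. Let \<open>e\<^sub>n\<close> be the union of the cells of level \<open>n - 1\<close> in which \<open>\<Omega>\<close> has density
more than \<open>\<theta>\<close>, and let \<open>h\<close> have the differences \<open>1\<^bsub>e\<^sub>n\<^esub> \<Delta>\<^sub>n f\<close>. The support hypothesis confines \<open>Vh\<close> to
the union of the \<open>e\<^sub>n\<close>, whose measure is at most \<open>C |\<Omega>|\<close> by the strong maximal inequality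
(\<open>strong_maximal_weak_type\<close>). Because the sequences defining the filtration are bounded, a suitable
\<open>\<theta>\<close> makes \<open>\<Omega>\<close> occupy at most half of every cell of level \<open>n\<close> outside \<open>e\<^sub>n\<close>; since \<open>|\<Delta>\<^sub>n f|\<^sup>2\<close> is
constant on those cells, its integral over the complement of \<open>e\<^sub>n\<close> is at most twice its integral over
the complement of \<open>e\<^sub>n\<close> and \<open>\<Omega>\<close>. Summing over \<open>n\<close> and using orthogonality,
\<open>\<parallel>g\<parallel>\<^sub>2\<^sup>2 \<le> 2 \<integral>\<^bsub>{S \<le> t}\<^esub> S\<^sup>2\<close> (\<open>good_part_L2\<close>), so the boundedness of \<open>V\<close> on \<open>L\<^sup>2\<close> and Chebyshev's
inequality handle \<open>Vg\<close>. Each height \<open>t\<close> has its own splitting into two pieces, to which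
the linearity of \<open>V\<close> applies directly; this takes the place of an infinite atomic decomposition.

The multi-parameter inequalities are obtained by applying one-parameter inequalities in one
coordinate after the other. This works because the filtration has a product structure: averaging a
function of level \<open>m\<close> over the cells of level \<open>n\<close> is the same as averaging it over the cells of level
\<open>inf n m\<close> (\<open>avg_step_inf\<close>). In one parameter, Doob's inequality (\<open>doob_maximal\<close>) and the square
function inequality for finite systems of martingales (\<open>square_function_chain\<close>) are integrated
pathwise inequalities, in which the martingale property only serves to annihilate linear terms. The
square function inequality is needed for systems, with norm \<open>sqrt (\<Sum>\<^sub>i |X\<^sub>i|\<^sup>2)\<close>, because after
the first coordinate has been treated there is one martingale for each index in that coordinate.\<close>

section \<open>Cells of the Vilenkin grid\<close>

text \<open>The half-open box lies between the open and the closed box with the same corners, which have the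
same measure.\<close>

lemma half_open_box:
  fixes a b :: "'d::finite \<Rightarrow> real"
  assumes ab: "\<And>d. a d < b d"
  defines "H \<equiv> {y :: real^'d. \<forall>d. a d \<le> y $ d \<and> y $ d < b d}"
  shows "H \<in> sets borel" "emeasure lborel H = ennreal (\<Prod>d\<in>UNIV. b d - a d)"
proof -
  have "{y :: real^'d. a d \<le> y $ d \<and> y $ d < b d} \<in> sets borel" for d
  proof -
    have "(\<lambda>y :: real^'d. y $ d) \<in> borel_measurable borel"
      by (intro borel_measurable_continuous_onI continuous_intros)
    from measurable_sets[OF this, of "{a d..<b d}"] show ?thesis
      by (simp add: vimage_def)
  qed
  then have "(\<Inter>d. {y :: real^'d. a d \<le> y $ d \<and> y $ d < b d}) \<in> sets borel"
    by (intro sets.finite_INT) auto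
  moreover have "(\<Inter>d. {y :: real^'d. a d \<le> y $ d \<and> y $ d < b d}) = H"
    by (auto simp: H_def)
  ultimately show H: "H \<in> sets borel" by simp
  let ?A = "(\<chi> d. a d) :: real^'d" and ?B = "(\<chi> d. b d) :: real^'d"
  have nonempty: "cbox ?A ?B \<noteq> {}"
    using ab by (simp add: interval_ne_empty_cart less_imp_le)
  have le: "\<forall>i\<in>Basis. ?A \<bullet> i \<le> ?B \<bullet> i"
    using nonempty by (simp add: box_ne_empty)
  have c: "emeasure lborel (cbox ?A ?B) = ennreal (\<Prod>d\<in>UNIV. b d - a d)"
    using content_cbox_cart[OF nonempty]
    by (subst emeasure_eq_ennreal_measure) (auto simp: emeasure_lborel_cbox_eq)
  have bx: "emeasure lborel (box ?A ?B) = emeasure lborel (cbox ?A ?B)"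
    using le by (simp add: emeasure_lborel_box_eq emeasure_lborel_cbox_eq)
  have "box ?A ?B \<subseteq> H" "H \<subseteq> cbox ?A ?B"
    by (auto simp: H_def mem_box_cart less_imp_le)
  then have "emeasure lborel (box ?A ?B) \<le> emeasure lborel H"
    "emeasure lborel H \<le> emeasure lborel (cbox ?A ?B)"
    using H by (auto intro!: emeasure_mono)
  then show "emeasure lborel H = ennreal (\<Prod>d\<in>UNIV. b d - a d)"
    using c bx by simp
qed

lemma unit_cube_lmeasurable:
  "(unit_cube :: (real^'d::finite) set) \<in> sets lebesgue"
  "emeasure lebesgue (unit_cube :: (real^'d::finite) set) = 1"
proof -
  have eq: "unit_cube = {y :: real^'d. \<forall>d. 0 \<le> y $ d \<and> y $ d < 1}"
    by (simp add: unit_cube_def)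
  show "(unit_cube :: (real^'d::finite) set) \<in> sets lebesgue"
    using half_open_box(1)[of "\<lambda>d::'d. 0" "\<lambda>d. 1"] unfolding eq by simp
  show "emeasure lebesgue (unit_cube :: (real^'d::finite) set) = 1"
    using half_open_box[of "\<lambda>d::'d. 0" "\<lambda>d. 1"] unfolding eq by simp
qed

lemma space_cube [simp]: "space cube_measure = unit_cube"
  by (simp add: space_restrict_space)

lemma prob_space_cube: "prob_space (cube_measure :: (real^'d::finite) measure)"
  by (rule prob_spaceI) (simp add: unit_cube_lmeasurable emeasure_restrict_space)

lemma vilenkin_prod_Suc: "vilenkin_prod s (Suc n) = vilenkin_prod s n * s (Suc n)"
  by (simp add: vilenkin_prod_def mult.commute)

lemma vilenkin_prod_dvd: "n \<le> m \<Longrightarrow> vilenkin_prod s n dvd vilenkin_prod s m"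
  by (induction m rule: dec_induct) (auto simp: vilenkin_prod_Suc)

lemma vilenkin_prod_pos:
  assumes "vilenkin_sequence s" shows "0 < vilenkin_prod s n"
proof -
  have "0 < s k" if "k \<ge> 1" for k
    using assms that by (force simp: vilenkin_sequence_def)
  then show ?thesis by (auto simp: vilenkin_prod_def intro!: prod_pos)
qed

locale vilenkin_system =
  fixes p :: "'d::finite \<Rightarrow> nat \<Rightarrow> nat"
  assumes vil: "\<And>d. vilenkin_sequence (p d)"
begin

sublocale cube: prob_space "cube_measure :: (real^'d) measure"
  by (rule prob_space_cube)

abbreviation W :: "'d \<Rightarrow> nat \<Rightarrow> nat" where "W d \<equiv> vilenkin_prod (p d)"

lemma W_pos: "0 < W d k" by (rule vilenkin_prod_pos[OF vil])

definition idx :: "('d \<Rightarrow> nat) \<Rightarrow> real^'d \<Rightarrow> 'd \<Rightarrow> int" where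
  "idx n x d = \<lfloor>real (W d (n d)) * x $ d\<rfloor>"

text \<open>The cell of level \<open>n\<close> that contains \<open>x\<close>. Describing the rectangles by the integers \<open>idx n x\<close>, and not by
their corners, reduces the nesting of levels to integer division.\<close>

definition cell :: "('d \<Rightarrow> nat) \<Rightarrow> real^'d \<Rightarrow> (real^'d) set" where
  "cell n x = {y \<in> unit_cube. \<forall>d. idx n y d = idx n x d}"

definition vol :: "('d \<Rightarrow> nat) \<Rightarrow> real" where
  "vol n = (\<Prod>d\<in>UNIV. 1 / real (W d (n d)))"

lemma vol_pos: "0 < vol n"
  unfolding vol_def by (intro prod_pos) (simp add: W_pos)

lemma idx_cong_coord: "n d = m d \<Longrightarrow> x $ d = y $ d \<Longrightarrow> idx n x d = idx m y d"
  by (simp add: idx_def)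

text \<open>Coarsening drops the last digits of a Vilenkin expansion.\<close>

lemma idx_coarse:
  assumes "n d \<le> m d"
  shows "idx n x d = idx m x d div int (W d (m d) div W d (n d))"
proof -
  obtain k where k: "W d (m d) = W d (n d) * k"
    using vilenkin_prod_dvd[OF assms, of "p d"] by (elim dvdE)
  then have kp: "k > 0" using W_pos[of d "m d"] by (cases k) auto
  have "real (W d (n d)) * x $ d = real (W d (m d)) * x $ d / real_of_int (int k)"
    using kp by (simp add: k field_simps)
  then have "idx n x d = \<lfloor>real (W d (m d)) * x $ d / real_of_int (int k)\<rfloor>"
    by (simp add: idx_def)
  also have "\<dots> = idx m x d div int k"
    by (subst floor_divide_real_eq_div) (auto simp: idx_def)
  finally show ?thesis using W_pos[of d "n d"] by (simp add: k)
qed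

lemma idx_mono: "n d \<le> m d \<Longrightarrow> idx m x d = idx m y d \<Longrightarrow> idx n x d = idx n y d"
  using idx_coarse[of n d m x] idx_coarse[of n d m y] by simp

lemma cell_subset: "cell n x \<subseteq> unit_cube"
  by (auto simp: cell_def)

lemma cell_cube: "y \<in> cell n x \<Longrightarrow> y \<in> unit_cube"
  by (auto simp: cell_def)

lemma cell_self: "x \<in> unit_cube \<Longrightarrow> x \<in> cell n x"
  by (auto simp: cell_def)

lemma cell_eq: "y \<in> cell n x \<Longrightarrow> cell n y = cell n x"
  by (auto simp: cell_def)

lemma cell_antimono: "n \<le> m \<Longrightarrow> cell m x \<subseteq> cell n x"
  unfolding cell_def le_fun_def by (blast intro: idx_mono)

lemma cell_Int_same: "cell n x \<inter> cell m x = cell (sup n m) x"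
proof
  show "cell (sup n m) x \<subseteq> cell n x \<inter> cell m x"
    using cell_antimono[of n "sup n m" x] cell_antimono[of m "sup n m" x] by auto
  show "cell n x \<inter> cell m x \<subseteq> cell (sup n m) x"
  proof
    fix y assume y: "y \<in> cell n x \<inter> cell m x"
    have "idx (sup n m) y d = idx (sup n m) x d" for d
    proof (cases "n d \<le> m d")
      case True
      then have "idx (sup n m) z d = idx m z d" for z
        by (intro idx_cong_coord) (auto simp: sup_nat_def)
      then show ?thesis using y by (auto simp: cell_def)
    next
      case False
      then have "idx (sup n m) z d = idx n z d" for z
        by (intro idx_cong_coord) (auto simp: sup_nat_def)
      then show ?thesis using y by (auto simp: cell_def)
    qed
    then show "y \<in> cell (sup n m) x" using y by (auto simp: cell_def)
  qed
qed

text \<open>In each coordinate one of the two cells fills the common cell of level \<open>inf n m\<close>, so a common point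
can be chosen coordinate by coordinate. This is the product structure of the filtration.\<close>

lemma cell_meet:
  assumes x: "x \<in> unit_cube" and y: "y \<in> cell (inf n m) x"
  shows "\<exists>z. z \<in> cell n x \<and> z \<in> cell m y"
proof -
  define z :: "real^'d" where "z = (\<chi> d. if m d \<le> n d then x $ d else y $ d)"
  have zc: "z \<in> unit_cube"
    using x cell_cube[OF y] by (auto simp: z_def unit_cube_def)
  have inf_idx: "idx (inf n m) y d = idx (inf n m) x d" for d using y by (auto simp: cell_def)
  have "idx n z d = idx n x d \<and> idx m z d = idx m y d" for d
  proof (cases "m d \<le> n d")
    case True
    then have 1: "idx k z d = idx k x d" for k by (intro idx_cong_coord) (auto simp: z_def)
    have 2: "idx (inf n m) w d = idx m w d" for w
      using True by (intro idx_cong_coord) (auto simp: inf_nat_def)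
    show ?thesis using 1 2 inf_idx[of d] by simp
  next
    case False
    then have 1: "idx k z d = idx k y d" for k by (intro idx_cong_coord) (auto simp: z_def)
    have 2: "idx (inf n m) w d = idx n w d" for w
      using False by (intro idx_cong_coord) (auto simp: inf_nat_def)
    show ?thesis using 1 2 inf_idx[of d] by simp
  qed
  then show ?thesis using zc by (auto simp: cell_def)
qed

lemma idx_range:
  assumes "x \<in> unit_cube" shows "0 \<le> idx n x d" "idx n x d < int (W d (n d))"
proof -
  have x: "0 \<le> x $ d" "x $ d < 1" using assms by (auto simp: unit_cube_def)
  show "0 \<le> idx n x d" using x by (simp add: idx_def)
  show "idx n x d < int (W d (n d))"
    using x W_pos[of d "n d"] by (simp add: idx_def floor_less_iff)
qed

lemma cell_eq_half_open_box:
  assumes "x \<in> unit_cube"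
  shows "cell n x = {y. \<forall>d. real_of_int (idx n x d) / real (W d (n d)) \<le> y $ d \<and>
           y $ d < (real_of_int (idx n x d) + 1) / real (W d (n d))}" (is "_ = ?H")
proof (intro set_eqI iffI)
  fix y assume y: "y \<in> cell n x"
  show "y \<in> ?H"
  proof (safe)
    fix d
    have "\<lfloor>real (W d (n d)) * y $ d\<rfloor> = idx n x d" using y by (auto simp: cell_def idx_def)
    then have "real_of_int (idx n x d) \<le> real (W d (n d)) * y $ d"
      "real (W d (n d)) * y $ d < real_of_int (idx n x d) + 1" by linarith+
    then show "real_of_int (idx n x d) / real (W d (n d)) \<le> y $ d"
      "y $ d < (real_of_int (idx n x d) + 1) / real (W d (n d))"
      using W_pos[of d "n d"] by (auto simp: field_simps)
  qed
next
  fix y assume y: "y \<in> ?H"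
  have b: "real_of_int (idx n x d) \<le> real (W d (n d)) * y $ d"
    "real (W d (n d)) * y $ d < real_of_int (idx n x d) + 1" for d
  proof -
    have W: "real (W d (n d)) > 0" using W_pos by simp
    have 1: "real_of_int (idx n x d) / real (W d (n d)) \<le> y $ d"
      "y $ d < (real_of_int (idx n x d) + 1) / real (W d (n d))" using y by auto
    show "real_of_int (idx n x d) \<le> real (W d (n d)) * y $ d"
      "real (W d (n d)) * y $ d < real_of_int (idx n x d) + 1"
      using 1 W by (auto simp: field_simps)
  qed
  have "idx n y d = idx n x d" for d
    using b[of d] by (subst idx_def) linarith
  moreover have "0 \<le> y $ d \<and> y $ d < 1" for d
  proof
    have W: "real (W d (n d)) > 0" using W_pos by simp
    have "0 \<le> real (W d (n d)) * y $ d"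
      using b(1)[of d] idx_range(1)[OF assms, of n d] by linarith
    then show "0 \<le> y $ d" using W by (simp add: zero_le_mult_iff)
    have "real_of_int (idx n x d) + 1 \<le> real (W d (n d))"
      using idx_range(2)[OF assms, of n d] by linarith
    then have "real (W d (n d)) * y $ d < real (W d (n d)) * 1"
      using b(2)[of d] by linarith
    then show "y $ d < 1" using W by (simp only: mult_less_cancel_left_pos)
  qed
  ultimately show "y \<in> cell n x" by (auto simp: cell_def unit_cube_def)
qed

lemma cell_borel: "x \<in> unit_cube \<Longrightarrow> cell n x \<in> sets borel"
  and emeasure_lborel_cell: "x \<in> unit_cube \<Longrightarrow> emeasure lborel (cell n x) = ennreal (vol n)"
proof -
  assume x: "x \<in> unit_cube"
  have lt: "real_of_int (idx n x d) / real (W d (n d))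
      < (real_of_int (idx n x d) + 1) / real (W d (n d))" for d
    using W_pos[of d "n d"] by (simp add: divide_strict_right_mono)
  have w: "(real_of_int (idx n x d) + 1) / real (W d (n d)) - real_of_int (idx n x d) / real (W d (n d))
    = 1 / real (W d (n d))" for d
    by (simp add: diff_divide_distrib[symmetric])
  note h = half_open_box[of "\<lambda>d. real_of_int (idx n x d) / real (W d (n d))"
      "\<lambda>d. (real_of_int (idx n x d) + 1) / real (W d (n d))", OF lt]
  show "cell n x \<in> sets borel" using h(1) by (simp add: cell_eq_half_open_box[OF x])
  show "emeasure lborel (cell n x) = ennreal (vol n)"
    using h(2) unfolding cell_eq_half_open_box[OF x] w vol_def .
qed

lemma cell_sets [measurable]: "x \<in> unit_cube \<Longrightarrow> cell n x \<in> sets cube_measure"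
  using cell_borel[of x n] cell_subset[of n x]
  by (auto simp: sets_restrict_space_iff unit_cube_lmeasurable)

lemma measure_cell: "x \<in> unit_cube \<Longrightarrow> measure cube_measure (cell n x) = vol n"
proof -
  assume x: "x \<in> unit_cube"
  have "emeasure cube_measure (cell n x) = ennreal (vol n)"
    using cell_borel[OF x, of n] cell_subset[of n x] emeasure_lborel_cell[OF x, of n]
    by (subst emeasure_restrict_space) (auto simp: unit_cube_lmeasurable)
  then show ?thesis using vol_pos[of n] by (simp add: measure_def less_imp_le)
qed

text \<open>In each coordinate, the maximum and the minimum of the two levels are the two levels in some order.\<close>

lemma vol_sup_inf: "vol (sup n m) * vol (inf n m) = vol n * vol m"
  unfolding vol_def prod.distrib[symmetric]
  by (intro prod.cong) (auto simp: sup_nat_def inf_nat_def max_def min_def)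

lemma vilenkin_rectangle_eq_cell:
  assumes l: "\<And>d. l d < W d (n d)"
  obtains x where "x \<in> unit_cube" "vilenkin_rectangle p n l = cell n x" "\<And>d. idx n x d = int (l d)"
proof -
  define x :: "real^'d" where "x = (\<chi> d. real (l d) / real (W d (n d)))"
  have x: "x \<in> unit_cube"
    using l W_pos by (auto simp: unit_cube_def x_def)
  have i: "idx n x d = int (l d)" for d
    using W_pos[of d "n d"] by (simp add: idx_def x_def)
  show ?thesis
    by (rule that[OF x _ i]) (simp add: cell_eq_half_open_box[OF x] i vilenkin_rectangle_def)
qed

lemma cell_eq_vilenkin_rectangle:
  assumes "x \<in> unit_cube"
  shows "cell n x = vilenkin_rectangle p n (\<lambda>d. nat (idx n x d))"
    "\<And>d. nat (idx n x d) < W d (n d)"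
  using idx_range[OF assms, of n] by (auto simp: cell_eq_half_open_box[OF assms] vilenkin_rectangle_def nat_less_iff)

definition cells :: "('d \<Rightarrow> nat) \<Rightarrow> (real^'d) set set" where
  "cells n = cell n ` unit_cube"

lemma finite_cells: "finite (cells n)"
proof -
  have "cells n \<subseteq> (\<lambda>i. {y \<in> unit_cube. \<forall>d. idx n y d = i d}) ` (PiE UNIV (\<lambda>d. {0..<int (W d (n d))}))"
    unfolding cells_def using idx_range by (auto simp: cell_def image_iff PiE_iff Bex_def)
  moreover have "finite (PiE (UNIV::'d set) (\<lambda>d. {0..<int (W d (n d))}))"
    by (intro finite_PiE) auto
  ultimately show ?thesis by (meson finite_imageI finite_subset)
qed

lemma generators_eq_cells:
  "{vilenkin_rectangle p n l | l. \<forall>d. l d < vilenkin_prod (p d) (n d)} = cells n"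
proof -
  have "vilenkin_rectangle p n l \<in> cells n" if "\<forall>d. l d < W d (n d)" for l
    by (rule vilenkin_rectangle_eq_cell[of l n]) (use that in \<open>auto simp: cells_def\<close>)
  then show ?thesis
    using cell_eq_vilenkin_rectangle unfolding cells_def by blast
qed

section \<open>Functions that are constant on cells\<close>

text \<open>Measurability with respect to the finite \<open>\<sigma>\<close>-algebra of level \<open>n\<close>, in a form that is visibly preserved
by all pointwise operations.\<close>

definition step :: "('d \<Rightarrow> nat) \<Rightarrow> (real^'d \<Rightarrow> 'b) \<Rightarrow> bool" where
  "step n g \<longleftrightarrow> (\<forall>x\<in>unit_cube. \<forall>y\<in>cell n x. g y = g x)"

lemma stepD: "step n g \<Longrightarrow> x \<in> unit_cube \<Longrightarrow> y \<in> cell n x \<Longrightarrow> g y = g x"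
  by (auto simp: step_def)

lemma step_mono: "step n g \<Longrightarrow> n \<le> m \<Longrightarrow> step m g"
  unfolding step_def using cell_antimono by blast

lemma step_const: "step n (\<lambda>x. c)"
  by (simp add: step_def)

lemma step_comp: "step n g \<Longrightarrow> step n (\<lambda>x. F (g x))"
  by (simp add: step_def)

lemma step_comp2: "step n g \<Longrightarrow> step n h \<Longrightarrow> step n (\<lambda>x. F (g x) (h x))"
  by (simp add: step_def)

lemma step_sum: "(\<And>i. i \<in> I \<Longrightarrow> step n (g i)) \<Longrightarrow> step n (\<lambda>x. \<Sum>i\<in>I. g i x)"
  by (simp add: step_def)

lemma step_cell: "step n (\<lambda>x. F (cell n x))"
  using cell_eq by (simp add: step_def)

lemma step_indicator: "step n (\<lambda>x. x \<in> A) \<Longrightarrow> step n (indicator A)"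
  by (auto simp: step_def indicator_def)

lemma sets_filtration: "sets (vilenkin_filtration p n) = sigma_sets unit_cube (cells n)"
  "space (vilenkin_filtration p n) = unit_cube"
proof -
  have "cells n \<subseteq> Pow unit_cube" by (auto simp: cells_def cell_def)
  then show "sets (vilenkin_filtration p n) = sigma_sets unit_cube (cells n)"
    "space (vilenkin_filtration p n) = unit_cube"
    by (simp_all add: vilenkin_filtration_def generators_eq_cells)
qed

text \<open>The cells of a level are a finite partition, so its \<open>\<sigma>\<close>-algebra consists of the unions of cells.\<close>

lemma sets_filtration_iff:
  "A \<in> sets (vilenkin_filtration p n) \<longleftrightarrow> A \<subseteq> unit_cube \<and> step n (\<lambda>x. x \<in> A)"
proof
  assume "A \<in> sets (vilenkin_filtration p n)"
  then have "A \<in> sigma_sets unit_cube (cells n)" by (simp add: sets_filtration)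
  then show "A \<subseteq> unit_cube \<and> step n (\<lambda>x. x \<in> A)"
  proof induction
    case (Basic a)
    then obtain z where z: "z \<in> unit_cube" "a = cell n z" by (auto simp: cells_def)
    have "y \<in> cell n z \<longleftrightarrow> x \<in> cell n z" if "x \<in> unit_cube" "y \<in> cell n x" for x y
      using that by (auto simp: cell_def)
    then show ?case using z cell_subset by (auto simp: step_def)
  next
    case (Compl a)
    then show ?case by (auto simp: step_def cell_cube)
  qed (auto simp: step_def)
next
  assume A: "A \<subseteq> unit_cube \<and> step n (\<lambda>x. x \<in> A)"
  have "A = \<Union>{R \<in> cells n. R \<subseteq> A}"
  proof
    show "A \<subseteq> \<Union>{R \<in> cells n. R \<subseteq> A}"
    proof
      fix x assume x: "x \<in> A"
      then have "x \<in> unit_cube" using A by auto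
      then have "cell n x \<in> cells n" "x \<in> cell n x"
        using cell_self unfolding cells_def by blast+
      moreover have "cell n x \<subseteq> A"
        using A x \<open>x \<in> unit_cube\<close> unfolding step_def by blast
      ultimately show "x \<in> \<Union>{R \<in> cells n. R \<subseteq> A}" by blast
    qed
  qed blast
  moreover have "\<Union>{R \<in> cells n. R \<subseteq> A} \<in> sets (vilenkin_filtration p n)"
    by (rule sets.finite_Union) (auto simp: finite_cells sets_filtration)
  ultimately show "A \<in> sets (vilenkin_filtration p n)" by simp
qed

lemma subalgebra_filtration: "subalgebra cube_measure (vilenkin_filtration p n)"
proof -
  have "cells n \<subseteq> sets cube_measure" by (auto simp: cells_def)
  then have "sigma_sets unit_cube (cells n) \<subseteq> sets cube_measure"
    using sets.sigma_sets_subset[of "cells n" cube_measure] by simp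
  then show ?thesis by (simp add: subalgebra_def sets_filtration)
qed

lemma step_measurable_filtration:
  fixes g :: "real^'d \<Rightarrow> 'b::topological_space"
  shows "step n g \<Longrightarrow> g \<in> measurable (vilenkin_filtration p n) borel"
proof (rule measurableI)
  fix A :: "'b set" assume g: "step n g"
  have "g -` A \<inter> unit_cube \<subseteq> unit_cube \<and> step n (\<lambda>x. x \<in> g -` A \<inter> unit_cube)"
    using g cell_cube unfolding step_def by fastforce
  then show "g -` A \<inter> space (vilenkin_filtration p n) \<in> sets (vilenkin_filtration p n)"
    unfolding sets_filtration_iff sets_filtration(2) .
qed simp

lemma step_iff_measurable:
  fixes g :: "real^'d \<Rightarrow> 'b::t1_space"
  shows "g \<in> borel_measurable (vilenkin_filtration p n) \<longleftrightarrow> step n g"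
proof
  assume g: "g \<in> borel_measurable (vilenkin_filtration p n)"
  show "step n g"
  proof (unfold step_def, intro ballI)
    fix x y :: "real^'d" assume x: "x \<in> unit_cube" and y: "y \<in> cell n x"
    have "g -` {g x} \<inter> unit_cube \<in> sets (vilenkin_filtration p n)"
      using measurable_sets[OF g, of "{g x}"] by (simp add: sets_filtration(2))
    then show "g y = g x" using x y by (auto simp: sets_filtration_iff step_def)
  qed
qed (rule step_measurable_filtration)

lemma step_measurable: "step n g \<Longrightarrow> g \<in> measurable cube_measure borel"
  by (rule measurable_from_subalg[OF subalgebra_filtration step_measurable_filtration])

text \<open>Such a function takes only finitely many values on the cube.\<close>

lemma step_bounded:
  fixes g :: "real^'d \<Rightarrow> 'b::real_normed_vector"
  assumes "step n g" obtains C where "\<And>x. x \<in> unit_cube \<Longrightarrow> norm (g x) \<le> C"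
proof -
  have "g ` unit_cube \<subseteq> (\<lambda>R. g (SOME x. x \<in> R)) ` cells n"
  proof
    fix v assume "v \<in> g ` unit_cube"
    then obtain x where x: "x \<in> unit_cube" "v = g x" by auto
    have "(SOME y. y \<in> cell n x) \<in> cell n x" using cell_self[OF x(1)] by (rule someI)
    then have "g (SOME y. y \<in> cell n x) = g x" using assms x by (auto simp: step_def)
    then show "v \<in> (\<lambda>R. g (SOME x. x \<in> R)) ` cells n"
      using x by (intro image_eqI[of _ _ "cell n x"]) (auto simp: cells_def)
  qed
  then have "finite (g ` unit_cube)" using finite_cells finite_surj by blast
  then have "bdd_above ((\<lambda>x. norm (g x)) ` unit_cube)"
    by (metis finite_imageI image_image bdd_above_finite)
  then show ?thesis using that by (auto simp: bdd_above_def)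
qed

lemma step_integrable:
  fixes g :: "real^'d \<Rightarrow> 'b::{banach,second_countable_topology}"
  assumes "step n g" shows "integrable cube_measure g"
proof -
  obtain C where "\<And>x. x \<in> unit_cube \<Longrightarrow> norm (g x) \<le> C" using step_bounded[OF assms] by metis
  then show ?thesis
    using step_measurable[OF assms] by (intro cube.integrable_const_bound[of _ C]) auto
qed

lemma step_integrable_mult:
  fixes g u :: "real^'d \<Rightarrow> 'b::{real_normed_algebra,banach,second_countable_topology}"
  assumes "step n g" "integrable cube_measure u" shows "integrable cube_measure (\<lambda>x. g x * u x)"
proof -
  obtain C where C: "\<And>x. x \<in> unit_cube \<Longrightarrow> norm (g x) \<le> C" using step_bounded[OF assms(1)] by metis
  note [measurable] = step_measurable[OF assms(1)] borel_measurable_integrable[OF assms(2)]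
  show ?thesis
  proof (rule Bochner_Integration.integrable_bound)
    show "integrable cube_measure (\<lambda>x. C * norm (u x))" using assms(2) by auto
    show "AE x in cube_measure. norm (g x * u x) \<le> norm (C * norm (u x))"
    proof (rule AE_I2)
      fix x :: "real^'d" assume "x \<in> space cube_measure"
      then have "norm (g x) \<le> C" using C by simp
      then have "norm (g x) * norm (u x) \<le> C * norm (u x)" by (intro mult_right_mono) auto
      then show "norm (g x * u x) \<le> norm (C * norm (u x))"
        using norm_mult_ineq[of "g x" "u x"] by (auto intro: order_trans[OF _ abs_ge_self])
    qed
  qed simp
qed

lemma integral_over_cells:
  fixes u :: "real^'d \<Rightarrow> 'b::{banach,second_countable_topology}"
  assumes u: "integrable cube_measure u"
  shows "(\<integral>x. u x \<partial>cube_measure) = (\<Sum>R\<in>cells n. \<integral>x\<in>R. u x \<partial>cube_measure)"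
proof -
  have s: "R \<in> sets cube_measure" if "R \<in> cells n" for R using that by (auto simp: cells_def)
  have "(\<integral>x. u x \<partial>cube_measure) = (\<integral>x. (\<Sum>R\<in>cells n. indicator R x *\<^sub>R u x) \<partial>cube_measure)"
  proof (rule Bochner_Integration.integral_cong[OF refl])
    fix x :: "real^'d" assume "x \<in> space cube_measure"
    then have x: "x \<in> unit_cube" by simp
    have "(\<Sum>R\<in>cells n. indicator R x *\<^sub>R u x) = (\<Sum>R\<in>{cell n x}. indicator R x *\<^sub>R u x)"
    proof (rule sum.mono_neutral_right[OF finite_cells])
      show "{cell n x} \<subseteq> cells n" using x by (auto simp: cells_def)
      show "\<forall>R\<in>cells n - {cell n x}. indicator R x *\<^sub>R u x = 0"
        using cell_eq[of x n] by (auto simp: cells_def indicator_def)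
    qed
    then show "u x = (\<Sum>R\<in>cells n. indicator R x *\<^sub>R u x)" using cell_self[OF x] by simp
  qed
  also have "\<dots> = (\<Sum>R\<in>cells n. \<integral>x. indicator R x *\<^sub>R u x \<partial>cube_measure)"
    using s u by (intro Bochner_Integration.integral_sum integrable_mult_indicator) auto
  finally show ?thesis by (simp add: set_lebesgue_integral_def)
qed

end

section \<open>Inequalities between powers\<close>

text \<open>After expanding, this is Young's inequality for the mixed term \<open>a powr (r - 1) * b\<close>. It is a discrete
form of \<open>(r - 1) / r d(s\<^sup>r) = s d(s\<^bsup>r-1\<^esup>)\<close>.\<close>

lemma powr_gap_le:
  fixes a b r :: real
  assumes r: "1 < r" and a: "0 \<le> a" and ab: "a \<le> b"
  shows "(r - 1) / r * (b powr r - a powr r) \<le> (b powr (r - 1) - a powr (r - 1)) * b"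
proof -
  have b: "0 \<le> b" using a ab by simp
  define q where "q = r / (r - 1)"
  have "a powr (r - 1) * b \<le> (a powr (r - 1)) powr q / q + b powr r / r"
  proof (rule Youngs_inequality)
    show "1 < q" using r by (simp add: q_def field_simps)
    show "1 / q + 1 / r = 1" using r by (simp add: q_def field_simps)
  qed (use r b in auto)
  also have "(a powr (r - 1)) powr q = a powr r" using r by (simp add: powr_powr q_def)
  also have "a powr r / q = (r - 1) / r * a powr r" by (simp add: q_def)
  finally have "a powr (r - 1) * b \<le> (r - 1) / r * a powr r + b powr r / r" .
  moreover have "b powr (r - 1) * b = b powr r"
    using b by (cases "b = 0") (auto simp: powr_diff)
  moreover have "(r - 1) / r * b powr r + b powr r / r = b powr r"
    using r by (simp add: field_simps)
  ultimately show ?thesis by (simp add: algebra_simps)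
qed

text \<open>A weighted Young inequality with explicit constants: either \<open>y \<le> e * s\<close>, and the first term suffices,
or \<open>s \<le> y / e\<close>, and the second one does.\<close>

lemma powr_mult_le_split:
  fixes s y e r :: real
  assumes r: "1 < r" and s: "0 \<le> s" and y: "0 \<le> y" and e: "0 < e"
  shows "s powr (r - 1) * y \<le> e * s powr r + e powr (1 - r) * y powr r"
proof (cases "y \<le> e * s")
  case True
  have "s powr (r - 1) * s = s powr r" using s by (cases "s = 0") (auto simp: powr_diff)
  then have "s powr (r - 1) * y \<le> e * s powr r"
    using mult_left_mono[OF True, of "s powr (r - 1)"] by (simp add: algebra_simps)
  then show ?thesis by (simp add: add_increasing2)
next
  case False
  then have ypos: "0 < y" using s e by (meson le_less_trans mult_nonneg_nonneg less_imp_le not_le)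
  have "s \<le> y / e" using False e by (simp add: field_simps)
  then have "s powr (r - 1) \<le> (y / e) powr (r - 1)" using r s by (intro powr_mono2) auto
  then have "s powr (r - 1) * y \<le> (y / e) powr (r - 1) * y" using y by (rule mult_right_mono)
  also have "\<dots> = e powr (1 - r) * y powr r"
    using ypos e by (simp add: powr_divide powr_diff field_simps)
  finally show ?thesis using e by (simp add: add_increasing)
qed

text \<open>The second derivative \<open>r (r - 1) t\<^bsup>r-2\<^esup>\<close> of \<open>t\<^sup>r\<close> decreases in \<open>t\<close> for \<open>r \<le> 2\<close>, so on the interval
between \<open>a\<close> and \<open>b\<close> it is at least its value at \<open>M\<close>. The cases \<open>a = 0\<close> and \<open>b = 0\<close>, where \<open>t\<^sup>r\<close> need not be
twice differentiable, are treated separately.\<close>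

lemma powr_taylor_lower:
  fixes a b M r :: real
  assumes r: "1 < r" "r \<le> 2" and a: "0 \<le> a" and b: "0 \<le> b" and M: "a \<le> M" "b \<le> M"
  shows "r * (r - 1) / 2 * M powr (r - 2) * (b - a)\<^sup>2
         \<le> b powr r - a powr r - r * a powr (r - 1) * (b - a)"
proof -
  let ?k = "r * (r - 1) / 2"
  have k: "0 \<le> ?k" using r by simp
  have k1: "?k \<le> r - 1"
  proof -
    have "r * (r - 1) \<le> 2 * (r - 1)" using r by (intro mult_right_mono) auto
    then show ?thesis by simp
  qed
  have sq: "t powr (r - 2) * t\<^sup>2 = t powr r" if "0 \<le> t" for t
  proof (cases "t = 0")
    case False
    then have "t\<^sup>2 = t powr 2" using that by (simp add: powr_numeral)
    then show ?thesis by (simp add: powr_add[symmetric])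
  qed simp
  have sq1: "t powr (r - 1) * t = t powr r" if "0 \<le> t" for t
    using that by (cases "t = 0") (auto simp: powr_diff)
  have M0: "0 \<le> M" using a M by simp
  have Mr: "M powr (r - 2) \<le> t powr (r - 2)" if "0 < t" "t \<le> M" for t
    using that r by (intro powr_mono2') auto
  consider "a = 0" | "b = 0" "0 < a" | "a = b" | "0 < a" "0 < b" "a \<noteq> b" using a b by linarith
  then show ?thesis
  proof cases
    case 1
    have "M powr (r - 2) * b\<^sup>2 \<le> b powr r"
    proof (cases "b = 0")
      case False
      then show ?thesis using Mr[of b] sq[OF b] b M by (metis less_le mult_right_mono zero_le_power2)
    qed simp
    then have "?k * (M powr (r - 2) * b\<^sup>2) \<le> 1 * b powr r"
      using k k1 r by (intro mult_mono) auto
    then show ?thesis using 1 r by (simp add: mult.assoc)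
  next
    case 2
    have "M powr (r - 2) * a\<^sup>2 \<le> a powr r"
      using Mr[of a] sq[OF a] 2 M by (metis mult_right_mono zero_le_power2)
    then have "?k * (M powr (r - 2) * a\<^sup>2) \<le> (r - 1) * a powr r"
      using k k1 r by (intro mult_mono) auto
    then show ?thesis using 2 r sq1[OF a] by (simp add: mult.assoc algebra_simps)
  next
    case 3 then show ?thesis by simp
  next
    case 4
    define diff :: "nat \<Rightarrow> real \<Rightarrow> real" where
      "diff = (\<lambda>m t. if m = 0 then t powr r else if m = 1 then r * t powr (r - 1)
                else r * ((r - 1) * t powr (r - 2)))"
    have "\<exists>t. (if b < a then b < t \<and> t < a else a < t \<and> t < b) \<and>
      b powr r = (\<Sum>m<2. diff m a / fact m * (b - a)^m) + diff 2 t / fact 2 * (b - a)^2"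
    proof (rule Taylor[where a = "min a b" and b = "max a b"])
      show "\<forall>m t. m < 2 \<and> min a b \<le> t \<and> t \<le> max a b \<longrightarrow> DERIV (diff m) t :> diff (Suc m) t"
      proof (intro allI impI)
        fix m :: nat and t :: real assume mt: "m < 2 \<and> min a b \<le> t \<and> t \<le> max a b"
        then have t: "0 < t" using 4 by (auto simp: min_def split: if_splits)
        consider "m = 0" | "m = 1" using mt by linarith
        then show "DERIV (diff m) t :> diff (Suc m) t"
        proof cases
          case 1
          then show ?thesis using t by (auto simp: diff_def intro!: derivative_eq_intros)
        next
          case 2
          then show ?thesis using t
            by (auto simp: diff_def intro!: derivative_eq_intros)
        qed
      qed
    qed (use 4 in \<open>auto simp: diff_def fun_eq_iff\<close>)
    then obtain t where t: "if b < a then b < t \<and> t < a else a < t \<and> t < b"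
      and eq: "b powr r = (\<Sum>m<2. diff m a / fact m * (b - a)^m) + diff 2 t / fact 2 * (b - a)^2"
      by blast
    have "0 < t" "t \<le> M" using t M 4 by (auto split: if_splits)
    then have "?k * (M powr (r - 2) * (b - a)\<^sup>2) \<le> ?k * (t powr (r - 2) * (b - a)\<^sup>2)"
      using Mr[of t] k by (intro mult_left_mono mult_right_mono) auto
    also have "\<dots> = b powr r - a powr r - r * a powr (r - 1) * (b - a)"
    proof -
      define D where "D = b - a"
      show ?thesis using eq unfolding D_def[symmetric]
        by (simp add: diff_def numeral_2_eq_2)
    qed
    finally show ?thesis by (simp add: mult.assoc)
  qed
qed

text \<open>The same bound for the \<open>r\<close>-th power of a Hilbert space norm, with \<open>a\<close>, \<open>b\<close> the norms of two vectors and
\<open>c\<close> their inner product, so that \<open>a\<^sup>2 + b\<^sup>2 - 2 c\<close> is the squared distance. For \<open>a > 0\<close> the right-hand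
side minus the left-hand side is affine and nonincreasing in \<open>c\<close>, so the worst case is \<open>c = a b\<close>, which
is the scalar bound.\<close>

lemma powr_taylor_lower_inner:
  fixes a b c M r :: real
  assumes r: "1 < r" "r \<le> 2" and a: "0 \<le> a" and b: "0 \<le> b" and M: "a \<le> M" "b \<le> M"
    and c: "\<bar>c\<bar> \<le> a * b"
  shows "r * (r - 1) / 2 * M powr (r - 2) * (a\<^sup>2 + b\<^sup>2 - 2 * c)
         \<le> b powr r - a powr r - r * a powr (r - 2) * (c - a\<^sup>2)"
proof (cases "a = 0")
  case True
  then show ?thesis using powr_taylor_lower[OF r a b M] c r by simp
next
  case False
  then have a: "0 < a" using a by simp
  have Mr: "M powr (r - 2) \<le> a powr (r - 2)" using a M r by (intro powr_mono2') auto
  have "r * (r - 1) * M powr (r - 2) \<le> r * 1 * a powr (r - 2)"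
    using Mr r by (intro mult_mono) auto
  then have "(a * b - c) * (r * (r - 1) * M powr (r - 2)) \<le> (a * b - c) * (r * a powr (r - 2))"
    using c by (intro mult_left_mono) auto
  moreover have "r * a powr (r - 1) * (b - a) = r * (a powr (r - 2) * a) * (b - a)"
    using a by (simp add: powr_diff power2_eq_square powr_numeral)
  moreover have "r * (r - 1) / 2 * M powr (r - 2) * (a\<^sup>2 + b\<^sup>2 - 2 * c)
    = r * (r - 1) / 2 * M powr (r - 2) * (b - a)\<^sup>2 + (a * b - c) * (r * (r - 1) * M powr (r - 2))"
    by (simp add: field_simps power2_eq_square)
  moreover have "r * (a powr (r - 2) * a) * (b - a) - r * a powr (r - 2) * (c - a\<^sup>2)
    = (a * b - c) * (r * a powr (r - 2))"
    by (simp add: algebra_simps power2_eq_square)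
  moreover note powr_taylor_lower[OF r less_imp_le[OF a] b M]
  ultimately show ?thesis by linarith
qed

text \<open>This takes the place of Hoelder's inequality in the square function estimate: where \<open>S \<le> s\<close> the first
term suffices, and elsewhere \<open>S\<^bsup>r-2\<^esup> \<le> s\<^bsup>r-2\<^esup>\<close>.\<close>

lemma powr_le_split:
  fixes s S r :: real
  assumes r: "0 < r" "r \<le> 2" and "0 \<le> s" "0 \<le> S" and "s = 0 \<Longrightarrow> S = 0"
  shows "S powr r \<le> s powr r + s powr (r - 2) * S\<^sup>2"
proof (cases "S \<le> s")
  case True
  then have "S powr r \<le> s powr r" using assms by (intro powr_mono2) auto
  then show ?thesis by (simp add: add_increasing2)
next
  case False
  then have s: "0 < s" "s \<le> S" using assms by (cases "s = 0"; simp)+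
  have "S powr r = S powr (r - 2) * S\<^sup>2"
    using s by (simp add: powr_diff powr_numeral)
  also have "\<dots> \<le> s powr (r - 2) * S\<^sup>2"
    using s r by (intro mult_right_mono powr_mono2') auto
  finally show ?thesis by (simp add: add_increasing)
qed

primrec runmax :: "(nat \<Rightarrow> 'a \<Rightarrow> real) \<Rightarrow> nat \<Rightarrow> 'a \<Rightarrow> real" where
  "runmax Y 0 x = Y 0 x"
| "runmax Y (Suc k) x = max (runmax Y k x) (Y (Suc k) x)"

lemma runmax_ge: "j \<le> k \<Longrightarrow> Y j x \<le> runmax Y k x"
  by (induction k) (auto simp: le_Suc_eq max_def)

lemma runmax_nonneg: "(\<And>k. 0 \<le> Y k x) \<Longrightarrow> 0 \<le> runmax Y k x"
  using runmax_ge[of 0 k Y x] by (meson order_trans le0)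

text \<open>Summation by parts: the running maximum increases only at times when it equals \<open>Y\<close>, and there
\<open>powr_gap_le\<close> bounds the increment of its \<open>r\<close>-th power.\<close>

lemma pathwise_maximal:
  assumes r: "1 < r" and Y: "\<And>k. 0 \<le> Y k x"
  shows "(r - 1) / r * runmax Y K x powr r + (\<Sum>k<K. runmax Y k x powr (r - 1) * (Y (Suc k) x - Y k x))
    \<le> runmax Y K x powr (r - 1) * Y K x"
proof (induction K)
  case 0
  have "Y 0 x powr (r - 1) * Y 0 x = Y 0 x powr r"
    using Y[of 0] by (cases "Y 0 x = 0") (auto simp: powr_diff)
  moreover have "(r - 1) / r * Y 0 x powr r \<le> 1 * Y 0 x powr r"
    using r by (intro mult_right_mono) (auto simp: field_simps)
  ultimately show ?case by simp
next
  case (Suc K)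
  let ?s = "runmax Y K x" and ?t = "runmax Y (Suc K) x"
  have s: "0 \<le> ?s" using Y by (rule runmax_nonneg)
  have "(r - 1) / r * (?t powr r - ?s powr r) \<le> (?t powr (r - 1) - ?s powr (r - 1)) * Y (Suc K) x"
  proof (cases "Y (Suc K) x \<le> ?s")
    case False
    then have t: "?t = Y (Suc K) x" by simp
    show ?thesis unfolding t using False by (intro powr_gap_le[OF r s]) auto
  qed (simp add: max_def)
  then show ?case using Suc by (simp only: sum.lessThan_Suc) (simp add: algebra_simps)
qed

text \<open>The optimal constant in Doob's inequality is \<open>(r / (r - 1)) powr r\<close>. The additional factor \<open>2\<close> comes
from absorbing half of the left-hand side by \<open>powr_mult_le_split\<close>.\<close>

definition doob_const :: "real \<Rightarrow> real" where
  "doob_const r = (2 * r / (r - 1)) powr r"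

text \<open>In this form the last sum has nonnegative expectation for a submartingale, because its coefficients
are nonnegative and known at time \<open>k\<close>; Doob's inequality is what remains.\<close>

lemma pathwise_maximal_powr:
  assumes r: "1 < r" and Y: "\<And>k. 0 \<le> Y k x"
  shows "runmax Y K x powr r \<le> doob_const r * Y K x powr r
    - 2 * r / (r - 1) * (\<Sum>k<K. runmax Y k x powr (r - 1) * (Y (Suc k) x - Y k x))"
proof -
  \<comment> \<open>Half of the coefficient \<open>(r - 1) / r\<close>, so that the term \<open>e s\<^sup>r\<close> can be absorbed.\<close>
  define e where "e = (r - 1) / (2 * r)"
  have e: "0 < e" using r by (simp add: e_def)
  let ?Z = "\<Sum>k<K. runmax Y k x powr (r - 1) * (Y (Suc k) x - Y k x)"
  have "(r - 1) / r * runmax Y K x powr r + ?Z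
      \<le> e * runmax Y K x powr r + e powr (1 - r) * Y K x powr r"
    using pathwise_maximal[of r Y x K, OF r Y]
      powr_mult_le_split[OF r runmax_nonneg[of Y x K, OF Y] Y[of K] e] by linarith
  moreover have "(r - 1) / r = 2 * e" using r by (simp add: e_def field_simps)
  ultimately have "e * runmax Y K x powr r \<le> e powr (1 - r) * Y K x powr r - ?Z" by simp
  then have "runmax Y K x powr r \<le> (e powr (1 - r) * Y K x powr r - ?Z) / e"
    using e by (simp add: pos_le_divide_eq mult.commute)
  also have "\<dots> = e powr (- r) * Y K x powr r - ?Z / e"
  proof -
    have "e powr (1 - r) / e = e powr (1 - r) / e powr 1" using e by simp
    also have "\<dots> = e powr (- r)" using powr_diff[of e "1 - r" 1] by simp
    finally show ?thesis by (simp add: diff_divide_distrib times_divide_eq_left[symmetric] del: times_divide_eq_left)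
  qed
  also have "e powr (- r) = doob_const r"
  proof -
    have "inverse e = 2 * r / (r - 1)" by (simp add: e_def)
    then show ?thesis using e by (simp add: doob_const_def powr_minus inverse_powr[symmetric])
  qed
  also have "?Z / e = 2 * r / (r - 1) * ?Z" by (simp add: e_def)
  finally show ?thesis .
qed

context vilenkin_system
begin

section \<open>Averages over cells\<close>

text \<open>A version of the conditional expectation onto level \<open>n\<close> that is defined at every point.\<close>

definition avg :: "('d \<Rightarrow> nat) \<Rightarrow> (real^'d \<Rightarrow> 'b::{real_normed_field,banach,second_countable_topology}) \<Rightarrow> real^'d \<Rightarrow> 'b" where
  "avg n u x = (\<integral>y\<in>cell n x. u y \<partial>cube_measure) /\<^sub>R vol n"

lemma step_avg: "step n (avg n u)"
  unfolding avg_def by (rule step_cell)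

lemma integral_cell_step:
  fixes u :: "real^'d \<Rightarrow> 'b::{real_normed_field,banach,second_countable_topology}"
  assumes g: "step m g" and x: "x \<in> unit_cube" and A: "A \<in> sets cube_measure"
  shows "(\<integral>y\<in>cell m x. indicator A y *\<^sub>R g y \<partial>cube_measure)
    = measure cube_measure (cell m x \<inter> A) *\<^sub>R (g x :: 'b)"
proof -
  have "(\<integral>y\<in>cell m x. indicator A y *\<^sub>R g y \<partial>cube_measure)
    = (\<integral>y. indicator (cell m x \<inter> A) y *\<^sub>R g x \<partial>cube_measure)"
    unfolding set_lebesgue_integral_def
    by (intro Bochner_Integration.integral_cong refl)
       (auto simp: indicator_def stepD[OF g x])
  also have "\<dots> = (\<integral>y. indicator (cell m x \<inter> A) y \<partial>cube_measure) *\<^sub>R g x"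
    using A x by (intro integral_scaleR_left) (auto simp: cube.emeasure_finite less_top[symmetric])
  also have "(\<integral>y. indicator (cell m x \<inter> A) y \<partial>cube_measure) = measure cube_measure (cell m x \<inter> A)"
    using cell_subset[of m x] by (simp add: Int_absorb2 le_infI1)
  finally show ?thesis .
qed

lemma integral_cell_step_whole:
  fixes g :: "real^'d \<Rightarrow> 'b::{real_normed_field,banach,second_countable_topology}"
  assumes g: "step n g" and x: "x \<in> unit_cube"
  shows "(\<integral>y\<in>cell n x. g y \<partial>cube_measure) = vol n *\<^sub>R g x"
proof -
  have "(\<integral>y\<in>cell n x. g y \<partial>cube_measure) = (\<integral>y\<in>cell n x. indicator unit_cube y *\<^sub>R g y \<partial>cube_measure)"
    unfolding set_lebesgue_integral_def
    by (intro Bochner_Integration.integral_cong refl) auto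
  also have "\<dots> = vol n *\<^sub>R g x"
    using integral_cell_step[OF g x, of unit_cube] cell_subset[of n x] measure_cell[OF x, of n]
      sets.top[of "cube_measure :: (real^'d) measure"] by (simp add: Int_absorb2)
  finally show ?thesis .
qed

lemma avg_step_same: "step n u \<Longrightarrow> x \<in> unit_cube \<Longrightarrow> avg n u x = u x"
  using vol_pos[of n] by (simp add: avg_def integral_cell_step_whole)

text \<open>On each cell the factor \<open>\<phi>\<close> is a constant.\<close>

lemma integral_mult_eq_by_cells:
  fixes u v \<phi> :: "real^'d \<Rightarrow> 'b::{real_normed_field,banach,second_countable_topology}"
  assumes \<phi>: "step n \<phi>" and u: "integrable cube_measure u" and v: "integrable cube_measure v"
    and eq: "\<And>x. x \<in> unit_cube \<Longrightarrow>
      (\<integral>y\<in>cell n x. u y \<partial>cube_measure) = (\<integral>y\<in>cell n x. v y \<partial>cube_measure)"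
  shows "(\<integral>x. \<phi> x * u x \<partial>cube_measure) = (\<integral>x. \<phi> x * v x \<partial>cube_measure)"
proof -
  have pull: "(\<integral>y\<in>cell n x. \<phi> y * w y \<partial>cube_measure) = \<phi> x * (\<integral>y\<in>cell n x. w y \<partial>cube_measure)"
    if x: "x \<in> unit_cube" for x and w :: "real^'d \<Rightarrow> 'b"
  proof -
    have "(\<integral>y\<in>cell n x. \<phi> y * w y \<partial>cube_measure)
        = (\<integral>y. \<phi> x * (indicator (cell n x) y *\<^sub>R w y) \<partial>cube_measure)"
      unfolding set_lebesgue_integral_def
      by (intro Bochner_Integration.integral_cong refl) (auto simp: indicator_def stepD[OF \<phi> x])
    then show ?thesis by (simp only: set_lebesgue_integral_def integral_mult_right_zero)
  qed
  show ?thesis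
    unfolding integral_over_cells[OF step_integrable_mult[OF \<phi> u], of n]
      integral_over_cells[OF step_integrable_mult[OF \<phi> v], of n]
    by (intro sum.cong refl) (auto simp: cells_def pull eq)
qed

lemma integrable_avg: "integrable cube_measure (avg n u)"
  by (rule step_integrable[OF step_avg])

lemma integral_mult_avg:
  fixes u \<phi> :: "real^'d \<Rightarrow> 'b::{real_normed_field,banach,second_countable_topology}"
  assumes "step n \<phi>" and "integrable cube_measure u"
  shows "(\<integral>x. \<phi> x * avg n u x \<partial>cube_measure) = (\<integral>x. \<phi> x * u x \<partial>cube_measure)"
proof (rule integral_mult_eq_by_cells[OF assms(1) integrable_avg assms(2)])
  fix x :: "real^'d" assume x: "x \<in> unit_cube"
  show "(\<integral>y\<in>cell n x. avg n u y \<partial>cube_measure) = (\<integral>y\<in>cell n x. u y \<partial>cube_measure)"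
    unfolding integral_cell_step_whole[OF step_avg x] using vol_pos[of n] by (simp add: avg_def)
qed

lemma avg_avg:
  fixes u :: "real^'d \<Rightarrow> 'b::{real_normed_field,banach,second_countable_topology}"
  assumes nm: "n \<le> m" and u: "integrable cube_measure u"
  shows "avg n (avg m u) x = avg n u x"
proof -
  have "step n (\<lambda>y. indicator (cell n x) y :: 'b)"
    by (intro step_indicator) (auto simp: step_def cell_def)
  then have "step m (\<lambda>y. indicator (cell n x) y :: 'b)" using nm by (rule step_mono)
  note eq = integral_mult_avg[OF this u]
  have "(\<integral>y\<in>cell n x. w y \<partial>cube_measure) = (\<integral>y. indicator (cell n x) y * w y \<partial>cube_measure)"
    for w :: "real^'d \<Rightarrow> 'b"
    unfolding set_lebesgue_integral_def
    by (intro Bochner_Integration.integral_cong refl) (auto simp: indicator_def)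
  then show ?thesis unfolding avg_def[of n] eq by (simp only: eq)
qed

lemma avg_mono:
  fixes u v :: "real^'d \<Rightarrow> real"
  assumes "integrable cube_measure u" "integrable cube_measure v" "x \<in> unit_cube"
    and "\<And>y. y \<in> unit_cube \<Longrightarrow> u y \<le> v y"
  shows "avg n u x \<le> avg n v x"
proof -
  have "(\<integral>y\<in>cell n x. u y \<partial>cube_measure) \<le> (\<integral>y\<in>cell n x. v y \<partial>cube_measure)"
    using assms unfolding set_lebesgue_integral_def
    by (intro integral_mono integrable_mult_indicator) (auto intro: mult_left_mono)
  then show ?thesis using vol_pos[of n] by (simp add: avg_def divide_right_mono)
qed

text \<open>A cell of level \<open>n\<close> and a cell of level \<open>m\<close> inside the same cell of level \<open>inf n m\<close> intersect in a cell
of level \<open>sup n m\<close>, whose volume does not depend on the two cells. Hence, relative to their volumes, a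
cell of level \<open>n\<close> and the cell of level \<open>inf n m\<close> around it give the same weight to every value of \<open>u\<close>.\<close>

lemma avg_step_inf:
  fixes u :: "real^'d \<Rightarrow> 'b::{real_normed_field,banach,second_countable_topology}"
  assumes u: "step m u" and x: "x \<in> unit_cube"
  shows "avg n u x = avg (inf n m) u x"
proof -
  have exp: "avg k u x = (\<Sum>R\<in>cells m. (\<integral>y\<in>R. indicator (cell k x) y *\<^sub>R u y \<partial>cube_measure) /\<^sub>R vol k)" for k
    unfolding avg_def set_lebesgue_integral_def[of _ "cell k x"]
    using integral_over_cells[of "\<lambda>y. indicator (cell k x) y *\<^sub>R u y" m] step_integrable[OF u] x
    by (simp add: integrable_mult_indicator scaleR_sum_right)
  have "measure cube_measure (cell m y \<inter> cell n x) / vol n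
      = measure cube_measure (cell m y \<inter> cell (inf n m) x) / vol (inf n m)" if y: "y \<in> unit_cube" for y
  proof (cases "y \<in> cell (inf n m) x")
    case True
    obtain z where z: "z \<in> cell n x" "z \<in> cell m y" using cell_meet[OF x True] by blast
    have zc: "z \<in> unit_cube" using z(1) by (rule cell_cube)
    have "cell m y \<inter> cell n x = cell (sup m n) z"
      unfolding cell_Int_same[symmetric] using z by (simp add: cell_eq)
    then have 1: "measure cube_measure (cell m y \<inter> cell n x) = vol (sup n m)"
      using measure_cell[OF zc] by (simp add: sup_commute)
    have "cell m y \<inter> cell (inf n m) x = cell (sup m (inf n m)) y"
      unfolding cell_Int_same[symmetric] using True by (simp add: cell_eq)
    then have 2: "measure cube_measure (cell m y \<inter> cell (inf n m) x) = vol m"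
      using measure_cell[OF y] by (simp add: sup_absorb1)
    show ?thesis unfolding 1 2 using vol_sup_inf[of n m] vol_pos[of n] vol_pos[of "inf n m"]
      by (simp add: field_simps)
  next
    case False
    have "cell m y \<inter> cell (inf n m) x = {}"
    proof (rule ccontr)
      assume "cell m y \<inter> cell (inf n m) x \<noteq> {}"
      then obtain z where z: "z \<in> cell m y" "z \<in> cell (inf n m) x" by blast
      then have "z \<in> cell (inf n m) y" using cell_antimono[of "inf n m" m y] by auto
      then have "cell (inf n m) y = cell (inf n m) x" using z cell_eq by metis
      then show False using False cell_self[OF y] by auto
    qed
    moreover have "cell n x \<subseteq> cell (inf n m) x" by (rule cell_antimono) simp
    ultimately have "cell m y \<inter> cell n x = {}" by blast
    then show ?thesis using \<open>cell m y \<inter> cell (inf n m) x = {}\<close> by simp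
  qed
  then show ?thesis unfolding exp
    by (intro sum.cong refl)
       (auto simp: cells_def integral_cell_step[OF u] x divide_inverse_commute)
qed

lemma avg_avg_step:
  fixes u :: "real^'d \<Rightarrow> 'b::{real_normed_field,banach,second_countable_topology}"
  assumes u: "step N u" and x: "x \<in> unit_cube"
  shows "avg n (avg m u) x = avg (inf n m) u x"
  using avg_step_inf[OF step_avg x, of n m u] avg_avg[OF inf_le2 step_integrable[OF u], of n m x]
  by simp

section \<open>Inequalities for one-parameter chains of levels\<close>

lemma step_runmax:
  assumes "\<And>k. \<nu> k \<le> \<nu> (Suc k)" "\<And>k. k \<le> K \<Longrightarrow> step (\<nu> k) (Y k)" "k \<le> K"
  shows "step (\<nu> k) (runmax Y k)"
  using assms(3)
proof (induction k)
  case 0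
  then show ?case using assms(2)[of 0] by (simp add: step_def)
next
  case (Suc k)
  then have "step (\<nu> (Suc k)) (runmax Y k)" "step (\<nu> (Suc k)) (Y (Suc k))"
    using step_mono[OF Suc.IH assms(1)] assms(2)[of "Suc k"] by simp_all
  then have "step (\<nu> (Suc k)) (\<lambda>x. max (runmax Y k x) (Y (Suc k) x))" by (rule step_comp2)
  then show ?case by (simp add: step_def)
qed

text \<open>The submartingale property is only used in the form that increments have nonnegative integral against
nonnegative functions of the earlier level.\<close>

lemma doob_maximal:
  assumes r: "1 < r" and chain: "\<And>k. \<nu> k \<le> \<nu> (Suc k)"
    and Y: "\<And>k. k \<le> K \<Longrightarrow> step (\<nu> k) (Y k)" and nonneg: "\<And>k x. 0 \<le> Y k x"
    and sub: "\<And>k \<phi>. k < K \<Longrightarrow> step (\<nu> k) \<phi> \<Longrightarrow> (\<And>x. 0 \<le> \<phi> x) \<Longrightarrow>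
      0 \<le> (\<integral>x. \<phi> x * (Y (Suc k) x - Y k x) \<partial>cube_measure)"
  shows "(\<integral>x. runmax Y K x powr r \<partial>cube_measure) \<le> doob_const r * (\<integral>x. Y K x powr r \<partial>cube_measure)"
proof -
  let ?I = "\<lambda>k x. runmax Y k x powr (r - 1) * (Y (Suc k) x - Y k x)"
  have R: "step (\<nu> k) (runmax Y k)" if "k \<le> K" for k
    using chain Y that by (rule step_runmax)
  have I: "integrable cube_measure (?I k)" if k: "k < K" for k
  proof (rule step_integrable)
    have "step (\<nu> (Suc k)) (runmax Y k)" "step (\<nu> (Suc k)) (Y k)" "step (\<nu> (Suc k)) (Y (Suc k))"
      using step_mono[OF R chain] step_mono[OF Y chain] Y[of "Suc k"] k by simp_all
    then show "step (\<nu> (Suc k)) (?I k)" by (simp add: step_def)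
  qed
  have pos: "0 \<le> (\<integral>x. ?I k x \<partial>cube_measure)" if "k < K" for k
  proof (rule sub[OF that])
    show "step (\<nu> k) (\<lambda>x. runmax Y k x powr (r - 1))"
      using R[of k] that by (simp add: step_def)
  qed simp
  have iR: "integrable cube_measure (\<lambda>x. runmax Y K x powr r)"
    using R[of K] by (intro step_integrable[of "\<nu> K"]) (simp add: step_def)
  have iY: "integrable cube_measure (\<lambda>x. Y K x powr r)"
    using Y[of K] by (intro step_integrable[of "\<nu> K"]) (simp add: step_def)
  have iS: "integrable cube_measure (\<lambda>x. \<Sum>k<K. ?I k x)"
    using I by (intro Bochner_Integration.integrable_sum) auto
  have "(\<integral>x. runmax Y K x powr r \<partial>cube_measure) \<le>
    (\<integral>x. doob_const r * Y K x powr r - 2 * r / (r - 1) * (\<Sum>k<K. ?I k x) \<partial>cube_measure)"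
  proof (rule integral_mono[OF iR])
    show "integrable cube_measure
        (\<lambda>x. doob_const r * Y K x powr r - 2 * r / (r - 1) * (\<Sum>k<K. ?I k x))"
      by (intro Bochner_Integration.integrable_diff integrable_mult_right iY iS)
  qed (rule pathwise_maximal_powr, use r nonneg in auto)
  also have "\<dots> = doob_const r * (\<integral>x. Y K x powr r \<partial>cube_measure)
      - 2 * r / (r - 1) * (\<Sum>k<K. \<integral>x. ?I k x \<partial>cube_measure)"
    using I by (subst Bochner_Integration.integral_diff[OF integrable_mult_right[OF iY] integrable_mult_right[OF iS]])
      (simp add: Bochner_Integration.integral_sum)
  also have "\<dots> \<le> doob_const r * (\<integral>x. Y K x powr r \<partial>cube_measure)"
  proof -
    have "0 \<le> 2 * r / (r - 1) * (\<Sum>k<K. \<integral>x. ?I k x \<partial>cube_measure)"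
      using pos r by (intro mult_nonneg_nonneg sum_nonneg) auto
    then show ?thesis by linarith
  qed
  finally show ?thesis .
qed

text \<open>The chain carries a finite system of martingales \<open>X\<^sub>i\<close>. With \<open>a = sqrt (\<Sum>\<^sub>i |X\<^sub>i|\<^sup>2)\<close>, the
convexity bound \<open>powr_taylor_lower_inner\<close> shows that \<open>a\<^sup>r\<close> grows in each step by at least a multiple of
\<open>s\<^bsup>r-2\<^esup>\<close> times the squared increment, up to a term that is linear in the increment and
integrates to zero; here \<open>s\<close> is the maximum of \<open>a\<close> along the chain. Summing bounds the integral of \<open>s\<^bsup>r-2\<^esup> S\<^sup>2\<close>, Doob's inequality bounds the
integral of \<open>s\<^sup>r\<close>, and \<open>powr_le_split\<close> bounds \<open>S\<^sup>r\<close> by the sum of the two.\<close>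

lemma square_function_chain:
  fixes X :: "nat \<Rightarrow> 'i \<Rightarrow> real^'d \<Rightarrow> complex"
  assumes r: "1 < r" "r \<le> 2" and fin: "finite I" and chain: "\<And>k. \<nu> k \<le> \<nu> (Suc k)"
    and X: "\<And>k i. k \<le> K \<Longrightarrow> i \<in> I \<Longrightarrow> step (\<nu> k) (X k i)"
    and mart: "\<And>k i \<phi>. k < K \<Longrightarrow> i \<in> I \<Longrightarrow> step (\<nu> k) \<phi> \<Longrightarrow>
      (\<integral>x. \<phi> x * (X (Suc k) i x - X k i x) \<partial>cube_measure) = 0"
  shows "(\<integral>x. (\<Sum>i\<in>I. (cmod (X 0 i x))\<^sup>2 + (\<Sum>k<K. (cmod (X (Suc k) i x - X k i x))\<^sup>2)) powr (r / 2) \<partial>cube_measure)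
    \<le> (doob_const r + 2 / (r * (r - 1))) * (\<integral>x. (\<Sum>i\<in>I. (cmod (X K i x))\<^sup>2) powr (r / 2) \<partial>cube_measure)"
proof -
  define a where "a k x = sqrt (\<Sum>i\<in>I. (cmod (X k i x))\<^sup>2)" for k x
  define c where "c k x = (\<Sum>i\<in>I. Re (cnj (X k i x) * X (Suc k) i x))" for k x
  define d where "d k x = (\<Sum>i\<in>I. (cmod (X (Suc k) i x - X k i x))\<^sup>2)" for k x
  \<comment> \<open>The constant of the convexity bound; it is at most \<open>1\<close>, which absorbs the initial term below.\<close>
  define \<kappa> where "\<kappa> = r * (r - 1) / 2"
  have \<kappa>: "0 < \<kappa>" "\<kappa> \<le> 1"
  proof -
    show "0 < \<kappa>" using r by (simp add: \<kappa>_def)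
    have "r * (r - 1) \<le> 2 * 1" using r by (intro mult_mono) auto
    then show "\<kappa> \<le> 1" by (simp add: \<kappa>_def)
  qed
  have a0: "0 \<le> a k x" for k x by (simp add: a_def sum_nonneg)
  have a2: "(a k x)\<^sup>2 = (\<Sum>i\<in>I. (cmod (X k i x))\<^sup>2)" for k x by (simp add: a_def sum_nonneg)
  have d0: "0 \<le> d k x" for k x by (simp add: d_def sum_nonneg)
  have d_eq: "d k x = (a k x)\<^sup>2 + (a (Suc k) x)\<^sup>2 - 2 * c k x" for k x
  proof -
    have "(cmod (u - v))\<^sup>2 = (cmod v)\<^sup>2 + (cmod u)\<^sup>2 - 2 * Re (cnj v * u)" for u v
      by (simp only: cmod_power2) (simp add: power2_eq_square algebra_simps)
    then show ?thesis
      by (simp add: d_def a2 c_def sum.distrib sum_subtractf sum_distrib_left)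
  qed
  have c_le: "\<bar>c k x\<bar> \<le> a k x * a (Suc k) x" for k x
  proof -
    have "\<bar>c k x\<bar> \<le> (\<Sum>i\<in>I. \<bar>Re (cnj (X k i x) * X (Suc k) i x)\<bar>)" unfolding c_def by (rule sum_abs)
    also have "\<dots> \<le> (\<Sum>i\<in>I. \<bar>cmod (X k i x)\<bar> * \<bar>cmod (X (Suc k) i x)\<bar>)"
      using abs_Re_le_cmod by (intro sum_mono) (metis abs_norm_cancel complex_mod_cnj norm_mult)
    also have "\<dots> \<le> L2_set (\<lambda>i. cmod (X k i x)) I * L2_set (\<lambda>i. cmod (X (Suc k) i x)) I"
      by (rule L2_set_mult_ineq)
    finally show ?thesis by (simp add: a_def L2_set_def)
  qed
  have s_a: "step (\<nu> k) (a k)" if "k \<le> K" for k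
    using X[OF that] by (simp add: step_def a_def)
  have s_c: "step (\<nu> (Suc k)) (c k)" if "k < K" for k
  proof -
    have "step (\<nu> (Suc k)) (X k i)" "step (\<nu> (Suc k)) (X (Suc k) i)" if "i \<in> I" for i
      using \<open>k < K\<close> that X[of k i] X[of "Suc k" i] step_mono[OF _ chain[of k]] by auto
    then show ?thesis by (simp add: step_def c_def)
  qed
  \<comment> \<open>Here \<open>c - a\<^sup>2\<close> is the inner product of the current value with the next increment.\<close>
  have lin: "(\<integral>x. \<phi> x * (c k x - (a k x)\<^sup>2) \<partial>cube_measure) = 0"
    if k: "k < K" and \<phi>: "step (\<nu> k) \<phi>" for k \<phi>
  proof -
    let ?f = "\<lambda>i x. complex_of_real (\<phi> x) * cnj (X k i x) * (X (Suc k) i x - X k i x)"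
    have "step (\<nu> k) (\<lambda>x. complex_of_real (\<phi> x) * cnj (X k i x))" if "i \<in> I" for i
      using X[of k i] \<phi> k that by (simp add: step_def)
    from mart[OF k _ this] have 0: "(\<integral>x. ?f i x \<partial>cube_measure) = 0" if "i \<in> I" for i
      using that by simp
    have "step (\<nu> (Suc k)) (X k i)" "step (\<nu> (Suc k)) (X (Suc k) i)" "step (\<nu> (Suc k)) \<phi>" if "i \<in> I" for i
      using \<open>k < K\<close> that X[of k i] X[of "Suc k" i] step_mono[OF _ chain[of k]] \<phi> by auto
    then have "step (\<nu> (Suc k)) (?f i)" if "i \<in> I" for i
      using that by (simp add: step_def)
    then have int: "integrable cube_measure (?f i)" if "i \<in> I" for i
      using that step_integrable by blast
    have "\<phi> x * (c k x - (a k x)\<^sup>2) = Re (\<Sum>i\<in>I. ?f i x)" for x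
      unfolding c_def a2 sum_subtractf[symmetric] sum_distrib_left Re_sum
      by (intro sum.cong refl) (simp only: cmod_power2, simp add: power2_eq_square algebra_simps)
    then have "(\<integral>x. \<phi> x * (c k x - (a k x)\<^sup>2) \<partial>cube_measure) = Re (\<integral>x. (\<Sum>i\<in>I. ?f i x) \<partial>cube_measure)"
      using int by (simp only:) (intro integral_Re Bochner_Integration.integrable_sum; simp)
    also have "(\<integral>x. (\<Sum>i\<in>I. ?f i x) \<partial>cube_measure) = 0"
      using int 0 by (simp add: Bochner_Integration.integral_sum)
    finally show ?thesis by simp
  qed
  \<comment> \<open>The norm of a vector-valued martingale is a submartingale: its increment dominates the linear term
    \<open>(c - a\<^sup>2) / a\<close>. Division by zero gives \<open>0\<close>, which is the right value where \<open>a = 0\<close>.\<close>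
  have sub: "0 \<le> (\<integral>x. \<phi> x * (a (Suc k) x - a k x) \<partial>cube_measure)"
    if k: "k < K" and \<phi>: "step (\<nu> k) \<phi>" "\<And>x. 0 \<le> \<phi> x" for k \<phi>
  proof -
    have s: "step (\<nu> (Suc k)) \<phi>" "step (\<nu> (Suc k)) (a k)" "step (\<nu> (Suc k)) (a (Suc k))"
      using k \<phi>(1) s_a[of k] s_a[of "Suc k"] step_mono[OF _ chain[of k]] by auto
    have "0 = (\<integral>x. \<phi> x / a k x * (c k x - (a k x)\<^sup>2) \<partial>cube_measure)"
      using k \<phi>(1) s_a[of k] by (intro lin[symmetric]) (simp_all add: step_def)
    also have "\<dots> \<le> (\<integral>x. \<phi> x * (a (Suc k) x - a k x) \<partial>cube_measure)"
    proof (rule integral_mono)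
      show "integrable cube_measure (\<lambda>x. \<phi> x / a k x * (c k x - (a k x)\<^sup>2))"
        using s s_c[OF k] by (intro step_integrable[of "\<nu> (Suc k)"]) (simp add: step_def)
      show "integrable cube_measure (\<lambda>x. \<phi> x * (a (Suc k) x - a k x))"
        using s by (intro step_integrable[of "\<nu> (Suc k)"]) (simp add: step_def)
      show "\<phi> x / a k x * (c k x - (a k x)\<^sup>2) \<le> \<phi> x * (a (Suc k) x - a k x)" for x
      proof (cases "a k x = 0")
        case True
        then show ?thesis using \<phi>(2)[of x] a0[of "Suc k" x] by simp
      next
        case False
        then have pos: "0 < a k x" using a0[of k x] by simp
        have "c k x / a k x \<le> a (Suc k) x" using c_le[of k x] pos by (simp add: pos_divide_le_eq mult.commute)
        then have "\<phi> x * (c k x / a k x - a k x) \<le> \<phi> x * (a (Suc k) x - a k x)"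
          using \<phi>(2)[of x] by (intro mult_left_mono) auto
        moreover have "\<phi> x / a k x * (c k x - (a k x)\<^sup>2) = \<phi> x * (c k x / a k x - a k x)"
          using pos by (simp add: field_simps power2_eq_square)
        ultimately show ?thesis by simp
      qed
    qed
    finally show ?thesis .
  qed
  let ?Z = "\<lambda>k x. r * a k x powr (r - 2) * (c k x - (a k x)\<^sup>2)"
  have path: "(\<Sum>i\<in>I. (cmod (X 0 i x))\<^sup>2 + (\<Sum>k<K. (cmod (X (Suc k) i x - X k i x))\<^sup>2)) powr (r / 2)
    \<le> runmax a K x powr r + 1 / \<kappa> * (a K x powr r - (\<Sum>k<K. ?Z k x))" (is "?S2 powr _ \<le> _") for x
  proof -
    let ?s = "runmax a K x"
    have s0: "0 \<le> ?s" using a0 by (rule runmax_nonneg)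
    have as: "a k x \<le> ?s" if "k \<le> K" for k using that by (rule runmax_ge)
    have S2: "?S2 = (a 0 x)\<^sup>2 + (\<Sum>k<K. d k x)"
      unfolding sum.distrib a2 d_def by (simp add: sum.swap[of _ _ I])
    have S0: "0 \<le> ?S2" unfolding S2 using d0 by (simp add: sum_nonneg)
    have "sqrt ?S2 = 0" if "?s = 0"
    proof -
      have az: "a k x = 0" if "k \<le> K" for k using as[OF that] a0[of k x] \<open>?s = 0\<close> by simp
      have "d k x = 0" if "k < K" for k
        using az[of k] az[of "Suc k"] c_le[of k x] that unfolding d_eq by simp
      then show ?thesis using az[of 0] unfolding S2 by simp
    qed
    then have "sqrt ?S2 powr r \<le> ?s powr r + ?s powr (r - 2) * (sqrt ?S2)\<^sup>2"
      using r s0 S0 by (intro powr_le_split) auto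
    moreover have "sqrt ?S2 powr r = ?S2 powr (r / 2)"
      using S0 by (simp add: powr_half_sqrt[symmetric] powr_powr)
    moreover have "?s powr (r - 2) * (sqrt ?S2)\<^sup>2 = ?s powr (r - 2) * (a 0 x)\<^sup>2 + ?s powr (r - 2) * (\<Sum>k<K. d k x)"
      using S0 unfolding S2 by (simp add: distrib_left)
    moreover have "?s powr (r - 2) * (a 0 x)\<^sup>2 \<le> a 0 x powr r"
    proof (cases "a 0 x = 0")
      case False
      then have p: "0 < a 0 x" using a0[of 0 x] by simp
      have "?s powr (r - 2) * (a 0 x)\<^sup>2 \<le> a 0 x powr (r - 2) * (a 0 x)\<^sup>2"
        using p as[of 0] r by (intro mult_right_mono powr_mono2') auto
      also have "\<dots> = a 0 x powr r" using p by (simp add: powr_diff powr_numeral)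
      finally show ?thesis .
    qed simp
    moreover have "a 0 x powr r \<le> 1 / \<kappa> * a 0 x powr r"
      using \<kappa> mult_right_mono[of 1 "1 / \<kappa>" "a 0 x powr r"] by simp
    moreover have "\<kappa> * (?s powr (r - 2) * (\<Sum>k<K. d k x)) \<le> a K x powr r - a 0 x powr r - (\<Sum>k<K. ?Z k x)"
    proof -
      have "\<kappa> * ?s powr (r - 2) * d k x \<le> a (Suc k) x powr r - a k x powr r - ?Z k x" if "k < K" for k
        unfolding d_eq \<kappa>_def using that as
        by (intro powr_taylor_lower_inner r a0 c_le) auto
      then have "(\<Sum>k<K. \<kappa> * ?s powr (r - 2) * d k x) \<le> (\<Sum>k<K. (a (Suc k) x powr r - a k x powr r) - ?Z k x)"
        by (intro sum_mono) auto
      also have "\<dots> = a K x powr r - a 0 x powr r - (\<Sum>k<K. ?Z k x)"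
        using sum_lessThan_telescope[of "\<lambda>k. a k x powr r" K] by (simp add: sum_subtractf)
      finally show ?thesis by (simp add: sum_distrib_left mult.assoc)
    qed
    then have "?s powr (r - 2) * (\<Sum>k<K. d k x) \<le> 1 / \<kappa> * (a K x powr r - a 0 x powr r - (\<Sum>k<K. ?Z k x))"
      using \<kappa> by (simp add: pos_le_divide_eq mult.commute)
    ultimately show ?thesis by (simp add: right_diff_distrib)
  qed
  have R: "step (\<nu> K) (runmax a K)"
    by (rule step_runmax[where \<nu> = \<nu> and Y = a and K = K, OF chain s_a]) auto
  have iR: "integrable cube_measure (\<lambda>x. runmax a K x powr r)"
    using R by (intro step_integrable[of "\<nu> K"]) (simp add: step_def)
  have ia: "integrable cube_measure (\<lambda>x. a K x powr r)"
    using s_a[of K] by (intro step_integrable[of "\<nu> K"]) (simp add: step_def)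
  have iZ: "integrable cube_measure (?Z k)" and Z0: "(\<integral>x. ?Z k x \<partial>cube_measure) = 0" if "k < K" for k
  proof -
    have "step (\<nu> (Suc k)) (a k)" using s_a[of k] step_mono[OF _ chain[of k]] that by auto
    then show "integrable cube_measure (?Z k)"
      using s_c[OF that] by (intro step_integrable[of "\<nu> (Suc k)"]) (simp add: step_def)
    show "(\<integral>x. ?Z k x \<partial>cube_measure) = 0"
      using s_a[of k] that by (intro lin) (simp_all add: step_def)
  qed
  have iZs: "integrable cube_measure (\<lambda>x. \<Sum>k<K. ?Z k x)"
    using iZ by (intro Bochner_Integration.integrable_sum) auto
  have mono: "\<nu> k \<le> \<nu> K" if "k \<le> K" for k using chain that by (rule lift_Suc_mono_le)
  have XK: "step (\<nu> K) (X k i)" if "k \<le> K" "i \<in> I" for k i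
    using X[OF that] mono[OF that(1)] by (rule step_mono)
  have iS: "integrable cube_measure
      (\<lambda>x. (\<Sum>i\<in>I. (cmod (X 0 i x))\<^sup>2 + (\<Sum>k<K. (cmod (X (Suc k) i x - X k i x))\<^sup>2)) powr (r / 2))"
    using XK by (intro step_integrable[of "\<nu> K"]) (simp add: step_def)
  have "(\<integral>x. (\<Sum>i\<in>I. (cmod (X 0 i x))\<^sup>2 + (\<Sum>k<K. (cmod (X (Suc k) i x - X k i x))\<^sup>2)) powr (r / 2) \<partial>cube_measure)
    \<le> (\<integral>x. runmax a K x powr r + 1 / \<kappa> * (a K x powr r - (\<Sum>k<K. ?Z k x)) \<partial>cube_measure)"
    by (rule integral_mono[OF iS _ path])
       (intro Bochner_Integration.integrable_add integrable_mult_right Bochner_Integration.integrable_diff iR ia iZs)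
  also have "\<dots> = (\<integral>x. runmax a K x powr r \<partial>cube_measure) + 1 / \<kappa> * ((\<integral>x. a K x powr r \<partial>cube_measure)
      - (\<integral>x. (\<Sum>k<K. ?Z k x) \<partial>cube_measure))"
    by (subst Bochner_Integration.integral_add[OF iR integrable_mult_right[OF Bochner_Integration.integrable_diff[OF ia iZs]]],
        subst integral_mult_right_zero, subst Bochner_Integration.integral_diff[OF ia iZs]) (rule refl)
  also have "(\<integral>x. (\<Sum>k<K. ?Z k x) \<partial>cube_measure) = 0"
    using iZ Z0 by (subst Bochner_Integration.integral_sum) auto
  finally have "(\<integral>x. (\<Sum>i\<in>I. (cmod (X 0 i x))\<^sup>2 + (\<Sum>k<K. (cmod (X (Suc k) i x - X k i x))\<^sup>2)) powr (r / 2) \<partial>cube_measure)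
    \<le> (\<integral>x. runmax a K x powr r \<partial>cube_measure) + 1 / \<kappa> * (\<integral>x. a K x powr r \<partial>cube_measure)" by simp
  moreover have "(\<integral>x. runmax a K x powr r \<partial>cube_measure) \<le> doob_const r * (\<integral>x. a K x powr r \<partial>cube_measure)"
    by (rule doob_maximal[where \<nu> = \<nu> and Y = a and K = K, OF r(1) chain s_a a0 sub])
  ultimately have "(\<integral>x. (\<Sum>i\<in>I. (cmod (X 0 i x))\<^sup>2 + (\<Sum>k<K. (cmod (X (Suc k) i x - X k i x))\<^sup>2)) powr (r / 2) \<partial>cube_measure)
    \<le> (doob_const r + 2 / (r * (r - 1))) * (\<integral>x. a K x powr r \<partial>cube_measure)"
    by (simp add: \<kappa>_def distrib_right)
  moreover have "a K x powr r = (\<Sum>i\<in>I. (cmod (X K i x))\<^sup>2) powr (r / 2)" for x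
    unfolding a_def by (simp add: sum_nonneg powr_half_sqrt[symmetric] powr_powr)
  ultimately show ?thesis by simp
qed

section \<open>Vilenkin martingales\<close>

lemma set_integral_eq_mult:
  fixes w :: "real^'d \<Rightarrow> 'b::{real_normed_field,banach,second_countable_topology}"
  shows "(\<integral>y\<in>A. w y \<partial>cube_measure) = (\<integral>y. indicator A y * w y \<partial>cube_measure)"
  unfolding set_lebesgue_integral_def
  by (intro Bochner_Integration.integral_cong refl) (auto simp: indicator_def)

text \<open>It suffices to test against the indicator functions of cells.\<close>

lemma avg_eqI:
  fixes u h :: "real^'d \<Rightarrow> 'b::{real_normed_field,banach,second_countable_topology}"
  assumes h: "step n h" and x: "x \<in> unit_cube"
    and eq: "\<And>\<phi>. step n \<phi> \<Longrightarrow> (\<integral>y. \<phi> y * u y \<partial>cube_measure) = (\<integral>y. \<phi> y * h y \<partial>cube_measure)"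
  shows "avg n u x = h x"
proof -
  have "step n (indicator (cell n x) :: real^'d \<Rightarrow> 'b)"
    by (intro step_indicator) (auto simp: step_def cell_def)
  from eq[OF this] show ?thesis
    using integral_cell_step_whole[OF h x] vol_pos[of n]
    by (simp add: avg_def set_integral_eq_mult)
qed

lemma real_cond_exp_eq_avg:
  fixes u :: "real^'d \<Rightarrow> real"
  assumes u: "integrable cube_measure u"
  shows "AE x in cube_measure. real_cond_exp cube_measure (vilenkin_filtration p n) u x = avg n u x"
proof -
  interpret finite_measure_subalgebra cube_measure "vilenkin_filtration p n"
    by unfold_locales (rule subalgebra_filtration)
  show ?thesis
  proof (rule real_cond_exp_charact[OF _ u integrable_avg step_measurable_filtration[OF step_avg]])
    fix A assume "A \<in> sets (vilenkin_filtration p n)"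
    then have "step n (indicator A :: real^'d \<Rightarrow> real)"
      by (intro step_indicator) (simp add: sets_filtration_iff)
    from integral_mult_avg[OF this u]
    show "(\<integral>x\<in>A. u x \<partial>cube_measure) = (\<integral>x\<in>A. avg n u x \<partial>cube_measure)"
      by (simp add: set_integral_eq_mult)
  qed
qed

lemma complex_cond_exp_eq_avg:
  assumes u: "integrable cube_measure u"
  shows "AE x in cube_measure. complex_cond_exp cube_measure (vilenkin_filtration p n) u x = avg n u x"
proof -
  have int: "integrable cube_measure (\<lambda>y. indicator (cell n x) y *\<^sub>R u y)" if "x \<in> unit_cube" for x
    using u that by (intro integrable_mult_indicator) auto
  have "avg n (\<lambda>y. Re (u y)) x = Re (avg n u x)" "avg n (\<lambda>y. Im (u y)) x = Im (avg n u x)"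
    if "x \<in> unit_cube" for x
    using integral_Re[OF int[OF that]] integral_Im[OF int[OF that]]
    by (simp_all add: avg_def set_lebesgue_integral_def)
  moreover have "AE x in cube_measure. real_cond_exp cube_measure (vilenkin_filtration p n) (\<lambda>y. Re (u y)) x = avg n (\<lambda>y. Re (u y)) x"
    "AE x in cube_measure. real_cond_exp cube_measure (vilenkin_filtration p n) (\<lambda>y. Im (u y)) x = avg n (\<lambda>y. Im (u y)) x"
    using u by (intro real_cond_exp_eq_avg; simp)+
  moreover have "AE x in cube_measure. x \<in> (unit_cube :: (real^'d) set)"
    using AE_space[of "cube_measure :: (real^'d) measure"] by simp
  ultimately show ?thesis
    by (auto simp: complex_cond_exp_def complex_eq_iff elim!: AE_mp)
qed

text \<open>Cells have positive measure, so a null set cannot contain one.\<close>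

lemma step_eq_of_AE_eq:
  fixes g h :: "real^'d \<Rightarrow> complex"
  assumes g: "step n g" and h: "step n h" and ae: "AE x in cube_measure. g x = h x"
    and x: "x \<in> unit_cube"
  shows "g x = h x"
proof -
  have "(\<integral>y\<in>cell n x. g y \<partial>cube_measure) = (\<integral>y\<in>cell n x. h y \<partial>cube_measure)"
  proof -
    have "AE y in cube_measure. indicator (cell n x) y *\<^sub>R g y = indicator (cell n x) y *\<^sub>R h y"
      using ae by (auto elim!: AE_mp)
    moreover have "integrable cube_measure (\<lambda>y. indicator (cell n x) y *\<^sub>R g y)"
      "integrable cube_measure (\<lambda>y. indicator (cell n x) y *\<^sub>R h y)"
      using step_integrable[OF g] step_integrable[OF h] x by (auto intro: integrable_mult_indicator)
    ultimately show ?thesis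
      unfolding set_lebesgue_integral_def
      by (intro integral_cong_AE) (auto dest: borel_measurable_integrable)
  qed
  then show ?thesis
    using vol_pos[of n] by (simp add: integral_cell_step_whole[OF g x] integral_cell_step_whole[OF h x])
qed

text \<open>From here on a martingale is a family of functions that are constant on cells and compatible under
averaging at every point, without exceptional null sets.\<close>

lemma vilenkin_martingales_iff:
  "f \<in> vilenkin_martingales p \<longleftrightarrow>
    (\<forall>n. step n (f n)) \<and> (\<forall>n x. x \<notin> unit_cube \<longrightarrow> f n x = 0) \<and>
    (\<forall>n m. n \<le> m \<longrightarrow> (\<forall>x\<in>unit_cube. avg n (f m) x = f n x))"
proof -
  have eq: "(AE x in cube_measure. complex_cond_exp cube_measure (vilenkin_filtration p n) (f m) x = f n x)
      \<longleftrightarrow> (\<forall>x\<in>unit_cube. avg n (f m) x = f n x)" if st: "\<forall>n. step n (f n)" for n m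
  proof
    have ce: "AE x in cube_measure. complex_cond_exp cube_measure (vilenkin_filtration p n) (f m) x = avg n (f m) x"
      using st by (intro complex_cond_exp_eq_avg step_integrable) auto
    {
      assume "AE x in cube_measure. complex_cond_exp cube_measure (vilenkin_filtration p n) (f m) x = f n x"
      with ce have "AE x in cube_measure. avg n (f m) x = f n x" by eventually_elim simp
      then show "\<forall>x\<in>unit_cube. avg n (f m) x = f n x"
        using st step_eq_of_AE_eq[OF step_avg] by blast
    }
    assume *: "\<forall>x\<in>unit_cube. avg n (f m) x = f n x"
    have "AE x in cube_measure. x \<in> (unit_cube :: (real^'d) set)"
      using AE_space[of "cube_measure :: (real^'d) measure"] by simp
    with ce show "AE x in cube_measure. complex_cond_exp cube_measure (vilenkin_filtration p n) (f m) x = f n x"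
      by eventually_elim (use * in simp)
  qed
  show ?thesis
  proof (cases "\<forall>n. step n (f n)")
    case True
    then have "integrable cube_measure (f n)" for n using step_integrable by metis
    then show ?thesis
      using True unfolding vilenkin_martingales_def mem_Collect_eq step_iff_measurable
      by (simp add: eq[OF True])
  next
    case False
    then show ?thesis
      unfolding vilenkin_martingales_def mem_Collect_eq step_iff_measurable by blast
  qed
qed

lemma martingale_step: "f \<in> vilenkin_martingales p \<Longrightarrow> step n (f n)"
  by (simp add: vilenkin_martingales_iff)

lemma martingale_outside: "f \<in> vilenkin_martingales p \<Longrightarrow> x \<notin> unit_cube \<Longrightarrow> f n x = 0"
  by (simp add: vilenkin_martingales_iff)

lemma integral_cong_cube:
  "(\<And>x. x \<in> unit_cube \<Longrightarrow> g x = h x) \<Longrightarrow> (\<integral>x. g x \<partial>cube_measure) = (\<integral>x. h x \<partial>cube_measure)"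
  by (intro Bochner_Integration.integral_cong) auto

text \<open>The martingale property for arbitrary pairs of levels, a consequence of \<open>avg_step_inf\<close>.\<close>

lemma integral_mult_martingale:
  assumes f: "f \<in> vilenkin_martingales p" and \<phi>: "step m \<phi>"
  shows "(\<integral>x. \<phi> x * f l x \<partial>cube_measure) = (\<integral>x. \<phi> x * f (inf m l) x \<partial>cube_measure)"
proof -
  have "(\<integral>x. \<phi> x * f l x \<partial>cube_measure) = (\<integral>x. \<phi> x * avg m (f l) x \<partial>cube_measure)"
    by (rule integral_mult_avg[symmetric, OF \<phi> step_integrable[OF martingale_step[OF f]]])
  also have "\<dots> = (\<integral>x. \<phi> x * f (inf m l) x \<partial>cube_measure)"
  proof (rule integral_cong_cube)
    fix x :: "real^'d" assume x: "x \<in> unit_cube"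
    have "avg (inf m l) (f l) x = f (inf m l) x"
      using f x by (simp add: vilenkin_martingales_iff)
    then show "\<phi> x * avg m (f l) x = \<phi> x * f (inf m l) x"
      using avg_step_inf[OF martingale_step[OF f] x, of m l] by simp
  qed
  finally show ?thesis .
qed

section \<open>Martingale differences\<close>

definition shift :: "'d set \<Rightarrow> ('d \<Rightarrow> nat) \<Rightarrow> 'd \<Rightarrow> nat" where
  "shift K n = (\<lambda>d. n d - of_bool (d \<in> K))"

definition shiftable :: "'d set \<Rightarrow> ('d \<Rightarrow> nat) \<Rightarrow> bool" where
  "shiftable K n \<longleftrightarrow> (\<forall>d\<in>K. 0 < n d)"

text \<open>The difference operator in the coordinates from \<open>J\<close> only. The summation index \<open>K\<close> is the set of
coordinates whose level is lowered, which corresponds to \<open>\<epsilon>\<close> in \<^const>\<open>mart_diff\<close>. Partial differences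
make inductions over the set of coordinates possible.\<close>

definition pdiff :: "'d set \<Rightarrow> ('d \<Rightarrow> nat) \<Rightarrow> (('d \<Rightarrow> nat) \<Rightarrow> real^'d \<Rightarrow> complex) \<Rightarrow> real^'d \<Rightarrow> complex" where
  "pdiff J n f x = (\<Sum>K\<in>Pow J. (- 1) ^ card K * (if shiftable K n then f (shift K n) x else 0))"

lemma pdiff_empty: "pdiff {} n f x = f n x"
  by (simp add: pdiff_def Pow_empty shift_def shiftable_def)

lemma pdiff_insert:
  assumes d: "d \<notin> J"
  shows "pdiff (insert d J) n f x = pdiff J n f x - (if n d = 0 then 0 else pdiff J (n(d := n d - 1)) f x)"
proof -
  let ?t = "\<lambda>K. (- 1) ^ card K * (if shiftable K n then f (shift K n) x else 0)"
  have "pdiff (insert d J) n f x = pdiff J n f x + sum ?t (insert d ` Pow J)"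
    unfolding pdiff_def Pow_insert using d by (subst sum.union_disjoint) auto
  also have "sum ?t (insert d ` Pow J) = (\<Sum>K\<in>Pow J. ?t (insert d K))"
    using d by (subst sum.reindex) (auto simp: inj_on_def)
  also have "\<dots> = - (if n d = 0 then 0 else pdiff J (n(d := n d - 1)) f x)"
  proof (cases "n d = 0")
    case False
    have "?t (insert d K) = - ((- 1) ^ card K * (if shiftable K (n(d := n d - 1))
        then f (shift K (n(d := n d - 1))) x else 0))" if K: "K \<in> Pow J" for K
    proof -
      have dK: "d \<notin> K" using K d by auto
      then have "card (insert d K) = Suc (card K)" by simp
      moreover have "shiftable (insert d K) n \<longleftrightarrow> shiftable K (n(d := n d - 1))"
        using dK False by (auto simp: shiftable_def)
      moreover have "shift (insert d K) n = shift K (n(d := n d - 1))"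
        using dK by (auto simp: shift_def fun_eq_iff)
      ultimately show ?thesis by simp
    qed
    then have "(\<Sum>K\<in>Pow J. ?t (insert d K)) = - pdiff J (n(d := n d - 1)) f x"
      unfolding pdiff_def sum_negf[symmetric] by (rule sum.cong[OF refl])
    then show ?thesis using False by simp
  qed (simp add: shiftable_def)
  finally show ?thesis by (simp only: diff_conv_add_uminus)
qed

lemma mart_diff_eq_pdiff: "mart_diff n f = pdiff UNIV n f"
proof
  fix x
  have bij: "bij_betw (\<lambda>K d. of_bool (d \<in> K)) (UNIV :: 'd set set) (UNIV \<rightarrow>\<^sub>E {0, 1 :: nat})"
    by (rule bij_betw_byWitness[where f' = "\<lambda>\<epsilon>. {d. \<epsilon> d = 1}"]) (auto simp: PiE_iff fun_eq_iff)
  have "mart_diff n f x = (\<Sum>K\<in>(UNIV :: 'd set set). (- 1) ^ (\<Sum>d\<in>UNIV. of_bool (d \<in> K)) *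
      (if (\<lambda>d. of_bool (d \<in> K)) \<le> n then f (\<lambda>d. n d - of_bool (d \<in> K)) x else 0))"
    unfolding mart_diff_def by (rule sum.reindex_bij_betw[OF bij, symmetric])
  also have "\<dots> = pdiff UNIV n f x"
  proof -
    have "(\<lambda>d. of_bool (d \<in> K)) \<le> n \<longleftrightarrow> shiftable K n" for K
      by (auto simp: shiftable_def le_fun_def of_bool_def Suc_le_eq)
    moreover have "(\<Sum>d\<in>UNIV. of_bool (d \<in> K)) = card K" for K :: "'d set"
      by (simp add: of_bool_def sum.If_cases)
    ultimately show ?thesis by (simp add: pdiff_def shift_def cong: if_cong)
  qed
  finally show "mart_diff n f x = pdiff UNIV n f x" .
qed

lemma shift_le: "shift K n \<le> n"
  by (simp add: shift_def le_fun_def)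

lemma step_pdiff: "f \<in> vilenkin_martingales p \<Longrightarrow> step n (pdiff J n f)"
  unfolding pdiff_def
  by (intro step_sum) (auto simp: step_def dest: stepD[OF step_mono[OF martingale_step shift_le]])

lemma pdiff_outside: "f \<in> vilenkin_martingales p \<Longrightarrow> x \<notin> unit_cube \<Longrightarrow> pdiff J n f x = 0"
  by (simp add: pdiff_def martingale_outside[of f] cong: if_cong)

lemma pdiff_diff: "pdiff J n (\<lambda>k y. f k y - g k y) x = pdiff J n f x - pdiff J n g x"
  unfolding pdiff_def sum_subtractf[symmetric] by (intro sum.cong refl) (simp add: algebra_simps)

text \<open>A test function of level \<open>m\<close> does not distinguish levels above \<open>m d\<close> in the coordinate \<open>d\<close>. This yields
both the martingale property of partial differences in the remaining coordinates and the cancellation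
of full differences.\<close>

lemma integral_mult_pdiff_cong:
  assumes f: "f \<in> vilenkin_martingales p" and \<phi>: "step m \<phi>" and d: "d \<notin> J"
    and a: "m d \<le> a" and b: "m d \<le> b"
  shows "(\<integral>x. \<phi> x * pdiff J (n(d := a)) f x \<partial>cube_measure) = (\<integral>x. \<phi> x * pdiff J (n(d := b)) f x \<partial>cube_measure)"
proof -
  have exp: "(\<integral>x. \<phi> x * pdiff J n f x \<partial>cube_measure) = (\<Sum>K\<in>Pow J. (- 1) ^ card K *
      (if shiftable K n then \<integral>x. \<phi> x * f (inf m (shift K n)) x \<partial>cube_measure else 0))" for n
  proof -
    have int: "integrable cube_measure (\<lambda>x. \<phi> x * f l x)" for l
      by (rule step_integrable_mult[OF \<phi> step_integrable[OF martingale_step[OF f]]])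
    have "(\<integral>x. \<phi> x * pdiff J n f x \<partial>cube_measure) = (\<integral>x. (\<Sum>K\<in>Pow J. (- 1) ^ card K *
      (if shiftable K n then \<phi> x * f (shift K n) x else 0)) \<partial>cube_measure)"
      unfolding pdiff_def sum_distrib_left by (intro integral_cong_cube sum.cong refl) auto
    also have "\<dots> = (\<Sum>K\<in>Pow J. \<integral>x. (- 1) ^ card K *
      (if shiftable K n then \<phi> x * f (shift K n) x else 0) \<partial>cube_measure)"
    proof (intro Bochner_Integration.integral_sum integrable_mult_right)
      show "integrable cube_measure (\<lambda>x. if shiftable K n then \<phi> x * f (shift K n) x else 0)" for K
        using int by (cases "shiftable K n") auto
    qed
    also have "\<dots> = (\<Sum>K\<in>Pow J. (- 1) ^ card K *
      (if shiftable K n then \<integral>x. \<phi> x * f (inf m (shift K n)) x \<partial>cube_measure else 0))"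
      by (intro sum.cong refl) (simp add: integral_mult_martingale[OF f \<phi>, symmetric])
    finally show ?thesis .
  qed
  have "inf m (shift K (n(d := a))) = inf m (shift K (n(d := b)))" if "K \<in> Pow J" for K
    using that d a b by (auto simp: shift_def fun_eq_iff inf_nat_def min_def)
  moreover have "shiftable K (n(d := c)) \<longleftrightarrow> shiftable K n" if "K \<in> Pow J" for K c
    using that d by (auto simp: shiftable_def)
  ultimately show ?thesis unfolding exp by (intro sum.cong refl) (simp only:)
qed

text \<open>The third condition says that \<open>a k\<close> has mean zero in every coordinate \<open>d\<close> over the intervals of every level
below \<open>k d\<close>. These properties survive multiplication by indicator functions of sets of the preceding level.\<close>

definition diff_family :: "(('d \<Rightarrow> nat) \<Rightarrow> real^'d \<Rightarrow> complex) \<Rightarrow> bool" where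
  "diff_family a \<longleftrightarrow> (\<forall>k. step k (a k)) \<and> (\<forall>k x. x \<notin> unit_cube \<longrightarrow> a k x = 0) \<and>
    (\<forall>k m d \<phi>. step m \<phi> \<longrightarrow> m d < k d \<longrightarrow> (\<integral>x. \<phi> x * a k x \<partial>cube_measure) = 0)"

text \<open>The set \<open>A k\<close> has level \<open>k d - 1\<close> in the coordinate \<open>d\<close>, so including its indicator function in the test
function keeps the level of the latter below \<open>k d\<close> in that coordinate.\<close>

lemma diff_family_mart_diff:
  assumes f: "f \<in> vilenkin_martingales p"
    and A: "\<And>k. step (\<lambda>d. k d - 1) (\<lambda>x. x \<in> A k)"
  shows "diff_family (\<lambda>k x. indicator (A k) x * mart_diff k f x)"
  unfolding diff_family_def
proof (intro conjI allI impI)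
  fix k :: "'d \<Rightarrow> nat"
  have "(\<lambda>d. k d - 1) \<le> k" by (auto simp: le_fun_def)
  then have "step k (indicator (A k) :: real^'d \<Rightarrow> complex)"
    using step_mono[OF step_indicator[OF A[of k]]] by blast
  then show "step k (\<lambda>x. indicator (A k) x * mart_diff k f x)"
    using step_pdiff[OF f, of k UNIV] by (simp add: mart_diff_eq_pdiff step_def)
  show "indicator (A k) x * mart_diff k f x = 0" if "x \<notin> unit_cube" for x
    using pdiff_outside[OF f that] by (simp add: mart_diff_eq_pdiff)
next
  fix k m :: "'d \<Rightarrow> nat" and d and \<phi> :: "real^'d \<Rightarrow> complex"
  assume \<phi>: "step m \<phi>" and md: "m d < k d"
  \<comment> \<open>The level of the test function together with the indicator function.\<close>
  define m' where "m' = sup m (\<lambda>d. k d - 1)"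
  have m': "m' d \<le> k d - 1" using md by (simp add: m'_def sup_nat_def)
  have "step m' \<phi>" "step m' (indicator (A k) :: real^'d \<Rightarrow> complex)"
    by (rule step_mono[OF \<phi>], simp add: m'_def)
      (rule step_mono[OF step_indicator[OF A[of k]]], simp add: m'_def)
  then have \<psi>: "step m' (\<lambda>x. \<phi> x * indicator (A k) x)" by (rule step_comp2)
  let ?J = "UNIV - {d}"
  have "mart_diff k f x = pdiff ?J (k(d := k d)) f x - pdiff ?J (k(d := k d - 1)) f x" for x
    using pdiff_insert[of d ?J k f x] md by (simp add: mart_diff_eq_pdiff insert_absorb)
  moreover have "integrable cube_measure (\<lambda>x. \<phi> x * indicator (A k) x * pdiff ?J n f x)" for n
    by (rule step_integrable_mult[OF \<psi> step_integrable[OF step_pdiff[OF f]]])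
  moreover have "(\<integral>x. \<phi> x * indicator (A k) x * pdiff ?J (k(d := k d)) f x \<partial>cube_measure)
    = (\<integral>x. \<phi> x * indicator (A k) x * pdiff ?J (k(d := k d - 1)) f x \<partial>cube_measure)"
    by (rule integral_mult_pdiff_cong[OF f \<psi>]) (use m' in auto)
  ultimately have "(\<integral>x. \<phi> x * indicator (A k) x * mart_diff k f x \<partial>cube_measure) = 0"
    by (simp add: right_diff_distrib)
  then show "(\<integral>x. \<phi> x * (indicator (A k) x * mart_diff k f x) \<partial>cube_measure) = 0"
    by (simp add: mult.assoc)
qed

lemma finite_le_fun: fixes n :: "'d \<Rightarrow> nat" shows "finite {k :: 'd \<Rightarrow> nat. k \<le> n}"
proof -
  have "{k. k \<le> n} = PiE UNIV (\<lambda>d. {..n d})" by (auto simp: le_fun_def PiE_iff)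
  then show ?thesis by (simp add: finite_PiE)
qed

definition psum :: "(('d \<Rightarrow> nat) \<Rightarrow> real^'d \<Rightarrow> complex) \<Rightarrow> ('d \<Rightarrow> nat) \<Rightarrow> real^'d \<Rightarrow> complex" where
  "psum a n x = (\<Sum>k | k \<le> n. a k x)"

text \<open>Taking the difference in one more coordinate removes from the sum all indices that are smaller than \<open>n\<close> in
that coordinate.\<close>

lemma mart_diff_psum: "mart_diff n (psum a) x = a n x"
proof -
  have "finite J \<Longrightarrow> pdiff J n (psum a) x = (\<Sum>k | k \<le> n \<and> (\<forall>d\<in>J. k d = n d). a k x)" for J :: "'d set"
  proof (induction J arbitrary: n rule: finite_induct)
    case empty
    then show ?case by (simp add: pdiff_empty psum_def)
  next
    case (insert d J)
    let ?S = "\<lambda>(n :: 'd \<Rightarrow> nat) J. {k. k \<le> n \<and> (\<forall>d\<in>J. k d = n d)}"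
    have fin: "finite (?S n J)" for n J by (rule finite_subset[OF _ finite_le_fun[of n]]) auto
    show ?case
    proof (cases "n d = 0")
      case True
      then have "k d = n d" if "k \<le> n" for k using le_funD[OF that, of d] by simp
      then have "?S n J = ?S n (insert d J)" by auto
      then show ?thesis using True insert by (simp add: pdiff_insert)
    next
      case False
      let ?n = "n(d := n d - 1)"
      have "?n \<le> n" by (auto simp: le_fun_def)
      then have "k \<le> n" if "k \<le> ?n" for k using that by (rule order_trans[rotated])
      then have "?S ?n J \<subseteq> ?S n J" using insert.hyps by auto
      moreover have "?S n J - ?S ?n J = ?S n (insert d J)"
        using insert.hyps False
      proof (intro set_eqI iffI)
        fix k assume k: "k \<in> ?S n J - ?S ?n J"
        then have le: "k \<le> n" and J: "\<forall>e\<in>J. k e = n e" by auto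
        have "k e = ?n e" if "e \<in> J" for e using J that insert.hyps by (cases "e = d") auto
        then have "\<not> k \<le> ?n" using k by auto
        then have "\<not> k d \<le> n d - 1" using le by (auto simp: le_fun_def split: if_splits)
        then show "k \<in> ?S n (insert d J)" using le J by (auto simp: le_fun_def le_antisym)
      next
        fix k assume k: "k \<in> ?S n (insert d J)"
        then have "\<not> k \<le> ?n" using False by (auto simp: le_fun_def intro!: exI[of _ d])
        then show "k \<in> ?S n J - ?S ?n J" using k by auto
      qed
      ultimately have "sum (\<lambda>k. a k x) (?S n (insert d J)) = sum (\<lambda>k. a k x) (?S n J) - sum (\<lambda>k. a k x) (?S ?n J)"
        using sum_diff[OF fin, of "?S ?n J" n J "\<lambda>k. a k x"] by simp
      then show ?thesis
        unfolding pdiff_insert[OF insert.hyps(2)] insert.IH using False by (simp only: if_False)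
    qed
  qed
  from this[of UNIV] have "mart_diff n (psum a) x = (\<Sum>k | k \<le> n \<and> (\<forall>d\<in>UNIV. k d = n d). a k x)"
    by (simp add: mart_diff_eq_pdiff)
  also have "{k. k \<le> n \<and> (\<forall>d\<in>UNIV. k d = n d)} = {n}" by (auto simp: fun_eq_iff)
  finally show ?thesis by simp
qed

lemma step_psum:
  assumes "diff_family a" shows "step n (psum a n)"
  unfolding psum_def using assms by (intro step_sum) (auto simp: diff_family_def intro: step_mono)

lemma psum_martingale:
  assumes a: "diff_family a" shows "psum a \<in> vilenkin_martingales p"
  unfolding vilenkin_martingales_iff
proof (intro conjI allI impI ballI)
  show "step n (psum a n)" for n using a by (rule step_psum)
  show "psum a n x = 0" if "x \<notin> unit_cube" for n x
    using a that by (simp add: psum_def diff_family_def)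
  fix n m :: "'d \<Rightarrow> nat" and x :: "real^'d" assume nm: "n \<le> m" and x: "x \<in> unit_cube"
  have st: "step k (a k)" for k using a by (simp add: diff_family_def)
  show "avg n (psum a m) x = psum a n x"
  proof (rule avg_eqI[OF step_psum[OF a] x])
    fix \<phi> :: "real^'d \<Rightarrow> complex" assume \<phi>: "step n \<phi>"
    have int: "integrable cube_measure (\<lambda>x. \<phi> x * a k x)" for k
      by (rule step_integrable_mult[OF \<phi> step_integrable[OF st]])
    have exp: "(\<integral>y. \<phi> y * psum a l y \<partial>cube_measure) = (\<Sum>k | k \<le> l. \<integral>y. \<phi> y * a k y \<partial>cube_measure)" for l
      unfolding psum_def sum_distrib_left using int by (rule Bochner_Integration.integral_sum)
    have "(\<integral>y. \<phi> y * a k y \<partial>cube_measure) = 0" if k: "\<not> k \<le> n" for k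
    proof -
      obtain d where "n d < k d" using k by (auto simp: le_fun_def not_le)
      then show ?thesis using a \<phi> unfolding diff_family_def by blast
    qed
    then show "(\<integral>y. \<phi> y * psum a m y \<partial>cube_measure) = (\<integral>y. \<phi> y * psum a n y \<partial>cube_measure)"
      unfolding exp using nm by (intro sum.mono_neutral_right finite_le_fun) auto
  qed
qed

text \<open>For two different indices one of them is not below the other, say in the coordinate \<open>d\<close>; the factor with
the smaller index in this coordinate is then an admissible test function for the other factor.\<close>

lemma psum_orthogonal:
  assumes a: "diff_family a"
  shows "(\<integral>x. (cmod (psum a n x))\<^sup>2 \<partial>cube_measure) = (\<Sum>k | k \<le> n. \<integral>x. (cmod (a k x))\<^sup>2 \<partial>cube_measure)"
proof -
  have st: "step k (a k)" for k using a by (simp add: diff_family_def)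
  have st_cnj: "step k (\<lambda>x. cnj (a k x))" for k using st[of k] by (simp add: step_def)
  have int: "integrable cube_measure (\<lambda>x. cnj (a l x) * a k x)" for k l
    by (rule step_integrable_mult[OF st_cnj step_integrable[OF st]])
  have zero1: "(\<integral>x. cnj (a l x) * a k x \<partial>cube_measure) = 0" if k: "\<not> k \<le> l" for k l
  proof -
    obtain d where "l d < k d" using k by (auto simp: le_fun_def not_le)
    then show ?thesis using a st_cnj[of l] unfolding diff_family_def by blast
  qed
  have zero: "(\<integral>x. cnj (a l x) * a k x \<partial>cube_measure) = 0" if "k \<noteq> l" for k l
  proof (cases "k \<le> l")
    case True
    then have "\<not> l \<le> k" using that by auto
    have "(\<integral>x. cnj (cnj (a k x) * a l x) \<partial>cube_measure) = cnj (\<integral>x. cnj (a k x) * a l x \<partial>cube_measure)"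
      by (rule integral_bounded_linear[OF bounded_linear_cnj int])
    moreover note zero1[OF \<open>\<not> l \<le> k\<close>]
    moreover have "(\<lambda>x. cnj (a l x) * a k x) = (\<lambda>x. cnj (cnj (a k x) * a l x))"
      by (simp add: fun_eq_iff mult.commute)
    ultimately show ?thesis by (simp only: complex_cnj_zero)
  qed (rule zero1)
  have "complex_of_real (\<integral>x. (cmod (psum a n x))\<^sup>2 \<partial>cube_measure)
    = (\<integral>x. complex_of_real ((cmod (psum a n x))\<^sup>2) \<partial>cube_measure)" by (rule integral_complex_of_real[symmetric])
  also have "\<dots> = (\<integral>x. (\<Sum>l | l \<le> n. \<Sum>k | k \<le> n. cnj (a l x) * a k x) \<partial>cube_measure)"
    unfolding complex_norm_square psum_def
    by (intro integral_cong_cube) (simp add: sum_product mult.commute, rule sum.swap)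
  also have "\<dots> = (\<Sum>l | l \<le> n. \<Sum>k | k \<le> n. \<integral>x. cnj (a l x) * a k x \<partial>cube_measure)"
    using int by (simp add: Bochner_Integration.integral_sum)
  also have "\<dots> = (\<Sum>l | l \<le> n. \<integral>x. cnj (a l x) * a l x \<partial>cube_measure)"
  proof (intro sum.cong refl)
    fix l assume "l \<in> {l. l \<le> n}"
    then have "(\<Sum>k | k \<le> n. \<integral>x. cnj (a l x) * a k x \<partial>cube_measure) = (\<Sum>k\<in>{l}. \<integral>x. cnj (a l x) * a k x \<partial>cube_measure)"
      using zero finite_le_fun by (intro sum.mono_neutral_right) auto
    then show "(\<Sum>k | k \<le> n. \<integral>x. cnj (a l x) * a k x \<partial>cube_measure) = (\<integral>x. cnj (a l x) * a l x \<partial>cube_measure)" by simp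
  qed
  also have "\<dots> = complex_of_real (\<Sum>l | l \<le> n. \<integral>x. (cmod (a l x))\<^sup>2 \<partial>cube_measure)"
    unfolding of_real_sum
    by (intro sum.cong refl) (simp only: integral_complex_of_real[symmetric] complex_norm_square mult.commute)
  finally show ?thesis by (simp only: of_real_eq_iff)
qed

lemma martingale_diff:
  assumes f: "f \<in> vilenkin_martingales p" and g: "g \<in> vilenkin_martingales p"
  shows "(\<lambda>n x. f n x - g n x) \<in> vilenkin_martingales p"
  unfolding vilenkin_martingales_iff
proof (intro conjI allI impI ballI)
  show st: "step n (\<lambda>x. f n x - g n x)" for n
    using martingale_step[OF f] martingale_step[OF g] by (simp add: step_def)
  show "f n x - g n x = 0" if "x \<notin> unit_cube" for n x
    using f g that by (simp add: martingale_outside)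
  fix n m :: "'d \<Rightarrow> nat" and x :: "real^'d" assume nm: "n \<le> m" and x: "x \<in> unit_cube"
  show "avg n (\<lambda>x. f m x - g m x) x = f n x - g n x"
  proof (rule avg_eqI[OF st x])
    fix \<phi> :: "real^'d \<Rightarrow> complex" assume \<phi>: "step n \<phi>"
    have int: "integrable cube_measure (\<lambda>x. \<phi> x * h l x)" if "h \<in> vilenkin_martingales p" for h l
      by (rule step_integrable_mult[OF \<phi> step_integrable[OF martingale_step[OF that]]])
    show "(\<integral>y. \<phi> y * (f m y - g m y) \<partial>cube_measure) = (\<integral>y. \<phi> y * (f n y - g n y) \<partial>cube_measure)"
      using int f g nm integral_mult_martingale[OF f \<phi>, of m] integral_mult_martingale[OF g \<phi>, of m]
      by (simp add: right_diff_distrib inf_absorb1)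
  qed
qed

section \<open>Iteration over the coordinates\<close>

text \<open>The chain of levels that refines the coordinate \<open>d\<close> while all others are kept at their final level in \<open>N\<close>.
It is cut off at \<open>N d\<close> in order to be defined for all \<open>k\<close>.\<close>

definition coord_chain :: "('d \<Rightarrow> nat) \<Rightarrow> 'd \<Rightarrow> nat \<Rightarrow> 'd \<Rightarrow> nat" where
  "coord_chain N d k = N(d := min k (N d))"

lemma coord_chain_mono: "coord_chain N d k \<le> coord_chain N d (Suc k)"
  by (auto simp: coord_chain_def le_fun_def)

lemma coord_chain_last: "coord_chain N d (N d) = N"
  by (auto simp: coord_chain_def)

lemma avg_nonneg: "(\<And>y. 0 \<le> u y) \<Longrightarrow> 0 \<le> avg n (u :: real^'d \<Rightarrow> real) x"
  using vol_pos[of n] by (auto simp: avg_def set_lebesgue_integral_def intro!: divide_nonneg_pos)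

text \<open>The majorant is the iterated one-parameter maximal function: averaging over a cell amounts to averaging
in one coordinate after the other, each step is dominated by the maximal function in that coordinate,
and each maximal function costs one application of Doob's inequality.\<close>

lemma strong_maximal_majorant:
  fixes u :: "real^'d \<Rightarrow> real"
  assumes u: "step N u" and u0: "\<And>x. 0 \<le> u x" and "finite J"
  shows "\<exists>v. step N v \<and> (\<forall>x. 0 \<le> v x) \<and>
    (\<forall>n x. n \<le> N \<longrightarrow> (\<forall>d. d \<notin> J \<longrightarrow> n d = N d) \<longrightarrow> x \<in> unit_cube \<longrightarrow> avg n u x \<le> v x) \<and>
    (\<integral>x. v x powr 2 \<partial>cube_measure) \<le> doob_const 2 ^ card J * (\<integral>x. u x powr 2 \<partial>cube_measure)"
  using \<open>finite J\<close>
proof (induction J rule: finite_induct)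
  case empty
  have "avg n u x \<le> u x" if "\<forall>d. d \<notin> {} \<longrightarrow> n d = N d" "x \<in> unit_cube" for n x
  proof -
    have "n = N" using that by auto
    then show ?thesis using avg_step_same[OF u that(2)] by simp
  qed
  then show ?case using u u0 by (intro exI[of _ u]) auto
next
  case (insert d J)
  then obtain v where v: "step N v" and v0: "\<And>x. 0 \<le> v x"
    and vmax: "\<And>n x. n \<le> N \<Longrightarrow> (\<forall>d. d \<notin> J \<longrightarrow> n d = N d) \<Longrightarrow> x \<in> unit_cube \<Longrightarrow> avg n u x \<le> v x"
    and vint: "(\<integral>x. v x powr 2 \<partial>cube_measure) \<le> doob_const 2 ^ card J * (\<integral>x. u x powr 2 \<partial>cube_measure)"
    by blast
  define Y where "Y k = avg (coord_chain N d k) v" for k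
  have stY: "step (coord_chain N d k) (Y k)" for k unfolding Y_def by (rule step_avg)
  have Y0: "0 \<le> Y k x" for k x unfolding Y_def by (rule avg_nonneg[OF v0])
  have sub: "0 \<le> (\<integral>x. \<phi> x * (Y (Suc k) x - Y k x) \<partial>cube_measure)" if \<phi>: "step (coord_chain N d k) \<phi>" for k \<phi>
  proof -
    have \<phi>': "step (coord_chain N d (Suc k)) \<phi>" using \<phi> coord_chain_mono by (rule step_mono)
    have "integrable cube_measure (\<lambda>x. \<phi> x * Y j x)" for j
      unfolding Y_def by (rule step_integrable_mult[OF \<phi> integrable_avg])
    then have "(\<integral>x. \<phi> x * (Y (Suc k) x - Y k x) \<partial>cube_measure)
      = (\<integral>x. \<phi> x * Y (Suc k) x \<partial>cube_measure) - (\<integral>x. \<phi> x * Y k x \<partial>cube_measure)"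
      by (simp add: right_diff_distrib)
    also have "\<dots> = 0"
      unfolding Y_def integral_mult_avg[OF \<phi> step_integrable[OF v]] integral_mult_avg[OF \<phi>' step_integrable[OF v]]
      by simp
    finally show ?thesis by simp
  qed
  define w where "w = runmax Y (N d)"
  have "step (coord_chain N d (N d)) w"
    unfolding w_def by (rule step_runmax[where \<nu> = "coord_chain N d" and K = "N d", OF coord_chain_mono stY order_refl])
  then have w: "step N w" by (simp add: coord_chain_last)
  have w0: "0 \<le> w x" for x unfolding w_def using Y0 by (rule runmax_nonneg)
  have wmax: "avg n u x \<le> w x"
    if n: "n \<le> N" "\<forall>e. e \<notin> insert d J \<longrightarrow> n e = N e" and x: "x \<in> unit_cube" for n x
  proof -
    \<comment> \<open>Averaging at level \<open>n\<close> is averaging at level \<open>?n\<close>, followed by averaging in the coordinate \<open>d\<close>.\<close>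
    let ?n = "n(d := N d)"
    have eq: "inf (coord_chain N d (n d)) ?n = n"
      using le_funD[OF n(1)] by (auto simp: coord_chain_def fun_eq_iff inf_nat_def min_def intro: le_antisym)
    have "avg n u x = avg (coord_chain N d (n d)) (avg ?n u) x"
      using avg_avg_step[OF u x, of "coord_chain N d (n d)" ?n] eq by simp
    also have "\<dots> \<le> Y (n d) x"
      unfolding Y_def
    proof (rule avg_mono[OF integrable_avg step_integrable[OF v] x])
      show "avg ?n u y \<le> v y" if "y \<in> unit_cube" for y
        using that le_funD[OF n(1)] n(2) by (intro vmax) (auto simp: le_fun_def)
    qed
    also have "\<dots> \<le> w x" unfolding w_def using le_funD[OF n(1)] by (rule runmax_ge)
    finally show ?thesis .
  qed
  have "(\<integral>x. w x powr 2 \<partial>cube_measure) \<le> doob_const 2 * (\<integral>x. Y (N d) x powr 2 \<partial>cube_measure)"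
    unfolding w_def
    by (rule doob_maximal[where \<nu> = "coord_chain N d"]) (use coord_chain_mono stY Y0 sub in auto)
  also have "(\<integral>x. Y (N d) x powr 2 \<partial>cube_measure) = (\<integral>x. v x powr 2 \<partial>cube_measure)"
    by (intro integral_cong_cube) (simp add: Y_def coord_chain_last avg_step_same[OF v])
  also have "doob_const 2 * (\<integral>x. v x powr 2 \<partial>cube_measure)
      \<le> doob_const 2 * (doob_const 2 ^ card J * (\<integral>x. u x powr 2 \<partial>cube_measure))"
    using vint by (intro mult_left_mono) (simp_all add: doob_const_def)
  also have "\<dots> = doob_const 2 ^ card (insert d J) * (\<integral>x. u x powr 2 \<partial>cube_measure)"
    using insert.hyps by simp
  finally show ?case using w w0 wmax by blast
qed

lemma superlevel_avg_in_filtration: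
  fixes \<theta> :: real
  shows "{x \<in> unit_cube. \<theta> < avg n (indicator E) x} \<in> sets (vilenkin_filtration p n)"
  unfolding sets_filtration_iff
proof
  show "step n (\<lambda>x. x \<in> {x \<in> unit_cube. \<theta> < avg n (indicator E) x})"
    unfolding step_def
  proof (intro ballI)
    fix x y :: "real^'d" assume xy: "x \<in> unit_cube" "y \<in> cell n x"
    then have "avg n (indicator E :: real^'d \<Rightarrow> real) y = avg n (indicator E) x"
      using stepD[OF step_avg] by blast
    then show "(y \<in> {x \<in> unit_cube. \<theta> < avg n (indicator E) x}) = (x \<in> {x \<in> unit_cube. \<theta> < avg n (indicator E) x})"
      using xy cell_cube by auto
  qed
qed auto

lemma sets_filtration_cube: "A \<in> sets (vilenkin_filtration p n) \<Longrightarrow> A \<in> sets cube_measure"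
  using subalgebra_filtration[of n] by (auto simp: subalgebra_def)

text \<open>Chebyshev's inequality for the square of the majorant. The indicator function is first replaced by its
average of level \<open>N\<close>, which has the same averages at all levels up to \<open>N\<close> and whose square is dominated by
itself.\<close>

lemma strong_maximal_weak_type_finite:
  assumes E: "E \<in> sets cube_measure" and \<theta>: "0 < \<theta>"
  shows "measure cube_measure {x \<in> unit_cube. \<exists>n\<le>N. \<theta> < avg n (indicator E) x}
    \<le> doob_const 2 ^ CARD('d) / \<theta>\<^sup>2 * measure cube_measure E" (is "measure _ ?B \<le> _")
proof -
  define u where "u = avg N (indicator E :: real^'d \<Rightarrow> real)"
  have iE: "integrable cube_measure (indicator E :: real^'d \<Rightarrow> real)"
    using E by (simp add: less_top[symmetric])
  have u: "step N u" unfolding u_def by (rule step_avg)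
  have u0: "0 \<le> u x" for x unfolding u_def by (rule avg_nonneg) simp
  have u1: "u x \<le> 1" if x: "x \<in> unit_cube" for x
  proof -
    have "u x \<le> avg N (\<lambda>_. 1) x"
      unfolding u_def by (rule avg_mono[OF iE step_integrable[OF step_const] x]) (simp add: indicator_def)
    also have "\<dots> = 1" by (rule avg_step_same[OF step_const x])
    finally show ?thesis .
  qed
  have eq: "avg n (indicator E) x = avg n u x" if "n \<le> N" for n x
    unfolding u_def using that iE by (rule avg_avg[symmetric])
  obtain v where v: "step N v" and v0: "\<And>x. 0 \<le> v x"
    and vmax: "\<And>n x. n \<le> N \<Longrightarrow> x \<in> unit_cube \<Longrightarrow> avg n u x \<le> v x"
    and vint: "(\<integral>x. v x powr 2 \<partial>cube_measure) \<le> doob_const 2 ^ CARD('d) * (\<integral>x. u x powr 2 \<partial>cube_measure)"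
    using strong_maximal_majorant[OF u u0, of UNIV] by auto
  have uint: "(\<integral>x. u x powr 2 \<partial>cube_measure) \<le> measure cube_measure E"
  proof -
    have "(\<integral>x. u x powr 2 \<partial>cube_measure) \<le> (\<integral>x. u x \<partial>cube_measure)"
    proof (rule integral_mono)
      show "integrable cube_measure (\<lambda>x. u x powr 2)"
        using u by (intro step_integrable[of N]) (simp add: step_def)
      show "integrable cube_measure u" by (rule step_integrable[OF u])
      show "u x powr 2 \<le> u x" if "x \<in> space cube_measure" for x
        using u0[of x] u1[of x] that by (simp add: powr_numeral power2_eq_square mult_left_le)
    qed
    also have "\<dots> = (\<integral>x. 1 * indicator E x \<partial>cube_measure)"
      using integral_mult_avg[OF step_const[of N 1] iE] by (simp add: u_def)
    also have "\<dots> = measure cube_measure E"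
      using sets.sets_into_space[OF E] by (simp add: Int_absorb2)
    finally show ?thesis .
  qed
  have "?B = (\<Union>n\<in>{n. n \<le> N}. {x \<in> unit_cube. \<theta> < avg n (indicator E) x})" by auto
  then have Bs: "?B \<in> sets cube_measure"
    using sets_filtration_cube[OF superlevel_avg_in_filtration] finite_le_fun by auto
  have "\<theta>\<^sup>2 * measure cube_measure ?B = (\<integral>x. \<theta>\<^sup>2 * indicator ?B x \<partial>cube_measure)"
    using sets.sets_into_space[OF Bs] by (simp add: Int_absorb2)
  also have "\<dots> \<le> (\<integral>x. v x powr 2 \<partial>cube_measure)"
  proof (rule integral_mono)
    show "integrable cube_measure (\<lambda>x. \<theta>\<^sup>2 * indicator ?B x :: real)"
      using Bs by (intro integrable_mult_right) (simp add: less_top[symmetric])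
    show "integrable cube_measure (\<lambda>x. v x powr 2)"
      using v by (intro step_integrable[of N]) (simp add: step_def)
    show "\<theta>\<^sup>2 * indicator ?B x \<le> v x powr 2" for x
    proof (cases "x \<in> ?B")
      case True
      then obtain n where "n \<le> N" "\<theta> < avg n u x" "x \<in> unit_cube" using eq by auto
      then have "\<theta> \<le> v x" using vmax by fastforce
      then show ?thesis using True \<theta> v0[of x] by (simp add: powr_numeral power_mono)
    qed simp
  qed
  also have "\<dots> \<le> doob_const 2 ^ CARD('d) * measure cube_measure E"
    using vint uint by (rule order_trans[OF _ mult_left_mono]) (simp add: doob_const_def)
  finally show ?thesis using \<theta> by (simp add: field_simps)
qed

definition box_level :: "nat \<Rightarrow> 'd \<Rightarrow> nat" where "box_level k = (\<lambda>_. k)"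

lemma le_box_level: "\<exists>k. n \<le> box_level k"
proof
  show "n \<le> box_level (Max (range n))" by (simp add: box_level_def le_fun_def)
qed

lemma box_level_mono: "i \<le> j \<Longrightarrow> box_level i \<le> box_level j"
  by (simp add: box_level_def le_fun_def)

lemma strong_maximal_weak_type:
  fixes \<theta> :: real
  assumes E: "E \<in> sets cube_measure" and \<theta>: "0 < \<theta>"
  shows "emeasure cube_measure {x \<in> unit_cube. \<exists>n. \<theta> < avg n (indicator E) x}
    \<le> ennreal (doob_const 2 ^ CARD('d) / \<theta>\<^sup>2) * emeasure cube_measure E"
proof -
  let ?B = "\<lambda>k. {x \<in> unit_cube. \<exists>n\<le>box_level k. \<theta> < avg n (indicator E) x}"
  have "?B k = (\<Union>n\<in>{n. n \<le> box_level k}. {x \<in> unit_cube. \<theta> < avg n (indicator E) x})" for k by auto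
  then have Bs: "?B k \<in> sets cube_measure" for k
    using sets_filtration_cube[OF superlevel_avg_in_filtration] finite_le_fun by auto
  have inc: "incseq ?B"
  proof (intro incseq_SucI subsetI)
    fix k x assume "x \<in> ?B k"
    then obtain n where "x \<in> unit_cube" "n \<le> box_level k" "\<theta> < avg n (indicator E) x" by blast
    moreover have "box_level k \<le> box_level (Suc k)" by (simp add: box_level_mono)
    ultimately show "x \<in> ?B (Suc k)" using order_trans by blast
  qed
  have U: "{x \<in> unit_cube. \<exists>n. \<theta> < avg n (indicator E) x} = (\<Union>k. ?B k)" using le_box_level by blast
  have "emeasure cube_measure {x \<in> unit_cube. \<exists>n. \<theta> < avg n (indicator E) x} = (SUP k. emeasure cube_measure (?B k))"
  proof -
    have "range ?B \<subseteq> sets cube_measure" using Bs by blast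
    from SUP_emeasure_incseq[OF this inc] show ?thesis unfolding U by simp
  qed
  also have "\<dots> \<le> ennreal (doob_const 2 ^ CARD('d) / \<theta>\<^sup>2 * measure cube_measure E)"
    using strong_maximal_weak_type_finite[OF E \<theta>]
    by (intro SUP_least) (simp add: cube.emeasure_eq_measure ennreal_leI)
  also have "\<dots> = ennreal (doob_const 2 ^ CARD('d) / \<theta>\<^sup>2) * emeasure cube_measure E"
    unfolding cube.emeasure_eq_measure
    by (rule ennreal_mult) (simp_all add: doob_const_def)
  finally show ?thesis .
qed

definition square_const :: "real \<Rightarrow> real" where
  "square_const r = doob_const r + 2 / (r * (r - 1))"

text \<open>The partial differences in the coordinates from \<open>J\<close> form a finite system of martingales along the chain in
a further coordinate \<open>d\<close>. Its increments are the partial differences in the coordinates from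
\<open>insert d J\<close>, so \<open>square_function_chain\<close> performs the induction step.\<close>

lemma square_function_coordinates:
  assumes f: "f \<in> vilenkin_martingales p" and r: "1 < r" "r \<le> 2" and "finite J"
  shows "(\<integral>x. (\<Sum>n | n \<le> N \<and> (\<forall>d. d \<notin> J \<longrightarrow> n d = N d). (cmod (pdiff J n f x))\<^sup>2) powr (r / 2) \<partial>cube_measure)
    \<le> square_const r ^ card J * (\<integral>x. cmod (f N x) powr r \<partial>cube_measure)"
  using \<open>finite J\<close>
proof (induction J rule: finite_induct)
  case empty
  have "{n. n \<le> N \<and> (\<forall>d. d \<notin> {} \<longrightarrow> n d = N d)} = {N}" by auto
  moreover have "(t\<^sup>2) powr (r / 2) = t powr r" if "0 \<le> t" for t :: real
    using that by (simp add: powr_powr powr_numeral[symmetric] del: powr_numeral)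
  ultimately show ?case by (simp add: pdiff_empty)
next
  case (insert d J)
  define I where "I J = {n. n \<le> N \<and> (\<forall>d. d \<notin> J \<longrightarrow> n d = N d)}" for J
  have fin: "finite (I J)" for J
    unfolding I_def by (rule finite_subset[OF _ finite_le_fun[of N]]) auto
  define X where "X k i = pdiff J (i(d := k)) f" for k and i :: "'d \<Rightarrow> nat"
  have Id: "i d = N d" if "i \<in> I J" for i using that insert.hyps by (auto simp: I_def)
  have stX: "step (coord_chain N d k) (X k i)" if "k \<le> N d" "i \<in> I J" for k i
  proof -
    have "i(d := k) \<le> coord_chain N d k" using that by (auto simp: I_def le_fun_def coord_chain_def)
    then show ?thesis unfolding X_def by (rule step_mono[OF step_pdiff[OF f]])
  qed
  have mart: "(\<integral>x. \<phi> x * (X (Suc k) i x - X k i x) \<partial>cube_measure) = 0"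
    if k: "k < N d" and \<phi>: "step (coord_chain N d k) \<phi>" for k i \<phi>
  proof -
    have int: "integrable cube_measure (\<lambda>x. \<phi> x * X j i x)" for j
      unfolding X_def by (rule step_integrable_mult[OF \<phi> step_integrable[OF step_pdiff[OF f]]])
    have "(\<integral>x. \<phi> x * X (Suc k) i x \<partial>cube_measure) = (\<integral>x. \<phi> x * X k i x \<partial>cube_measure)"
      unfolding X_def by (rule integral_mult_pdiff_cong[OF f \<phi> insert.hyps(2)]) (auto simp: coord_chain_def)
    then show ?thesis using int by (simp add: right_diff_distrib)
  qed
  have X0: "X 0 i x = pdiff (insert d J) (i(d := 0)) f x" for i x
    unfolding X_def by (simp add: pdiff_insert[OF insert.hyps(2)])
  have XS: "X (Suc k) i x - X k i x = pdiff (insert d J) (i(d := Suc k)) f x" for k i x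
    unfolding X_def by (simp add: pdiff_insert[OF insert.hyps(2)])
  have reindex: "(\<Sum>n\<in>I (insert d J). g n) = (\<Sum>i\<in>I J. g (i(d := 0)) + (\<Sum>k<N d. g (i(d := Suc k))))"
    for g :: "('d \<Rightarrow> nat) \<Rightarrow> real"
  proof -
    have "bij_betw (\<lambda>(i, k). i(d := k)) (I J \<times> {..N d}) (I (insert d J))"
    proof (rule bij_betw_byWitness[where f' = "\<lambda>n. (n(d := N d), n d)"])
      show "\<forall>ik\<in>I J \<times> {..N d}. (\<lambda>n. (n(d := N d), n d)) ((\<lambda>(i, k). i(d := k)) ik) = ik"
        using Id by (auto simp: fun_eq_iff)
      show "(\<lambda>(i, k). i(d := k)) ` (I J \<times> {..N d}) \<subseteq> I (insert d J)"
        by (auto simp: I_def le_fun_def)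
      show "(\<lambda>n. (n(d := N d), n d)) ` I (insert d J) \<subseteq> I J \<times> {..N d}"
        by (auto simp: I_def le_fun_def)
    qed auto
    from sum.reindex_bij_betw[OF this, of g]
    have "(\<Sum>n\<in>I (insert d J). g n) = (\<Sum>i\<in>I J. \<Sum>k\<le>N d. g (i(d := k)))"
      by (simp add: sum.cartesian_product split_def)
    then show ?thesis by (simp add: sum.atMost_shift)
  qed
  have "(\<integral>x. (\<Sum>n\<in>I (insert d J). (cmod (pdiff (insert d J) n f x))\<^sup>2) powr (r / 2) \<partial>cube_measure)
    = (\<integral>x. (\<Sum>i\<in>I J. (cmod (X 0 i x))\<^sup>2 + (\<Sum>k<N d. (cmod (X (Suc k) i x - X k i x))\<^sup>2)) powr (r / 2) \<partial>cube_measure)"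
    unfolding reindex X0 XS ..
  also have "\<dots> \<le> square_const r * (\<integral>x. (\<Sum>i\<in>I J. (cmod (X (N d) i x))\<^sup>2) powr (r / 2) \<partial>cube_measure)"
    unfolding square_const_def
    by (rule square_function_chain[where \<nu> = "coord_chain N d"]) (use r fin coord_chain_mono stX mart in auto)
  also have "(\<lambda>x. \<Sum>i\<in>I J. (cmod (X (N d) i x))\<^sup>2) = (\<lambda>x. \<Sum>i\<in>I J. (cmod (pdiff J i f x))\<^sup>2)"
    unfolding X_def using Id by (intro ext sum.cong refl) (metis fun_upd_triv)
  also have "square_const r * (\<integral>x. (\<Sum>i\<in>I J. (cmod (pdiff J i f x))\<^sup>2) powr (r / 2) \<partial>cube_measure)
    \<le> square_const r * (square_const r ^ card J * (\<integral>x. cmod (f N x) powr r \<partial>cube_measure))"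
    using insert.IH r unfolding I_def by (intro mult_left_mono) (simp_all add: square_const_def doob_const_def)
  finally show ?case using insert.hyps by (simp add: I_def mult.assoc)
qed

lemma square_function_finite:
  assumes "f \<in> vilenkin_martingales p" and "1 < r" "r \<le> 2"
  shows "(\<integral>x. (\<Sum>n | n \<le> N. (cmod (mart_diff n f x))\<^sup>2) powr (r / 2) \<partial>cube_measure)
    \<le> square_const r ^ CARD('d) * (\<integral>x. cmod (f N x) powr r \<partial>cube_measure)"
  using square_function_coordinates[OF assms, of UNIV N] by (simp add: mart_diff_eq_pdiff)

end

section \<open>Powers of extended nonnegative reals\<close>

lemma epowr_ennreal: "0 \<le> y \<Longrightarrow> epowr (ennreal y) a = ennreal (y powr a)"
  by (simp add: epowr_def)

lemma epowr_top: "epowr top a = top"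
  by (simp add: epowr_def)

lemma epowr_mono: "x \<le> y \<Longrightarrow> 0 < a \<Longrightarrow> epowr x a \<le> epowr y a"
  by (cases x; cases y) (auto simp: epowr_ennreal epowr_top top_unique intro!: ennreal_leI powr_mono2)

lemma epowr_epowr: "epowr (epowr x a) b = epowr x (a * b)"
  by (cases x) (simp_all add: epowr_ennreal epowr_top powr_powr)

lemma epowr_one: "epowr x 1 = x"
  by (cases x) (simp_all add: epowr_ennreal epowr_top)

lemma epowr_two: "epowr x 2 = x\<^sup>2"
  by (cases x) (simp_all add: epowr_ennreal epowr_top ennreal_power ennreal_top_mult power2_eq_square powr_numeral ennreal_mult')

lemma epowr_mult:
  assumes "0 \<le> c" "0 < a" shows "epowr (ennreal c * x) a = ennreal (c powr a) * epowr x a"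
proof (cases x)
  case (real y)
  then show ?thesis using assms
    by (simp add: epowr_ennreal ennreal_mult'[symmetric] powr_mult)
next
  case top
  then show ?thesis using assms
    by (cases "c = 0") (auto simp: epowr_top ennreal_mult_top epowr_ennreal[of 0, simplified])
qed

lemma epowr_measurable [measurable]: "(\<lambda>x. epowr x a) \<in> borel_measurable borel"
  unfolding epowr_def by measurable

text \<open>The function \<open>\<lambda>x. epowr x (1 / a)\<close> is a monotone inverse, so every \<open>T k\<close> is below the inverse image of the
right-hand side.\<close>

lemma epowr_SUP_le:
  assumes "0 < a" shows "epowr (SUP k. T k) a \<le> (SUP k. epowr (T k) a)"
proof -
  let ?L = "SUP k. epowr (T k) a"
  have "T k \<le> epowr ?L (1 / a)" for k
  proof -
    have "T k = epowr (epowr (T k) a) (1 / a)" using assms by (simp add: epowr_epowr epowr_one)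
    also have "\<dots> \<le> epowr ?L (1 / a)" using assms by (intro epowr_mono SUP_upper) auto
    finally show ?thesis .
  qed
  then have "epowr (SUP k. T k) a \<le> epowr (epowr ?L (1 / a)) a"
    using assms by (intro epowr_mono SUP_least) auto
  then show ?thesis using assms by (simp add: epowr_epowr epowr_one)
qed

section \<open>From truncated estimates to norm estimates\<close>

text \<open>Integrated over \<open>s = S x\<close>, this is the measure of \<open>{S > t}\<close> plus \<open>1 / t\<^sup>2\<close> times the integral of \<open>S\<^sup>2\<close> over
its complement. The two parts appear as a single integrand so that Tonelli's theorem needs to be
applied only once.\<close>

definition trunc_kernel :: "real \<Rightarrow> ennreal \<Rightarrow> ennreal" where
  "trunc_kernel t s = (if ennreal t < s then 1 else s\<^sup>2 * ennreal (1 / t\<^sup>2))"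

lemma nn_integral_powr_below:
  fixes y q :: real
  assumes "0 < q" "0 \<le> y"
  shows "(\<integral>\<^sup>+t. ennreal (q * t powr (q - 1)) * indicator {t. 0 < t \<and> t < y} t \<partial>lborel) = ennreal (y powr q)"
proof -
  have "((\<lambda>t. q * t powr (q - 1)) has_integral (q * (y powr q / q))) {0..y}"
    using has_integral_mult_right[OF has_integral_powr_from_0[of "q - 1" y], of q] assms by simp
  then have "(\<integral>\<^sup>+t. ennreal (indicator {0..y} t * (q * t powr (q - 1))) \<partial>lborel) = ennreal (q * (y powr q / q))"
    using assms by (intro nn_integral_has_integral_lebesgue) auto
  moreover have "(\<integral>\<^sup>+t. ennreal (q * t powr (q - 1)) * indicator {t. 0 < t \<and> t < y} t \<partial>lborel)
    = (\<integral>\<^sup>+t. ennreal (indicator {0..y} t * (q * t powr (q - 1))) \<partial>lborel)"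
  proof (rule nn_integral_cong_AE)
    show "AE t in lborel. ennreal (q * t powr (q - 1)) * indicator {t. 0 < t \<and> t < y} t
      = ennreal (indicator {0..y} t * (q * t powr (q - 1)))"
      using AE_lborel_singleton[of 0] AE_lborel_singleton[of y]
      by eventually_elim (auto simp: indicator_def)
  qed
  ultimately show ?thesis using assms by simp
qed

lemma nn_integral_powr_above:
  fixes s q :: real
  assumes "0 < q" "q < 2" "0 < s"
  shows "(\<integral>\<^sup>+t. ennreal (q * t powr (q - 1)) * indicator {s..} t * ennreal (s\<^sup>2 / t\<^sup>2) \<partial>lborel)
    = ennreal (q / (2 - q) * s powr q)"
proof -
  have "((\<lambda>t. (q * s\<^sup>2) * t powr (q - 3)) has_integral (q * s\<^sup>2 * (- (s powr (q - 3 + 1)) / (q - 3 + 1)))) {s..}"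
    using assms by (intro has_integral_mult_right has_integral_powr_to_inf) auto
  then have "(\<integral>\<^sup>+t. ennreal (indicator {s..} t * ((q * s\<^sup>2) * t powr (q - 3))) \<partial>lborel)
      = ennreal (q * s\<^sup>2 * (- (s powr (q - 3 + 1)) / (q - 3 + 1)))"
    using assms by (intro nn_integral_has_integral_lebesgue) auto
  moreover have "ennreal (q * t powr (q - 1)) * indicator {s..} t * ennreal (s\<^sup>2 / t\<^sup>2)
    = ennreal (indicator {s..} t * ((q * s\<^sup>2) * t powr (q - 3)))" for t
  proof (cases "s \<le> t")
    case True
    then have t: "0 < t" using assms by simp
    have "t powr (q - 1) = t powr (q - 3) * t powr 2" by (simp add: powr_add[symmetric])
    also have "t powr 2 = t\<^sup>2" using t by (simp add: powr_numeral)
    finally have "q * t powr (q - 1) * (s\<^sup>2 / t\<^sup>2) = q * s\<^sup>2 * t powr (q - 3)"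
      using t by simp
    then show ?thesis using True assms by (simp add: ennreal_mult''[symmetric])
  qed simp
  moreover have "q * s\<^sup>2 * (- (s powr (q - 3 + 1)) / (q - 3 + 1)) = q / (2 - q) * s powr q"
  proof -
    have "s powr q = s powr (q - 2) * s powr 2" by (simp add: powr_add[symmetric])
    also have "s powr 2 = s\<^sup>2" using assms by (simp add: powr_numeral)
    finally have "s powr q = s\<^sup>2 * s powr (q - 2)" by simp
    moreover have "- (s powr (q - 3 + 1)) / (q - 3 + 1) = s powr (q - 2) / (2 - q)"
      by (simp add: minus_divide_left[symmetric] minus_divide_right)
    ultimately show ?thesis by simp
  qed
  ultimately show ?thesis by simp
qed

text \<open>The two parts of the kernel integrate to \<open>s\<^sup>q\<close> and \<open>q / (2 - q) s\<^sup>q\<close>; the second one converges because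
\<open>q < 2\<close>.\<close>

lemma nn_integral_trunc_kernel_le:
  assumes q: "0 < q" "q < 2"
  shows "(\<integral>\<^sup>+t. ennreal (q * t powr (q - 1)) * indicator {0<..} t * trunc_kernel t s \<partial>lborel)
    \<le> ennreal (1 + q / (2 - q)) * epowr s q"
proof (cases s)
  case top
  have "0 < 1 + q / (2 - q)" using q by (simp add: add_pos_pos)
  then show ?thesis using top by (simp add: epowr_top ennreal_mult_top)
next
  case (real r)
  have "(\<integral>\<^sup>+t. ennreal (q * t powr (q - 1)) * indicator {0<..} t * trunc_kernel t s \<partial>lborel)
    = (\<integral>\<^sup>+t. ennreal (q * t powr (q - 1)) * indicator {t. 0 < t \<and> t < r} t
        + ennreal (q * t powr (q - 1)) * indicator {r..} t * ennreal (r\<^sup>2 / t\<^sup>2) \<partial>lborel)"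
  proof (intro nn_integral_cong_AE)
    show "AE t in lborel. ennreal (q * t powr (q - 1)) * indicator {0<..} t * trunc_kernel t s
      = ennreal (q * t powr (q - 1)) * indicator {t. 0 < t \<and> t < r} t
        + ennreal (q * t powr (q - 1)) * indicator {r..} t * ennreal (r\<^sup>2 / t\<^sup>2)"
      using AE_lborel_singleton[of 0]
    proof eventually_elim
      case (elim t)
      have "s\<^sup>2 * ennreal (1 / t\<^sup>2) = ennreal (r\<^sup>2 / t\<^sup>2)"
        using real by (simp add: ennreal_power ennreal_mult''[symmetric])
      then show ?case using real elim
        by (auto simp: trunc_kernel_def indicator_def ennreal_less_iff)
    qed
  qed
  also have "\<dots> = ennreal (r powr q) +
    (\<integral>\<^sup>+t. ennreal (q * t powr (q - 1)) * indicator {r..} t * ennreal (r\<^sup>2 / t\<^sup>2) \<partial>lborel)"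
    using nn_integral_powr_below[of q r] real q by (subst nn_integral_add) auto
  also have "(\<integral>\<^sup>+t. ennreal (q * t powr (q - 1)) * indicator {r..} t * ennreal (r\<^sup>2 / t\<^sup>2) \<partial>lborel)
    = ennreal (q / (2 - q) * r powr q)"
  proof (cases "r = 0")
    case False
    then show ?thesis using nn_integral_powr_above[of q r] q real by simp
  qed simp
  also have "ennreal (r powr q) + ennreal (q / (2 - q) * r powr q) = ennreal (1 + q / (2 - q)) * epowr s q"
    using real q by (simp add: epowr_ennreal ennreal_plus[symmetric] ennreal_mult''[symmetric] distrib_right del: ennreal_plus)
  finally show ?thesis by simp
qed

text \<open>The layer cake formula for \<open>Y\<^sup>q\<close>, the weak estimate at every height \<open>t\<close>, and Tonelli's theorem to integrate
over \<open>t\<close> first.\<close>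

lemma truncated_estimate_integral:
  fixes Y :: "'a \<Rightarrow> real" and S :: "'a \<Rightarrow> ennreal"
  assumes M: "sigma_finite_measure M" and q: "0 < q" "q < 2"
    and Y [measurable]: "Y \<in> borel_measurable M" and Y0: "\<And>x. 0 \<le> Y x"
    and S [measurable]: "S \<in> borel_measurable M"
    and weak: "\<And>t. 0 < t \<Longrightarrow> emeasure M {x \<in> space M. t < Y x} \<le> C * (\<integral>\<^sup>+x. trunc_kernel t (S x) \<partial>M)"
  shows "(\<integral>\<^sup>+x. ennreal (Y x powr q) \<partial>M) \<le> C * ennreal (1 + q / (2 - q)) * (\<integral>\<^sup>+x. epowr (S x) q \<partial>M)"
proof -
  interpret M: sigma_finite_measure M by (rule M)
  interpret pair_sigma_finite M lborel ..
  let ?w = "\<lambda>t. ennreal (q * t powr (q - 1)) * indicator {0<..} t"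
  have [measurable]: "(\<lambda>z. trunc_kernel (snd z) (S (fst z))) \<in> borel_measurable (M \<Otimes>\<^sub>M lborel)"
    unfolding trunc_kernel_def by measurable
  have "(\<integral>\<^sup>+x. ennreal (Y x powr q) \<partial>M) = (\<integral>\<^sup>+x. (\<integral>\<^sup>+t. ?w t * indicator {x \<in> space M. t < Y x} x \<partial>lborel) \<partial>M)"
  proof (rule nn_integral_cong)
    fix x assume "x \<in> space M"
    then have "(\<integral>\<^sup>+t. ?w t * indicator {x \<in> space M. t < Y x} x \<partial>lborel)
      = (\<integral>\<^sup>+t. ennreal (q * t powr (q - 1)) * indicator {t. 0 < t \<and> t < Y x} t \<partial>lborel)"
      by (intro nn_integral_cong) (auto simp: indicator_def)
    then show "ennreal (Y x powr q) = (\<integral>\<^sup>+t. ?w t * indicator {x \<in> space M. t < Y x} x \<partial>lborel)"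
      using nn_integral_powr_below[OF q(1) Y0] by simp
  qed
  also have "\<dots> = (\<integral>\<^sup>+t. (\<integral>\<^sup>+x. ?w t * indicator {x \<in> space M. t < Y x} x \<partial>M) \<partial>lborel)"
    by (rule Fubini'[symmetric]) measurable
  also have "\<dots> \<le> (\<integral>\<^sup>+t. (\<integral>\<^sup>+x. C * (?w t * trunc_kernel t (S x)) \<partial>M) \<partial>lborel)"
  proof (rule nn_integral_mono)
    fix t :: real
    have [measurable]: "(\<lambda>x. trunc_kernel t (S x)) \<in> borel_measurable M"
      unfolding trunc_kernel_def by measurable
    show "(\<integral>\<^sup>+x. ?w t * indicator {x \<in> space M. t < Y x} x \<partial>M) \<le> (\<integral>\<^sup>+x. C * (?w t * trunc_kernel t (S x)) \<partial>M)"
    proof (cases "0 < t")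
      case True
      have "(\<integral>\<^sup>+x. ?w t * indicator {x \<in> space M. t < Y x} x \<partial>M) = ?w t * emeasure M {x \<in> space M. t < Y x}"
        by (rule nn_integral_cmult_indicator) measurable
      also have "\<dots> \<le> ?w t * (C * (\<integral>\<^sup>+x. trunc_kernel t (S x) \<partial>M))"
        by (rule mult_left_mono[OF weak[OF True]]) simp
      also have "\<dots> = C * (?w t * (\<integral>\<^sup>+x. trunc_kernel t (S x) \<partial>M))"
        by (rule mult.left_commute)
      also have "\<dots> = (\<integral>\<^sup>+x. C * (?w t * trunc_kernel t (S x)) \<partial>M)"
        by (simp add: nn_integral_cmult mult.assoc)
      finally show ?thesis .
    qed simp
  qed
  also have "\<dots> = (\<integral>\<^sup>+x. (\<integral>\<^sup>+t. C * (?w t * trunc_kernel t (S x)) \<partial>lborel) \<partial>M)"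
    by (rule Fubini') measurable
  also have "\<dots> \<le> (\<integral>\<^sup>+x. C * (ennreal (1 + q / (2 - q)) * epowr (S x) q) \<partial>M)"
  proof (rule nn_integral_mono)
    fix x
    have [measurable]: "(\<lambda>t. trunc_kernel t (S x)) \<in> borel_measurable lborel"
      unfolding trunc_kernel_def by measurable
    show "(\<integral>\<^sup>+t. C * (?w t * trunc_kernel t (S x)) \<partial>lborel) \<le> C * (ennreal (1 + q / (2 - q)) * epowr (S x) q)"
      by (subst nn_integral_cmult, measurable) (intro mult_left_mono nn_integral_trunc_kernel_le q, simp)
  qed
  also have "\<dots> = C * ennreal (1 + q / (2 - q)) * (\<integral>\<^sup>+x. epowr (S x) q \<partial>M)"
    by (simp add: nn_integral_cmult mult.assoc)
  finally show ?thesis .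
qed

context vilenkin_system
begin

section \<open>The square function as a limit\<close>

definition square_sum :: "(('d \<Rightarrow> nat) \<Rightarrow> real^'d \<Rightarrow> complex) \<Rightarrow> nat \<Rightarrow> real^'d \<Rightarrow> real" where
  "square_sum f k x = (\<Sum>n | n \<le> box_level k. (cmod (mart_diff n f x))\<^sup>2)"

lemma square_sum_nonneg: "0 \<le> square_sum f k x"
  by (simp add: square_sum_def sum_nonneg)

lemma square_sum_mono: "i \<le> j \<Longrightarrow> square_sum f i x \<le> square_sum f j x"
  unfolding square_sum_def using box_level_mono[of i j]
  by (intro sum_mono2 finite_le_fun) (auto intro: order_trans)

lemma step_square_sum:
  assumes f: "f \<in> vilenkin_martingales p" shows "step (box_level k) (square_sum f k)"
proof -
  have "step (box_level k) (mart_diff n f)" if "n \<le> box_level k" for n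
    unfolding mart_diff_eq_pdiff using step_pdiff[OF f] that by (rule step_mono)
  then show ?thesis by (simp add: square_sum_def step_def)
qed

text \<open>Every finite set of indices is contained in some cube \<open>{n. n \<le> box_level k}\<close>.\<close>

lemma square_function_SUP: "square_function f x = epowr (SUP k. ennreal (square_sum f k x)) (1 / 2)"
proof -
  let ?h = "\<lambda>n. ennreal ((cmod (mart_diff n f x))\<^sup>2)"
  have s: "(\<Sum>n | n \<le> box_level k. ?h n) = ennreal (square_sum f k x)" for k
    by (simp add: square_sum_def sum_ennreal)
  have "(\<Sum>\<^sub>\<infinity>n. ?h n) = (SUP F\<in>{F. finite F \<and> F \<subseteq> UNIV}. sum ?h F)"
    by (rule nonneg_infsum_complete) simp
  also have "\<dots> = (SUP k. ennreal (square_sum f k x))"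
  proof (rule antisym)
    show "(SUP F\<in>{F. finite F \<and> F \<subseteq> UNIV}. sum ?h F) \<le> (SUP k. ennreal (square_sum f k x))"
    proof (rule SUP_least)
      fix F :: "('d \<Rightarrow> nat) set" assume "F \<in> {F. finite F \<and> F \<subseteq> UNIV}"
      then have F: "finite F" by simp
      obtain k where k: "\<And>n. n \<le> box_level (k n)" using le_box_level by metis
      have "n \<le> box_level (\<Sum>n\<in>F. k n)" if "n \<in> F" for n
        using k[of n] box_level_mono[OF member_le_sum[of n F k]] F that by (auto intro: order_trans)
      then have "sum ?h F \<le> (\<Sum>n | n \<le> box_level (\<Sum>n\<in>F. k n). ?h n)"
        by (intro sum_mono2 finite_le_fun) auto
      also have "\<dots> \<le> (SUP k. ennreal (square_sum f k x))" unfolding s by (rule SUP_upper) simp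
      finally show "sum ?h F \<le> (SUP k. ennreal (square_sum f k x))" .
    qed
    show "(SUP k. ennreal (square_sum f k x)) \<le> (SUP F\<in>{F. finite F \<and> F \<subseteq> UNIV}. sum ?h F)"
      unfolding s[symmetric] by (intro SUP_mono) (auto intro!: finite_le_fun)
  qed
  finally show ?thesis by (simp add: square_function_def)
qed

lemma square_function_measurable:
  assumes f: "f \<in> vilenkin_martingales p"
  shows "square_function f \<in> borel_measurable cube_measure"
proof -
  have [measurable]: "square_sum f k \<in> borel_measurable cube_measure" for k
    by (rule step_measurable[OF step_square_sum[OF f]])
  show ?thesis unfolding square_function_SUP[abs_def] by measurable
qed

lemma square_sum_le_square_function: "ennreal (square_sum f k x) \<le> (square_function f x)\<^sup>2"
proof -
  have "ennreal (square_sum f k x) \<le> (SUP k. ennreal (square_sum f k x))" by (rule SUP_upper) simp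
  also have "\<dots> = (square_function f x)\<^sup>2"
    by (simp add: square_function_SUP epowr_two[symmetric] epowr_epowr epowr_one)
  finally show ?thesis .
qed

text \<open>Monotone convergence from the finite square functions.\<close>

lemma square_function_le_martingale:
  assumes f: "f \<in> vilenkin_martingales p" and r: "1 < r" "r \<le> 2"
  shows "(\<integral>\<^sup>+x. epowr (square_function f x) r \<partial>cube_measure)
    \<le> ennreal (square_const r ^ CARD('d)) * (SUP n. \<integral>\<^sup>+x. ennreal (cmod (f n x) powr r) \<partial>cube_measure)"
proof -
  let ?R = "SUP n. \<integral>\<^sup>+x. ennreal (cmod (f n x) powr r) \<partial>cube_measure"
  have c0: "0 \<le> square_const r ^ CARD('d)" using r by (simp add: square_const_def doob_const_def)
  have st: "step (box_level k) (\<lambda>x. square_sum f k x powr (r / 2))" for k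
    using step_square_sum[OF f, of k] by (simp add: step_def)
  have "(\<integral>\<^sup>+x. epowr (square_function f x) r \<partial>cube_measure)
    \<le> (\<integral>\<^sup>+x. (SUP k. ennreal (square_sum f k x powr (r / 2))) \<partial>cube_measure)"
  proof (rule nn_integral_mono)
    fix x
    have "epowr (square_function f x) r = epowr (SUP k. ennreal (square_sum f k x)) (r / 2)"
      by (simp add: square_function_SUP epowr_epowr)
    also have "\<dots> \<le> (SUP k. epowr (ennreal (square_sum f k x)) (r / 2))"
      using r by (intro epowr_SUP_le) simp
    finally show "epowr (square_function f x) r \<le> (SUP k. ennreal (square_sum f k x powr (r / 2)))"
      by (simp add: epowr_ennreal square_sum_nonneg)
  qed
  also have "\<dots> = (SUP k. \<integral>\<^sup>+x. ennreal (square_sum f k x powr (r / 2)) \<partial>cube_measure)"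
  proof (rule nn_integral_monotone_convergence_SUP)
    show "incseq (\<lambda>k x. ennreal (square_sum f k x powr (r / 2)))"
      using r square_sum_mono square_sum_nonneg
      by (auto simp: incseq_def le_fun_def intro!: ennreal_leI powr_mono2)
    show "(\<lambda>x. ennreal (square_sum f k x powr (r / 2))) \<in> borel_measurable cube_measure" for k
      using step_measurable[OF st[of k]] by measurable
  qed
  also have "\<dots> \<le> ennreal (square_const r ^ CARD('d)) * ?R"
  proof (rule SUP_least)
    fix k
    let ?N = "box_level k"
    have stf: "step ?N (\<lambda>x. cmod (f ?N x) powr r)"
      using martingale_step[OF f, of ?N] by (simp add: step_def)
    have "(\<integral>\<^sup>+x. ennreal (square_sum f k x powr (r / 2)) \<partial>cube_measure)
      = ennreal (\<integral>x. square_sum f k x powr (r / 2) \<partial>cube_measure)"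
      by (rule nn_integral_eq_integral[OF step_integrable[OF st]]) simp
    also have "\<dots> \<le> ennreal (square_const r ^ CARD('d) * (\<integral>x. cmod (f ?N x) powr r \<partial>cube_measure))"
      unfolding square_sum_def by (rule ennreal_leI[OF square_function_finite[OF f r]])
    also have "\<dots> = ennreal (square_const r ^ CARD('d)) * ennreal (\<integral>x. cmod (f ?N x) powr r \<partial>cube_measure)"
      by (rule ennreal_mult[OF c0]) simp
    also have "ennreal (\<integral>x. cmod (f ?N x) powr r \<partial>cube_measure) = (\<integral>\<^sup>+x. ennreal (cmod (f ?N x) powr r) \<partial>cube_measure)"
      by (rule nn_integral_eq_integral[OF step_integrable[OF stf], symmetric]) simp
    also have "ennreal (square_const r ^ CARD('d)) * (\<integral>\<^sup>+x. ennreal (cmod (f ?N x) powr r) \<partial>cube_measure)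
        \<le> ennreal (square_const r ^ CARD('d)) * ?R"
      by (intro mult_left_mono SUP_upper) simp_all
    finally show "(\<integral>\<^sup>+x. ennreal (square_sum f k x powr (r / 2)) \<partial>cube_measure) \<le> ennreal (square_const r ^ CARD('d)) * ?R" .
  qed
  finally show ?thesis .
qed

section \<open>Splitting a martingale at a level of its square function\<close>

abbreviation pred_level :: "('d \<Rightarrow> nat) \<Rightarrow> 'd \<Rightarrow> nat" where
  "pred_level n \<equiv> (\<lambda>d. n d - 1)"

text \<open>The only place where the boundedness of the sequences is used: a cell has boundedly many children.\<close>

lemma vol_pred_level:
  obtains B where "1 \<le> B" "\<And>n. vol (pred_level n) \<le> B * vol n"
proof -
  have "\<exists>B. \<forall>n\<ge>1. p d n \<le> B" for d using vil[of d] by (auto simp: vilenkin_sequence_def)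
  then obtain b where b: "\<And>d n. 1 \<le> n \<Longrightarrow> p d n \<le> b d" by metis
  define B where "B = (\<Prod>d\<in>UNIV. real (Suc (b d)))"
  have step1: "1 / real (W d (k - 1)) \<le> real (Suc (b d)) * (1 / real (W d k))" for d k
  proof (cases k)
    case 0
    then show ?thesis using W_pos[of d 0] by (simp add: divide_right_mono)
  next
    case (Suc j)
    have "real (p d k) \<le> real (Suc (b d))" using b[of k d] Suc by simp
    then have "real (p d k) * (1 / real (W d k)) \<le> real (Suc (b d)) * (1 / real (W d k))"
      by (intro mult_right_mono) auto
    moreover have "real (p d k) * (1 / real (W d k)) = 1 / real (W d (k - 1))"
      using Suc W_pos[of d k] by (simp add: vilenkin_prod_Suc)
    ultimately show ?thesis by simp
  qed
  show ?thesis
  proof (rule that[of B])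
    show "1 \<le> B" unfolding B_def by (intro prod_ge_1) simp
    show "vol (pred_level n) \<le> B * vol n" for n
      unfolding B_def vol_def prod.distrib[symmetric] by (intro prod_mono) (use step1 in auto)
  qed
qed

lemma avg_indicator: "x \<in> unit_cube \<Longrightarrow> A \<in> sets cube_measure \<Longrightarrow>
    avg n (indicator A :: real^'d \<Rightarrow> real) x = measure cube_measure (cell n x \<inter> A) / vol n"
  using integral_cell_step[of n "\<lambda>_. 1 :: real" x A] by (simp add: avg_def step_const divide_inverse mult.commute)

lemma avg_indicator_parent:
  assumes B: "vol (pred_level n) \<le> B * vol n" and x: "x \<in> unit_cube" and A: "A \<in> sets cube_measure"
  shows "avg n (indicator A :: real^'d \<Rightarrow> real) x \<le> B * avg (pred_level n) (indicator A) x"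
proof -
  have "cell n x \<subseteq> cell (pred_level n) x" by (rule cell_antimono) (auto simp: le_fun_def)
  then have le: "measure cube_measure (cell n x \<inter> A) \<le> measure cube_measure (cell (pred_level n) x \<inter> A)"
    using x A by (intro cube.finite_measure_mono) auto
  have "1 / vol n \<le> B / vol (pred_level n)"
    using B vol_pos[of n] vol_pos[of "pred_level n"] by (simp add: field_simps)
  then have "measure cube_measure (cell n x \<inter> A) * (1 / vol n)
      \<le> measure cube_measure (cell (pred_level n) x \<inter> A) * (B / vol (pred_level n))"
    using le vol_pos[of n] by (intro mult_mono) auto
  then show ?thesis unfolding avg_indicator[OF x A] by (simp add: mult.commute)
qed

lemma mart_diff_zero_level:
  fixes f :: "('d \<Rightarrow> nat) \<Rightarrow> real^'d \<Rightarrow> complex"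
  shows "mart_diff (\<lambda>_. 0) f x = f (\<lambda>_. 0) x"
proof -
  have "finite J \<Longrightarrow> pdiff J (\<lambda>_. 0) f x = f (\<lambda>_. 0) x" for J :: "'d set"
    by (induction J rule: finite_induct) (simp_all add: pdiff_empty pdiff_insert)
  then show ?thesis by (simp add: mart_diff_eq_pdiff)
qed

text \<open>Since \<open>\<phi>\<close> is constant on cells, it does not notice if the indicator function of \<open>A\<close> is replaced by the
density of \<open>A\<close> in the cells, which is at most one half where \<open>\<phi>\<close> lives.\<close>

lemma integral_step_le_twice:
  fixes \<phi> :: "real^'d \<Rightarrow> real"
  assumes \<phi>: "step n \<phi>" "\<And>x. 0 \<le> \<phi> x" and A: "A \<in> sets cube_measure"
    and half: "\<And>x. x \<in> unit_cube \<Longrightarrow> \<phi> x \<noteq> 0 \<Longrightarrow> avg n (indicator A :: real^'d \<Rightarrow> real) x \<le> 1 / 2"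
  shows "(\<integral>x. \<phi> x \<partial>cube_measure) \<le> 2 * (\<integral>x. \<phi> x * indicator (- A) x \<partial>cube_measure)"
proof -
  have iA: "integrable cube_measure (indicator A :: real^'d \<Rightarrow> real)"
    using A by (simp add: less_top[symmetric])
  have i\<phi>: "integrable cube_measure \<phi>" by (rule step_integrable[OF \<phi>(1)])
  have i1: "integrable cube_measure (\<lambda>x. \<phi> x * indicator A x)" by (rule step_integrable_mult[OF \<phi>(1) iA])
  have i2: "integrable cube_measure (\<lambda>x. \<phi> x * avg n (indicator A) x)"
    by (rule step_integrable_mult[OF \<phi>(1) integrable_avg])
  have "(\<integral>x. \<phi> x * indicator A x \<partial>cube_measure) = (\<integral>x. \<phi> x * avg n (indicator A) x \<partial>cube_measure)"
    by (rule integral_mult_avg[OF \<phi>(1) iA, symmetric])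
  also have "\<dots> \<le> (\<integral>x. \<phi> x * (1 / 2) \<partial>cube_measure)"
  proof (rule integral_mono[OF i2])
    show "integrable cube_measure (\<lambda>x. \<phi> x * (1 / 2))" using i\<phi> by simp
    show "\<phi> x * avg n (indicator A) x \<le> \<phi> x * (1 / 2)" if "x \<in> space cube_measure" for x
      using half[of x] \<phi>(2)[of x] that by (cases "\<phi> x = 0") (auto intro: mult_left_mono)
  qed
  finally have le: "(\<integral>x. \<phi> x * indicator A x \<partial>cube_measure) \<le> (\<integral>x. \<phi> x \<partial>cube_measure) / 2" by simp
  have "\<phi> x * indicator (- A) x = \<phi> x - \<phi> x * indicator A x" for x by (simp add: indicator_def)
  then have "(\<integral>x. \<phi> x * indicator (- A) x \<partial>cube_measure) = (\<integral>x. \<phi> x \<partial>cube_measure) - (\<integral>x. \<phi> x * indicator A x \<partial>cube_measure)"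
    using i\<phi> i1 by simp
  then show ?thesis using le by simp
qed

text \<open>Outside \<open>e k\<close> the set \<open>\<Omega>\<close> fills at most half of each cell of level \<open>k\<close>, so the \<open>k\<close>-th squared difference
can be integrated over the complement of \<open>\<Omega>\<close> at the price of a factor \<open>2\<close>. On that complement the sum
over \<open>k\<close> is at most the squared square function.\<close>

lemma good_part_L2:
  fixes \<Omega> :: "(real^'d) set"
  assumes f: "f \<in> vilenkin_martingales p" and \<Omega>: "\<Omega> \<in> sets cube_measure"
    and e: "\<And>k. e k \<in> sets (vilenkin_filtration p (pred_level k))"
    and half: "\<And>k x. x \<in> unit_cube \<Longrightarrow> x \<notin> e k \<Longrightarrow> avg k (indicator \<Omega> :: real^'d \<Rightarrow> real) x \<le> 1 / 2"
  defines "g \<equiv> psum (\<lambda>k x. indicator (- e k) x * mart_diff k f x)"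
  shows "g \<in> vilenkin_martingales p"
    and "mart_L_norm 2 g \<le> epowr (2 * (\<integral>\<^sup>+x. (square_function f x)\<^sup>2 * indicator (- \<Omega>) x \<partial>cube_measure)) (1 / 2)"
proof -
  let ?a = "\<lambda>k x. indicator (- e k) x * mart_diff k f x"
  let ?J = "\<integral>\<^sup>+x. (square_function f x)\<^sup>2 * indicator (- \<Omega>) x \<partial>cube_measure"
  have e_step: "step (pred_level k) (\<lambda>x. x \<in> - e k)" for k
    using e[of k] by (simp add: sets_filtration_iff step_def)
  have fam: "diff_family ?a" by (rule diff_family_mart_diff[OF f e_step])
  then show g: "g \<in> vilenkin_martingales p" unfolding g_def by (rule psum_martingale)
  have iO: "integrable cube_measure (indicator (- \<Omega>) :: real^'d \<Rightarrow> real)"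
  proof -
    have "integrable cube_measure (\<lambda>x. 1 - indicator \<Omega> x :: real)"
      using \<Omega> by (intro Bochner_Integration.integrable_diff) (auto simp: less_top[symmetric])
    moreover have "1 - indicator \<Omega> x = (indicator (- \<Omega>) x :: real)" for x by (simp add: indicator_def)
    ultimately show ?thesis by simp
  qed
  have bound: "(\<integral>x. (cmod (?a k x))\<^sup>2 \<partial>cube_measure)
    \<le> 2 * (\<integral>x. (cmod (mart_diff k f x))\<^sup>2 * indicator (- \<Omega>) x \<partial>cube_measure)" for k
  proof -
    have st: "step k (?a k)" using fam by (simp add: diff_family_def)
    then have st2: "step k (\<lambda>x. (cmod (?a k x))\<^sup>2)" by (rule step_comp[where F = "\<lambda>z. (cmod z)\<^sup>2"])
    have std: "step k (\<lambda>x. (cmod (mart_diff k f x))\<^sup>2)"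
      using step_pdiff[OF f, of k UNIV] by (simp add: mart_diff_eq_pdiff step_def)
    have "(\<integral>x. (cmod (?a k x))\<^sup>2 \<partial>cube_measure) \<le> 2 * (\<integral>x. (cmod (?a k x))\<^sup>2 * indicator (- \<Omega>) x \<partial>cube_measure)"
    proof (rule integral_step_le_twice[OF st2 _ \<Omega>])
      show "avg k (indicator \<Omega> :: real^'d \<Rightarrow> real) x \<le> 1 / 2" if "x \<in> unit_cube" "(cmod (?a k x))\<^sup>2 \<noteq> 0" for x
        using that by (intro half) (auto simp: indicator_def split: if_splits)
    qed simp
    also have "(\<integral>x. (cmod (?a k x))\<^sup>2 * indicator (- \<Omega>) x \<partial>cube_measure)
      \<le> (\<integral>x. (cmod (mart_diff k f x))\<^sup>2 * indicator (- \<Omega>) x \<partial>cube_measure)"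
      by (intro integral_mono step_integrable_mult[OF st2 iO] step_integrable_mult[OF std iO])
         (auto simp: indicator_def)
    finally show ?thesis by simp
  qed
  have gn: "(\<integral>\<^sup>+x. ennreal ((cmod (g n x))\<^sup>2) \<partial>cube_measure) \<le> 2 * ?J" for n
  proof -
    obtain k where k: "n \<le> box_level k" using le_box_level by blast
    have stg: "step n (\<lambda>x. (cmod (g n x))\<^sup>2)" using martingale_step[OF g, of n] by (simp add: step_def)
    have std: "step j (\<lambda>x. (cmod (mart_diff j f x))\<^sup>2)" for j
      using step_pdiff[OF f, of j UNIV] by (simp add: mart_diff_eq_pdiff step_def)
    have "(\<integral>x. (cmod (g n x))\<^sup>2 \<partial>cube_measure) = (\<Sum>j | j \<le> n. \<integral>x. (cmod (?a j x))\<^sup>2 \<partial>cube_measure)"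
      unfolding g_def by (rule psum_orthogonal[OF fam])
    also have "\<dots> \<le> (\<Sum>j | j \<le> n. 2 * (\<integral>x. (cmod (mart_diff j f x))\<^sup>2 * indicator (- \<Omega>) x \<partial>cube_measure))"
      by (intro sum_mono bound)
    also have "\<dots> \<le> (\<Sum>j | j \<le> box_level k. 2 * (\<integral>x. (cmod (mart_diff j f x))\<^sup>2 * indicator (- \<Omega>) x \<partial>cube_measure))"
      using k by (intro sum_mono2 finite_le_fun) (auto intro: order_trans)
    also have "\<dots> = 2 * (\<integral>x. square_sum f k x * indicator (- \<Omega>) x \<partial>cube_measure)"
      unfolding square_sum_def sum_distrib_right sum_distrib_left[symmetric]
      by (subst Bochner_Integration.integral_sum) (auto intro: step_integrable_mult[OF std iO])
    finally have le: "(\<integral>x. (cmod (g n x))\<^sup>2 \<partial>cube_measure) \<le> 2 * (\<integral>x. square_sum f k x * indicator (- \<Omega>) x \<partial>cube_measure)" .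
    have "(\<integral>\<^sup>+x. ennreal ((cmod (g n x))\<^sup>2) \<partial>cube_measure) = ennreal (\<integral>x. (cmod (g n x))\<^sup>2 \<partial>cube_measure)"
      by (rule nn_integral_eq_integral[OF step_integrable[OF stg]]) simp
    also have "\<dots> \<le> ennreal (2 * (\<integral>x. square_sum f k x * indicator (- \<Omega>) x \<partial>cube_measure))"
      by (rule ennreal_leI[OF le])
    also have "\<dots> = 2 * ennreal (\<integral>x. square_sum f k x * indicator (- \<Omega>) x \<partial>cube_measure)"
      by (simp add: ennreal_mult')
    also have "ennreal (\<integral>x. square_sum f k x * indicator (- \<Omega>) x \<partial>cube_measure)
        = (\<integral>\<^sup>+x. ennreal (square_sum f k x * indicator (- \<Omega>) x) \<partial>cube_measure)"
      by (rule nn_integral_eq_integral[OF step_integrable_mult[OF step_square_sum[OF f] iO], symmetric])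
         (simp add: square_sum_nonneg)
    also have "2 * (\<integral>\<^sup>+x. ennreal (square_sum f k x * indicator (- \<Omega>) x) \<partial>cube_measure) \<le> 2 * ?J"
      using square_sum_le_square_function
      by (intro mult_left_mono nn_integral_mono) (auto simp: indicator_def)
    finally show ?thesis .
  qed
  show "mart_L_norm 2 g \<le> epowr (2 * ?J) (1 / 2)"
    unfolding mart_L_norm_def
  proof (rule SUP_least)
    fix n
    have "Lp_norm cube_measure 2 (g n) = epowr (\<integral>\<^sup>+x. ennreal ((cmod (g n x))\<^sup>2) \<partial>cube_measure) (1 / 2)"
      by (simp add: Lp_norm_def eLp_norm_def epowr_two ennreal_power)
    also have "\<dots> \<le> epowr (2 * ?J) (1 / 2)" by (rule epowr_mono[OF gn]) simp
    finally show "Lp_norm cube_measure 2 (g n) \<le> epowr (2 * ?J) (1 / 2)" .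
  qed
qed

end

section \<open>Operators with local support\<close>

locale vilenkin_operator = vilenkin_system p for p :: "'d::finite \<Rightarrow> nat \<Rightarrow> nat" +
  fixes V :: "(('d \<Rightarrow> nat) \<Rightarrow> real^'d \<Rightarrow> complex) \<Rightarrow> real^'d \<Rightarrow> complex"
  assumes operator: "martingale_operator p V"
    and bounded_L2: "bounded_operator_on (mart_L_space p 2) (mart_L_norm 2) (Lp_norm cube_measure 2) V"
    and support: "\<And>f e. \<lbrakk>f \<in> vilenkin_martingales p;
                \<forall>x\<in>unit_cube. f (\<lambda>_. 0) x = 0;
                \<forall>n. e n \<in> sets (vilenkin_filtration p (\<lambda>d. n d - 1)) \<and>
                    (\<forall>x\<in>unit_cube. mart_diff n f x = indicator (e n) x * mart_diff n f x)\<rbrakk>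
           \<Longrightarrow> AE x in cube_measure. norm (V f x) > 0 \<longrightarrow> x \<in> (\<Union>n \<in> UNIV - {\<lambda>_. 0}. e n)"
begin

lemma V_measurable: "f \<in> vilenkin_martingales p \<Longrightarrow> V f \<in> borel_measurable cube_measure"
  using operator by (simp add: martingale_operator_def)

text \<open>Chebyshev's inequality; \<open>J\<close> is a bound for the square of an \<open>L\<^sup>2\<close> norm.\<close>

lemma markov_L2:
  assumes h: "h \<in> borel_measurable cube_measure" and t: "0 < t"
    and le: "Lp_norm cube_measure 2 h \<le> ennreal C * epowr J (1 / 2)" and C: "0 \<le> C"
  shows "emeasure cube_measure {x \<in> unit_cube. t < cmod (h x)} \<le> ennreal (C\<^sup>2) * J * ennreal (1 / t\<^sup>2)"
proof -
  let ?I = "\<integral>\<^sup>+x. ennreal ((cmod (h x))\<^sup>2) \<partial>cube_measure"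
  note [measurable] = h
  have L: "Lp_norm cube_measure 2 h = epowr ?I (1 / 2)"
    by (simp add: Lp_norm_def eLp_norm_def epowr_two ennreal_power)
  have "?I = epowr (Lp_norm cube_measure 2 h) 2"
    unfolding L epowr_epowr by (simp add: epowr_one)
  also have "\<dots> \<le> epowr (ennreal C * epowr J (1 / 2)) 2" by (rule epowr_mono[OF le]) simp
  also have "\<dots> = ennreal (C\<^sup>2) * J"
    using C by (simp add: epowr_mult epowr_epowr epowr_one powr_numeral)
  finally have I: "?I \<le> ennreal (C\<^sup>2) * J" .
  have "emeasure cube_measure {x \<in> unit_cube. t < cmod (h x)}
      = (\<integral>\<^sup>+x. indicator {x \<in> unit_cube. t < cmod (h x)} x \<partial>cube_measure)"
  proof (rule nn_integral_indicator[symmetric])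
    have "{x \<in> space cube_measure. t < cmod (h x)} \<in> sets cube_measure" by measurable
    then show "{x \<in> unit_cube. t < cmod (h x)} \<in> sets cube_measure" by simp
  qed
  also have "\<dots> \<le> (\<integral>\<^sup>+x. ennreal ((cmod (h x))\<^sup>2) * ennreal (1 / t\<^sup>2) \<partial>cube_measure)"
  proof (rule nn_integral_mono)
    fix x
    show "indicator {x \<in> unit_cube. t < cmod (h x)} x \<le> ennreal ((cmod (h x))\<^sup>2) * ennreal (1 / t\<^sup>2)"
    proof (cases "t < cmod (h x)")
      case True
      then have "1 \<le> (cmod (h x))\<^sup>2 * (1 / t\<^sup>2)" using t by (simp add: power_mono)
      then have "ennreal 1 \<le> ennreal ((cmod (h x))\<^sup>2) * ennreal (1 / t\<^sup>2)"
        by (subst ennreal_mult'[symmetric]) (auto intro: ennreal_leI)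
      then show ?thesis by (simp add: indicator_def)
    qed simp
  qed
  also have "\<dots> = ?I * ennreal (1 / t\<^sup>2)" by (rule nn_integral_multc) measurable
  also have "\<dots> \<le> ennreal (C\<^sup>2) * J * ennreal (1 / t\<^sup>2)" by (rule mult_right_mono[OF I]) simp
  finally show ?thesis .
qed

text \<open>The martingale is split at \<open>\<Omega> = {S > t}\<close> into \<open>g\<close>, which is controlled in \<open>L\<^sup>2\<close> by \<open>good_part_L2\<close>, and
\<open>h\<close>, for which \<open>V h\<close> vanishes outside a set controlled by the strong maximal inequality. The constant
\<open>K\<close> adds up the constants of the two parts.\<close>

lemma truncated_weak_estimate:
  "\<exists>K::real. \<forall>f\<in>vilenkin_martingales p. \<forall>t>0. emeasure cube_measure {x \<in> unit_cube. t < cmod (V f x)}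
    \<le> ennreal K * (\<integral>\<^sup>+x. trunc_kernel t (square_function f x) \<partial>cube_measure)"
proof -
  obtain C0 where C0: "\<forall>f\<in>mart_L_space p 2. Lp_norm cube_measure 2 (V f) \<le> ennreal C0 * mart_L_norm 2 f"
    using bounded_L2 by (auto simp: bounded_operator_on_def)
  \<comment> \<open>The given constant might be negative; \<^const>\<open>ennreal\<close> then truncates it to \<open>0\<close>.\<close>
  define C where "C = max C0 0"
  have C: "Lp_norm cube_measure 2 (V f) \<le> ennreal C * mart_L_norm 2 f" if "f \<in> mart_L_space p 2" for f
  proof -
    have "ennreal C0 \<le> ennreal C" by (intro ennreal_leI) (simp add: C_def)
    then show ?thesis
      by (rule order_trans[OF bspec[OF C0 that] mult_right_mono]) simp
  qed
  have C_nonneg: "0 \<le> C" by (simp add: C_def)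
  obtain B where B: "1 \<le> B" "\<And>n. vol (pred_level n) \<le> B * vol n" using vol_pred_level by blast
  \<comment> \<open>Density at most \<open>\<theta>\<close> in a cell forces density at most \<open>1 / 2\<close> in each of its children.\<close>
  define \<theta> where "\<theta> = 1 / (2 * B)"
  have \<theta>: "0 < \<theta>" using B by (simp add: \<theta>_def)
  define c where "c = doob_const 2 ^ CARD('d) / \<theta>\<^sup>2"
  have c0: "0 \<le> c" by (simp add: c_def doob_const_def)
  define K where "K = c + 2 * C\<^sup>2"
  have main: "emeasure cube_measure {x \<in> unit_cube. t < cmod (V f x)}
    \<le> ennreal K * (\<integral>\<^sup>+x. trunc_kernel t (square_function f x) \<partial>cube_measure)"
    if f: "f \<in> vilenkin_martingales p" and t: "0 < t" for f t
  proof -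
    define S where "S = square_function f"
    have S [measurable]: "S \<in> borel_measurable cube_measure"
      unfolding S_def by (rule square_function_measurable[OF f])
    define \<Omega> where "\<Omega> = {x \<in> unit_cube. ennreal t < S x}"
    have "{x \<in> space cube_measure. ennreal t < S x} \<in> sets cube_measure" by measurable
    then have \<Omega>: "\<Omega> \<in> sets cube_measure" by (simp add: \<Omega>_def)
    let ?T = "\<integral>\<^sup>+x. trunc_kernel t (S x) \<partial>cube_measure"
    have T\<Omega>: "emeasure cube_measure \<Omega> \<le> ?T"
    proof -
      have "emeasure cube_measure \<Omega> = (\<integral>\<^sup>+x. indicator \<Omega> x \<partial>cube_measure)" using \<Omega> by simp
      also have "\<dots> \<le> ?T" by (intro nn_integral_mono) (auto simp: trunc_kernel_def \<Omega>_def indicator_def)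
      finally show ?thesis .
    qed
    define J where "J = (\<integral>\<^sup>+x. (S x)\<^sup>2 * indicator (- \<Omega>) x \<partial>cube_measure)"
    have TJ: "J * ennreal (1 / t\<^sup>2) \<le> ?T"
    proof -
      have "J * ennreal (1 / t\<^sup>2) = (\<integral>\<^sup>+x. (S x)\<^sup>2 * indicator (- \<Omega>) x * ennreal (1 / t\<^sup>2) \<partial>cube_measure)"
        unfolding J_def
      proof (rule nn_integral_multc[symmetric])
        have "(\<lambda>x. if ennreal t < S x then 0 else (S x)\<^sup>2) \<in> borel_measurable cube_measure" by measurable
        then show "(\<lambda>x. (S x)\<^sup>2 * indicator (- \<Omega>) x) \<in> borel_measurable cube_measure"
          by (rule measurable_cong[THEN iffD1, rotated]) (auto simp: \<Omega>_def indicator_def)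
      qed
      also have "\<dots> \<le> ?T" by (intro nn_integral_mono) (auto simp: trunc_kernel_def \<Omega>_def indicator_def)
      finally show ?thesis .
    qed
    \<comment> \<open>The hypothesis on \<open>V\<close> concerns martingales of finite norm only; on the complement of \<open>\<Omega>\<close> the square
      function is at most \<open>t\<close>, whether or not it is integrable.\<close>
    have Jfin: "J < \<infinity>"
    proof -
      have "J \<le> (\<integral>\<^sup>+x. (ennreal t)\<^sup>2 \<partial>(cube_measure :: (real^'d) measure))"
        unfolding J_def
      proof (rule nn_integral_mono)
        fix x :: "real^'d" assume "x \<in> space cube_measure"
        then show "(S x)\<^sup>2 * indicator (- \<Omega>) x \<le> (ennreal t)\<^sup>2"
          by (auto simp: \<Omega>_def indicator_def not_less intro!: power_mono)
      qed
      also have "\<dots> < \<infinity>" using cube.emeasure_space_1 t by (simp add: ennreal_power)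
      finally show ?thesis .
    qed
    define e where "e n = {x \<in> unit_cube. \<theta> < avg (pred_level n) (indicator \<Omega>) x}" for n
    define U where "U = {x \<in> unit_cube. \<exists>n. \<theta> < avg n (indicator \<Omega>) x}"
    have eU: "e n \<subseteq> U" for n by (auto simp: e_def U_def)
    have U_le: "emeasure cube_measure U \<le> ennreal c * ?T"
      unfolding U_def c_def
      by (rule order_trans[OF strong_maximal_weak_type[OF \<Omega> \<theta>] mult_left_mono[OF T\<Omega>]]) simp
    have e_sets: "e n \<in> sets (vilenkin_filtration p (pred_level n))" for n
      unfolding e_def by (rule superlevel_avg_in_filtration)
    have cK: "ennreal c \<le> ennreal K" unfolding K_def by (intro ennreal_leI) simp
    show ?thesis
    proof (cases "e (\<lambda>_. 0) = {}")
      case False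
      \<comment> \<open>Then \<open>\<Omega>\<close> has density more than \<open>\<theta>\<close> in the whole cube, and the trivial bound \<open>1\<close> for the measure on
        the left suffices.\<close>
      have idx0: "idx (\<lambda>_. 0) y d = 0" if "y \<in> unit_cube" for y d
        using idx_range[OF that, of "\<lambda>_. 0" d] by (simp add: vilenkin_prod_def)
      have "e (\<lambda>_. 0) = unit_cube"
      proof -
        obtain x where x: "x \<in> e (\<lambda>_. 0)" using False by blast
        have "y \<in> e (\<lambda>_. 0)" if y: "y \<in> unit_cube" for y
        proof -
          have "x \<in> unit_cube" using x by (simp add: e_def)
          then have "x \<in> cell (\<lambda>_. 0) y" using y by (simp add: cell_def idx0)
          then show ?thesis using x y stepD[OF step_avg y, of x "\<lambda>_. 0" "indicator \<Omega> :: real^'d \<Rightarrow> real"]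
            by (simp add: e_def)
        qed
        then show ?thesis by (auto simp: e_def)
      qed
      then have "U = unit_cube" using eU[of "\<lambda>_. 0"] by (auto simp: U_def)
      then have "emeasure cube_measure {x \<in> unit_cube. t < cmod (V f x)} \<le> emeasure cube_measure U"
        using sets.top[of "cube_measure :: (real^'d) measure"] by (intro emeasure_mono) auto
      also have "\<dots> \<le> ennreal K * ?T" using U_le mult_right_mono[OF cK] order_trans by auto
      finally show ?thesis by (simp add: S_def)
    next
      case True
      \<comment> \<open>Now the bad part \<open>h\<close> vanishes at level \<open>0\<close>, as the support hypothesis requires.\<close>
      define g where "g = psum (\<lambda>k x. indicator (- e k) x * mart_diff k f x)"
      define h where "h = (\<lambda>n x. f n x - g n x)"
      have half: "avg k (indicator \<Omega> :: real^'d \<Rightarrow> real) x \<le> 1 / 2" if x: "x \<in> unit_cube" "x \<notin> e k" for k x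
      proof -
        have "avg (pred_level k) (indicator \<Omega> :: real^'d \<Rightarrow> real) x \<le> \<theta>" using x by (simp add: e_def)
        then have "B * avg (pred_level k) (indicator \<Omega> :: real^'d \<Rightarrow> real) x \<le> B * \<theta>"
          using B by (intro mult_left_mono) auto
        also have "B * \<theta> = 1 / 2" using B by (simp add: \<theta>_def)
        finally show ?thesis using avg_indicator_parent[OF B(2) x(1) \<Omega>, of k] by linarith
      qed
      have g: "g \<in> vilenkin_martingales p" and gL: "mart_L_norm 2 g \<le> epowr (2 * J) (1 / 2)"
        using good_part_L2[OF f \<Omega> e_sets half] unfolding g_def J_def S_def by blast+
      have gS: "g \<in> mart_L_space p 2"
      proof -
        have "epowr (2 * J) (1 / 2) < \<infinity>" using Jfin
          by (cases J) (auto simp: ennreal_mult'[symmetric] epowr_ennreal simp flip: ennreal_numeral)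
        then show ?thesis using g gL by (auto simp: mart_L_space_def)
      qed
      have h: "h \<in> vilenkin_martingales p" unfolding h_def by (rule martingale_diff[OF f g])
      have hd: "mart_diff n h x = indicator (e n) x * mart_diff n f x" for n x
      proof -
        have "mart_diff n h x = mart_diff n f x - mart_diff n g x"
          unfolding h_def mart_diff_eq_pdiff by (rule pdiff_diff)
        also have "mart_diff n g x = indicator (- e n) x * mart_diff n f x" unfolding g_def by (rule mart_diff_psum)
        finally show ?thesis by (simp add: indicator_def)
      qed
      have h0: "h (\<lambda>_. 0) x = 0" for x
        using hd[of "\<lambda>_. 0" x] True by (simp add: mart_diff_zero_level)
      have "AE x in cube_measure. norm (V h x) > 0 \<longrightarrow> x \<in> (\<Union>n \<in> UNIV - {\<lambda>_. 0}. e n)"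
      proof (rule support[OF h])
        show "\<forall>x\<in>unit_cube. h (\<lambda>_. 0) x = 0" using h0 by simp
        show "\<forall>n. e n \<in> sets (vilenkin_filtration p (\<lambda>d. n d - 1)) \<and>
            (\<forall>x\<in>unit_cube. mart_diff n h x = indicator (e n) x * mart_diff n h x)"
          using e_sets by (simp add: hd indicator_def)
      qed
      moreover have "AE x in cube_measure. V f x = V g x + V h x"
      proof -
        have "AE x in cube_measure. V (\<lambda>n y. g n y + h n y) x = V g x + V h x"
          using operator g h by (simp add: martingale_operator_def)
        moreover have "(\<lambda>n y. g n y + h n y) = f" by (simp add: h_def)
        ultimately show ?thesis by simp
      qed
      ultimately have ae: "AE x in cube_measure. x \<in> {x \<in> unit_cube. t < cmod (V f x)}
          \<longrightarrow> x \<in> U \<union> {x \<in> unit_cube. t < cmod (V g x)}"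
        by eventually_elim (use eU in force)
      have Us: "U \<in> sets cube_measure"
      proof -
        have "U = (\<Union>n. {x \<in> unit_cube. \<theta> < avg n (indicator \<Omega>) x})" by (auto simp: U_def)
        moreover have "(\<Union>n\<in>UNIV. {x \<in> unit_cube. \<theta> < avg n (indicator \<Omega>) x}) \<in> sets cube_measure"
          by (rule sets.countable_UN'') (auto intro: sets_filtration_cube[OF superlevel_avg_in_filtration])
        ultimately show ?thesis by simp
      qed
      note [measurable] = V_measurable[OF g]
      have "{x \<in> space cube_measure. t < cmod (V g x)} \<in> sets cube_measure" by measurable
      then have gs: "{x \<in> unit_cube. t < cmod (V g x)} \<in> sets cube_measure" by simp
      have "emeasure cube_measure {x \<in> unit_cube. t < cmod (V f x)}
          \<le> emeasure cube_measure (U \<union> {x \<in> unit_cube. t < cmod (V g x)})"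
        using ae Us gs by (intro emeasure_mono_AE) auto
      also have "\<dots> \<le> emeasure cube_measure U + emeasure cube_measure {x \<in> unit_cube. t < cmod (V g x)}"
        by (rule emeasure_subadditive[OF Us gs])
      also have "\<dots> \<le> ennreal c * ?T + ennreal (2 * C\<^sup>2) * ?T"
      proof (rule add_mono[OF U_le])
        have "Lp_norm cube_measure 2 (V g) \<le> ennreal C * epowr (2 * J) (1 / 2)"
          using C[OF gS] mult_left_mono[OF gL] order_trans by auto
        from markov_L2[OF V_measurable[OF g] t this C_nonneg]
        have "emeasure cube_measure {x \<in> unit_cube. t < cmod (V g x)} \<le> ennreal (C\<^sup>2) * (2 * J) * ennreal (1 / t\<^sup>2)" .
        also have "\<dots> = ennreal (2 * C\<^sup>2) * (J * ennreal (1 / t\<^sup>2))"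
          by (simp add: ennreal_mult' ac_simps)
        also have "\<dots> \<le> ennreal (2 * C\<^sup>2) * ?T" by (rule mult_left_mono[OF TJ]) simp
        finally show "emeasure cube_measure {x \<in> unit_cube. t < cmod (V g x)} \<le> ennreal (2 * C\<^sup>2) * ?T" .
      qed
      also have "\<dots> = ennreal K * ?T"
        using c0 by (simp add: K_def distrib_right ennreal_plus)
      finally show ?thesis by (simp add: S_def)
    qed
  qed
  then show ?thesis by blast
qed

lemma operator_square_function_bound:
  assumes q: "0 < q" "q < 2"
  obtains K :: real where "0 \<le> K" "\<And>f. f \<in> vilenkin_martingales p \<Longrightarrow>
    (\<integral>\<^sup>+x. ennreal (cmod (V f x) powr q) \<partial>cube_measure)
    \<le> ennreal K * (\<integral>\<^sup>+x. epowr (square_function f x) q \<partial>cube_measure)"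
proof -
  obtain K0 where K0: "\<And>f t. f \<in> vilenkin_martingales p \<Longrightarrow> 0 < t \<Longrightarrow>
      emeasure cube_measure {x \<in> unit_cube. t < cmod (V f x)}
      \<le> ennreal K0 * (\<integral>\<^sup>+x. trunc_kernel t (square_function f x) \<partial>cube_measure)"
    using truncated_weak_estimate by blast
  define K where "K = max 0 K0 * (1 + q / (2 - q))"
  have K: "ennreal K = ennreal K0 * ennreal (1 + q / (2 - q))"
    using q by (simp add: K_def ennreal_mult max_def ennreal_neg)
  show ?thesis
  proof (rule that[of K])
    show "0 \<le> K" using q by (simp add: K_def)
    fix f assume f: "f \<in> vilenkin_martingales p"
    note [measurable] = V_measurable[OF f]
    show "(\<integral>\<^sup>+x. ennreal (cmod (V f x) powr q) \<partial>cube_measure)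
      \<le> ennreal K * (\<integral>\<^sup>+x. epowr (square_function f x) q \<partial>cube_measure)"
      unfolding K
    proof (rule truncated_estimate_integral[OF _ q])
      show "sigma_finite_measure (cube_measure :: (real^'d) measure)" ..
      show "square_function f \<in> borel_measurable cube_measure" by (rule square_function_measurable[OF f])
    qed (use K0[OF f] in auto)
  qed
qed

lemma bounded_on_hardy:
  assumes q: "0 < q" "q < 2"
  shows "bounded_operator_on (mart_H_space p q) (mart_H_norm q) (Lp_norm cube_measure q) V"
proof -
  obtain K where K: "0 \<le> K" "\<And>f. f \<in> vilenkin_martingales p \<Longrightarrow>
    (\<integral>\<^sup>+x. ennreal (cmod (V f x) powr q) \<partial>cube_measure)
    \<le> ennreal K * (\<integral>\<^sup>+x. epowr (square_function f x) q \<partial>cube_measure)"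
    using operator_square_function_bound[OF q] by blast
  have "Lp_norm cube_measure q (V f) \<le> ennreal (K powr (1 / q)) * mart_H_norm q f"
    if f: "f \<in> mart_H_space p q" for f
  proof -
    have "Lp_norm cube_measure q (V f) = epowr (\<integral>\<^sup>+x. ennreal (cmod (V f x) powr q) \<partial>cube_measure) (1 / q)"
      by (simp add: Lp_norm_def eLp_norm_def epowr_ennreal)
    also have "\<dots> \<le> epowr (ennreal K * (\<integral>\<^sup>+x. epowr (square_function f x) q \<partial>cube_measure)) (1 / q)"
      using f q by (intro epowr_mono K(2)) (auto simp: mart_H_space_def)
    also have "\<dots> = ennreal (K powr (1 / q)) * mart_H_norm q f"
      using K(1) q by (simp add: epowr_mult mart_H_norm_def eLp_norm_def)
    finally show ?thesis .
  qed
  then show ?thesis unfolding bounded_operator_on_def by blast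
qed

lemma bounded_on_L:
  assumes r: "1 < r" "r < 2"
  shows "bounded_operator_on (mart_L_space p r) (mart_L_norm r) (Lp_norm cube_measure r) V"
proof -
  obtain K where K: "0 \<le> K" "\<And>f. f \<in> vilenkin_martingales p \<Longrightarrow>
    (\<integral>\<^sup>+x. ennreal (cmod (V f x) powr r) \<partial>cube_measure)
    \<le> ennreal K * (\<integral>\<^sup>+x. epowr (square_function f x) r \<partial>cube_measure)"
    using operator_square_function_bound[of r] r by auto
  define c where "c = square_const r ^ CARD('d)"
  have c: "0 \<le> c" using r by (simp add: c_def square_const_def doob_const_def)
  have "Lp_norm cube_measure r (V f) \<le> ennreal ((K * c) powr (1 / r)) * mart_L_norm r f"
    if f: "f \<in> mart_L_space p r" for f
  proof -
    let ?R = "SUP n. \<integral>\<^sup>+x. ennreal (cmod (f n x) powr r) \<partial>cube_measure"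
    have f': "f \<in> vilenkin_martingales p" using f by (simp add: mart_L_space_def)
    have "(\<integral>\<^sup>+x. ennreal (cmod (V f x) powr r) \<partial>cube_measure) \<le> ennreal K * (ennreal c * ?R)"
      unfolding c_def using r
      by (intro order_trans[OF K(2)[OF f']] mult_left_mono square_function_le_martingale f') auto
    also have "\<dots> = ennreal (K * c) * ?R" using K c by (simp add: ennreal_mult mult.assoc)
    finally have le: "(\<integral>\<^sup>+x. ennreal (cmod (V f x) powr r) \<partial>cube_measure) \<le> ennreal (K * c) * ?R" .
    have "Lp_norm cube_measure r (V f) = epowr (\<integral>\<^sup>+x. ennreal (cmod (V f x) powr r) \<partial>cube_measure) (1 / r)"
      by (simp add: Lp_norm_def eLp_norm_def epowr_ennreal)
    also have "\<dots> \<le> epowr (ennreal (K * c) * ?R) (1 / r)" using r by (intro epowr_mono le) auto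
    also have "\<dots> = ennreal ((K * c) powr (1 / r)) * epowr ?R (1 / r)"
      using K c r by (intro epowr_mult) auto
    also have "ennreal ((K * c) powr (1 / r)) * epowr ?R (1 / r) \<le> ennreal ((K * c) powr (1 / r)) * mart_L_norm r f"
    proof (rule mult_left_mono)
      have "epowr ?R (1 / r) \<le> (SUP n. epowr (\<integral>\<^sup>+x. ennreal (cmod (f n x) powr r) \<partial>cube_measure) (1 / r))"
        using r by (intro epowr_SUP_le) simp
      also have "\<dots> = mart_L_norm r f"
        by (simp add: mart_L_norm_def Lp_norm_def eLp_norm_def epowr_ennreal)
      finally show "epowr ?R (1 / r) \<le> mart_L_norm r f" .
    qed simp
    finally show ?thesis .
  qed
  then show ?thesis unfolding bounded_operator_on_def by blast
qed

end

theorem theorem6: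
  fixes p :: "'d::finite \<Rightarrow> nat \<Rightarrow> nat"
    and V :: "(('d \<Rightarrow> nat) \<Rightarrow> real^'d \<Rightarrow> complex) \<Rightarrow> real^'d \<Rightarrow> complex"
  assumes "2 \<le> CARD('d)"
    and "\<And>d. vilenkin_sequence (p d)"
    and "martingale_operator p V"
    and "bounded_operator_on (mart_L_space p 2) (mart_L_norm 2) (Lp_norm cube_measure 2) V"
    and "\<And>f e. \<lbrakk>f \<in> vilenkin_martingales p;
                \<forall>x\<in>unit_cube. f (\<lambda>_. 0) x = 0;
                \<forall>n. e n \<in> sets (vilenkin_filtration p (\<lambda>d. n d - 1)) \<and>
                    (\<forall>x\<in>unit_cube. mart_diff n f x = indicator (e n) x * mart_diff n f x)\<rbrakk>
           \<Longrightarrow> AE x in cube_measure. norm (V f x) > 0 \<longrightarrow> x \<in> (\<Union>n \<in> UNIV - {\<lambda>_. 0}. e n)"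
  shows "(\<forall>q::real. 0 < q \<and> q \<le> 1 \<longrightarrow>
            bounded_operator_on (mart_H_space p q) (mart_H_norm q) (Lp_norm cube_measure q) V) \<and>
         (\<forall>r::real. 1 < r \<and> r \<le> 2 \<longrightarrow>
            bounded_operator_on (mart_L_space p r) (mart_L_norm r) (Lp_norm cube_measure r) V)"
proof -
  interpret vilenkin_operator p V
    using assms(2-5) by unfold_locales
  have "bounded_operator_on (mart_L_space p r) (mart_L_norm r) (Lp_norm cube_measure r) V"
    if "1 < r" "r \<le> 2" for r
    using bounded_on_L[of r] assms(4) that by (cases "r = 2") auto
  then show ?thesis using bounded_on_hardy by auto
qed

end
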